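(* Let $n\in\mathbb N$ and $\mathbf t=(t_1,\dots,t_n)$ with all $t_j>0$. Then $\mathcal R(\mathbb C^n,\sigma_{\mathbf t})$ is a Toeplitz algebra. More precisely, there is an $\alpha$-invariant subspace $\mathcal D_0^{\mathbf t}\subset \mathrm{BUC}(\mathbb C^n)$ such that $$\mathcal R(\mathbb C^n,\sigma_{\mathbf t})=\mathcal T^{\mathbf t}(\mathcal D_0^{\mathbf t}):=C^\ast\big(T_f^{\mathbf t}: f\in\mathcal D_0^{\mathbf t}\big).$$
   Context: Write $\langle z,w\rangle_{\mathbf t}=\sum_{j=1}^n z_j\overline{w_j}/t_j$ and $\sigma_{\mathbf t}(w,z)=\operatorname{Im}\langle w,z\rangle_{\mathbf t}$ on $\mathbb C^n$. Let $\mu_{\mathbf t}$ be the probability measure $d\mu_{\mathbf t}(z)=\frac{1}{\pi^n t_1\cdots t_n}e^{-\sum_j|z_j|^2/t_j}\,dV(z)$ on $\mathbb C^n$ ($V$ Lebesgue measure), and $F_{\mathbf t}^2=L^2(\mathbb C^n,\mu_{\mathbf t})\cap\mathrm{Hol}(\mathbb C^n)$ the Fock-Bargmann space, with orthogonal projection $P^{\mathbf t}:L^2(\mathbb C^n,\mu_{\mathbf t})\to F_{\mathbf t}^2$. For measurable $\varphi:\mathbb C^n\to\mathbb C$ the Toeplitz operator is $T^{\mathbf t}_\varphi g=P^{\mathbf t}(\varphi g)$ with domain $\{g\in F_{\mathbf t}^2:\varphi g\in L^2(\mathbb C^n,\mu_{\mathbf t})\}$. The operators $T^{\mathbf t}_{2\sigma_{\mathbf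 t}(\cdot,z)}$, $z\in\mathbb C^n$, are self-adjoint. The resolvent algebra (in Fock-Bargmann representation) $\mathcal R(\mathbb C^n,\sigma_{\mathbf t})\subset\mathcal L(F^2_{\mathbf t})$ is the $C^\ast$ algebra generated by all resolvents $(i\lambda-T^{\mathbf t}_{2\sigma_{\mathbf t}(\cdot,z)})^{-1}$ with $\lambda\in\mathbb R\setminus\{0\}$ and $z\in\mathbb C^n$. $\mathrm{BUC}(\mathbb C^n)$ is the space of bounded uniformly continuous functions $\mathbb C^n\to\mathbb C$. For a function $f$ put $\alpha_z(f)(w)=f(w-z)$; a subspace of functions is $\alpha$-invariant if it is mapped into itself by all $\alpha_z$, $z\in\mathbb C^n$. $C^\ast(\cdot)$ denotes the generated $C^\ast$ algebra. *)

theory Defs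
  imports "HOL-Analysis.Analysis"
begin

text \<open>The index type \<open>'n\<close> plays the role of \<open>{1,\<dots>,n}\<close>; the space \<open>\<complex>\<^sup>n\<close> is \<open>complex ^ 'n\<close>, whose
  \<open>lborel\<close> is Lebesgue measure on \<open>\<real>\<^sup>2\<^sup>n\<close>.\<close>

section \<open>The Fock-Bargmann space\<close>

definition tform :: "real ^ 'n \<Rightarrow> complex ^ 'n \<Rightarrow> complex ^ 'n \<Rightarrow> complex" where
  "tform t z w = (\<Sum>j\<in>UNIV. z $ j * cnj (w $ j) / of_real (t $ j))"

definition sigma_t :: "real ^ 'n \<Rightarrow> complex ^ 'n \<Rightarrow> complex ^ 'n \<Rightarrow> real" where
  "sigma_t t w z = Im (tform t w z)"

definition fock_measure :: "real ^ 'n \<Rightarrow> (complex ^ 'n) measure" where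
  "fock_measure t = density lborel (\<lambda>z. ennreal
     (1 / (pi ^ CARD('n) * (\<Prod>j\<in>UNIV. t $ j)) * exp (- (\<Sum>j\<in>UNIV. (cmod (z $ j))\<^sup>2 / t $ j))))"

text \<open>Square-integrable functions themselves, not classes modulo null sets.\<close>

definition L2_fun :: "real ^ 'n \<Rightarrow> (complex ^ 'n \<Rightarrow> complex) set" where
  "L2_fun t = {f \<in> borel_measurable (fock_measure t).
                 integrable (fock_measure t) (\<lambda>w. (cmod (f w))\<^sup>2)}"

definition L2_inner ::
    "real ^ 'n \<Rightarrow> (complex ^ 'n \<Rightarrow> complex) \<Rightarrow> (complex ^ 'n \<Rightarrow> complex) \<Rightarrow> complex" where
  "L2_inner t f g = (LINT w|fock_measure t. f w * cnj (g w))"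

definition L2_nrm :: "real ^ 'n \<Rightarrow> (complex ^ 'n \<Rightarrow> complex) \<Rightarrow> real" where
  "L2_nrm t f = sqrt (LINT w|fock_measure t. (cmod (f w))\<^sup>2)"

text \<open>Entire functions on \<open>\<complex>\<^sup>n\<close>: the Frechet derivative exists everywhere and is complex linear.\<close>

definition entire :: "(complex ^ 'n \<Rightarrow> complex) set" where
  "entire = {f. \<forall>z. \<exists>f'. (f has_derivative f') (at z) \<and> (\<forall>c v. f' (c *s v) = c * f' v)}"

text \<open>A continuous function is determined by its class modulo null sets, so \<open>fock t\<close> is the
  Fock-Bargmann space itself and equality of its elements is equality of functions.\<close>

definition fock :: "real ^ 'n \<Rightarrow> (complex ^ 'n \<Rightarrow> complex) set" where
  "fock t = L2_fun t \<inter> entire"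

definition fock_proj :: "real ^ 'n \<Rightarrow> (complex ^ 'n \<Rightarrow> complex) \<Rightarrow> complex ^ 'n \<Rightarrow> complex" where
  "fock_proj t f = (THE h. h \<in> fock t \<and> (\<forall>k\<in>fock t. L2_inner t (\<lambda>w. f w - h w) k = 0))"

section \<open>Operators on the Fock-Bargmann space\<close>

type_synonym 'n fock_op = "(complex ^ 'n \<Rightarrow> complex) \<Rightarrow> complex ^ 'n \<Rightarrow> complex"

text \<open>Operators are extensional functions: they take the value \<open>undefined\<close> off their domain, so that
  operators with the same domain agree as soon as they agree on that domain.\<close>

definition bounded_ops :: "real ^ 'n \<Rightarrow> 'n fock_op set" where
  "bounded_ops t = {A \<in> fock t \<rightarrow>\<^sub>E fock t.
     (\<forall>f\<in>fock t. \<forall>g\<in>fock t. A (\<lambda>w. f w + g w) = (\<lambda>w. A f w + A g w)) \<and>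
     (\<forall>c. \<forall>f\<in>fock t. A (\<lambda>w. c * f w) = (\<lambda>w. c * A f w)) \<and>
     (\<exists>C. \<forall>f\<in>fock t. L2_nrm t (A f) \<le> C * L2_nrm t f)}"

definition op_zero :: "real ^ 'n \<Rightarrow> 'n fock_op" where
  "op_zero t = (\<lambda>f\<in>fock t. \<lambda>w. 0)"

definition op_add :: "real ^ 'n \<Rightarrow> 'n fock_op \<Rightarrow> 'n fock_op \<Rightarrow> 'n fock_op" where
  "op_add t A B = (\<lambda>f\<in>fock t. \<lambda>w. A f w + B f w)"

definition op_scale :: "real ^ 'n \<Rightarrow> complex \<Rightarrow> 'n fock_op \<Rightarrow> 'n fock_op" where
  "op_scale t c A = (\<lambda>f\<in>fock t. \<lambda>w. c * A f w)"

definition op_adj :: "real ^ 'n \<Rightarrow> 'n fock_op \<Rightarrow> 'n fock_op" where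
  "op_adj t A = (THE B. B \<in> bounded_ops t \<and>
     (\<forall>f\<in>fock t. \<forall>g\<in>fock t. L2_inner t (A f) g = L2_inner t f (B g)))"

definition op_norm :: "real ^ 'n \<Rightarrow> 'n fock_op \<Rightarrow> real" where
  "op_norm t A = Sup {L2_nrm t (A f) | f. f \<in> fock t \<and> L2_nrm t f \<le> 1}"

text \<open>A \<open>C\<^sup>*\<close>-subalgebra of the bounded operators need not contain the identity.
  The operator product is composition, \<open>compose (fock t) A B = (\<lambda>f\<in>fock t. A (B f))\<close>.\<close>

definition cstar_subalgebra :: "real ^ 'n \<Rightarrow> 'n fock_op set \<Rightarrow> bool" where
  "cstar_subalgebra t \<A> \<longleftrightarrow>
     \<A> \<subseteq> bounded_ops t \<and>
     op_zero t \<in> \<A> \<and>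
     (\<forall>A\<in>\<A>. \<forall>B\<in>\<A>. op_add t A B \<in> \<A>) \<and>
     (\<forall>c. \<forall>A\<in>\<A>. op_scale t c A \<in> \<A>) \<and>
     (\<forall>A\<in>\<A>. \<forall>B\<in>\<A>. compose (fock t) A B \<in> \<A>) \<and>
     (\<forall>A\<in>\<A>. op_adj t A \<in> \<A>) \<and>
     (\<forall>X. \<forall>A\<in>bounded_ops t. (\<forall>k. X k \<in> \<A>) \<longrightarrow>
        (\<lambda>k::nat. op_norm t (op_add t (X k) (op_scale t (-1) A))) \<longlonglongrightarrow> 0 \<longrightarrow> A \<in> \<A>)"

definition cstar_generated :: "real ^ 'n \<Rightarrow> 'n fock_op set \<Rightarrow> 'n fock_op set" where
  "cstar_generated t S = cstar_subalgebra t hull S"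

section \<open>Toeplitz operators and the resolvent algebra\<close>

definition toeplitz_dom ::
    "real ^ 'n \<Rightarrow> (complex ^ 'n \<Rightarrow> complex) \<Rightarrow> (complex ^ 'n \<Rightarrow> complex) set" where
  "toeplitz_dom t \<phi> = {g \<in> fock t. (\<lambda>w. \<phi> w * g w) \<in> L2_fun t}"

definition toeplitz :: "real ^ 'n \<Rightarrow> (complex ^ 'n \<Rightarrow> complex) \<Rightarrow> 'n fock_op" where
  "toeplitz t \<phi> = (\<lambda>g\<in>toeplitz_dom t \<phi>. fock_proj t (\<lambda>w. \<phi> w * g w))"

text \<open>The inverse of \<open>c - T\<^sub>\<phi>\<close>, regarded as a map from the domain of \<open>T\<^sub>\<phi>\<close> to the whole space;
  meaningful when that map is bijective, as it is for self-adjoint \<open>T\<^sub>\<phi>\<close> and non-real \<open>c\<close>.\<close>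

definition toeplitz_resolvent ::
    "real ^ 'n \<Rightarrow> (complex ^ 'n \<Rightarrow> complex) \<Rightarrow> complex \<Rightarrow> 'n fock_op" where
  "toeplitz_resolvent t \<phi> c =
     restrict (the_inv_into (toeplitz_dom t \<phi>) (\<lambda>g w. c * g w - toeplitz t \<phi> g w)) (fock t)"

definition resolvent_algebra :: "real ^ 'n \<Rightarrow> 'n fock_op set" where
  "resolvent_algebra t = cstar_generated t
     {toeplitz_resolvent t (\<lambda>w. of_real (2 * sigma_t t w z)) (\<i> * of_real l) | l z. l \<noteq> 0}"

definition toeplitz_algebra :: "real ^ 'n \<Rightarrow> (complex ^ 'n \<Rightarrow> complex) set \<Rightarrow> 'n fock_op set" where
  "toeplitz_algebra t D = cstar_generated t (toeplitz t ` D)"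

section \<open>Spaces of symbols\<close>

definition BUC :: "(complex ^ 'n \<Rightarrow> complex) set" where
  "BUC = {f. bounded (range f) \<and> uniformly_continuous_on UNIV f}"

definition complex_subspace :: "(complex ^ 'n \<Rightarrow> complex) set \<Rightarrow> bool" where
  "complex_subspace D \<longleftrightarrow> (\<lambda>w. 0) \<in> D \<and> (\<forall>f\<in>D. \<forall>g\<in>D. (\<lambda>w. f w + g w) \<in> D) \<and>
     (\<forall>c. \<forall>f\<in>D. (\<lambda>w. c * f w) \<in> D)"

definition shift :: "complex ^ 'n \<Rightarrow> (complex ^ 'n \<Rightarrow> complex) \<Rightarrow> complex ^ 'n \<Rightarrow> complex" where
  "shift z f = (\<lambda>w. f (w - z))"

definition shift_invariant :: "(complex ^ 'n \<Rightarrow> complex) set \<Rightarrow> bool" where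
  "shift_invariant D \<longleftrightarrow> (\<forall>z. shift z ` D \<subseteq> D)"

end

theory Submission
  imports Defs "HOL-Probability.Distributions" "HOL-Complex_Analysis.Cauchy_Integral_Formula"
begin

text \<open>The Toeplitz operator with symbol \<open>2 \<sigma>\<^sub>t(\<cdot>, z)\<close> generates the one-parameter group of Weyl operators
  \<open>W\<^sub>s f(u) = exp (- s \<langle>u,z\<rangle> - s\<^sup>2 |z|\<^sup>2 / 2) f(u + s z)\<close>, so its resolvent at \<open>i l\<close>, \<open>l > 0\<close>, is \<open>- i\<close> times
  the integral of \<open>exp (- l s) W\<^sub>s\<close> over \<open>s \<ge> 0\<close>. Each \<open>W\<^sub>s\<close> is itself a Toeplitz operator, with symbol
  \<open>exp (s\<^sup>2 |z|\<^sup>2 / 2 - 2 i s \<sigma>\<^sub>t(\<cdot>, z))\<close>. The growth in \<open>s\<close> keeps the resolvent from being a Toeplitz operator with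
  the integrated symbol, but for \<open>k\<close> continuous and compactly supported the integral of \<open>k(s) W\<^sub>s\<close> over
  \<open>s \<ge> 0\<close> is one, with a symbol in BUC. Its operator norm is at most the \<open>L\<^sup>1\<close> norm of \<open>k\<close>, and in \<open>L\<^sup>1(0,\<infinity>)\<close>
  the span of the exponentials \<open>exp (- l s)\<close> and the compactly supported continuous functions have the
  same closure. As symbol space one may take all BUC functions whose translates have Toeplitz operators
  in the resolvent algebra.\<close>


section \<open>The Gaussian measure\<close>

text \<open>Toeplitz quantization is multiplication followed by projection, so it sees the unitary
  multiplication by \<open>exp (- 2 i s \<sigma>_t(., z))\<close> only through its compression,
  which is \<open>W_s\<close> damped by \<open>exp (- s^2 |z|^2 / 2)\<close>. The growing factor in
  the symbols compensates exactly this loss, and that can be afforded only while \<open>s\<close>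
  stays bounded. The same dilation settles the main obstacle: the domain of the unbounded operator
  consists of those \<open>g\<close> whose product with the symbol is square integrable, whereas
  what is known about a Laplace integral is the regularity of its Weyl orbit. Comparing norms in the
  dilation transfers one to the other. Resolvents are then identified by exhibiting a preimage,
  injectivity being a consequence of the real symbol. Requiring all translates in the symbol space
  makes invariance automatic and remains checkable, because translating a symbol multiplies
  \<open>k\<close> by a character, which preserves the class of admissible \<open>k\<close>.\<close>

lemma tform_simps:
  "tform t (x + y) w = tform t x w + tform t y w"
  "tform t w (x + y) = tform t w x + tform t w y"
  "tform t (x - y) w = tform t x w - tform t y w"
  "tform t w (x - y) = tform t w x - tform t w y"
  "tform t (- x) w = - tform t x w"
  "tform t w (- x) = - tform t w x"
  "tform t (r *\<^sub>R x) w = of_real r * tform t x w"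
  "tform t w (r *\<^sub>R x) = of_real r * tform t w x"
  "tform t (c *s x) w = c * tform t x w"
  "tform t 0 w = 0"
  "tform t w 0 = 0"
  by (simp_all add: tform_def sum.distrib sum_subtractf sum_negf sum_distrib_left algebra_simps
      add_divide_distrib diff_divide_distrib scaleR_conv_of_real[where 'a = complex])

lemma cnj_tform: "cnj (tform t x y) = tform t y x"
  by (simp add: tform_def mult.commute)

lemma Re_tform_commute: "Re (tform t y x) = Re (tform t x y)"
  by (subst cnj_tform[symmetric]) simp

definition qform :: "real ^ 'n \<Rightarrow> complex ^ 'n \<Rightarrow> real" where
  "qform t z = (\<Sum>j\<in>UNIV. (cmod (z $ j))\<^sup>2 / t $ j)"

lemma tform_self: "tform t z z = of_real (qform t z)"
  by (simp add: tform_def qform_def complex_norm_square[symmetric])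

lemma qform_add: "qform t (x + y) = qform t x + qform t y + 2 * Re (tform t x y)"
proof -
  have "Re (tform t (x + y) (x + y)) = Re (tform t x x) + Re (tform t y y) + 2 * Re (tform t x y)"
    by (simp add: tform_simps Re_tform_commute[of t y x])
  then show ?thesis by (simp add: tform_self)
qed

lemma qform_scaleR: "qform t (r *\<^sub>R x) = r\<^sup>2 * qform t x"
  by (simp add: qform_def sum_distrib_left power_mult_distrib)

lemma qform_minus: "qform t (- x) = qform t x"
  by (simp add: qform_def)

lemma qform_diff: "qform t (x - y) = qform t x + qform t y - 2 * Re (tform t x y)"
  using qform_add[of t x "-y"] by (simp add: qform_minus tform_simps)

lemma qform_unit: "cmod c = 1 \<Longrightarrow> qform t (c *s x) = qform t x"
  by (simp add: qform_def norm_mult)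

lemma continuous_on_tform: "continuous_on UNIV (\<lambda>p. tform t (fst p) (snd p))"
  unfolding tform_def divide_inverse by (intro continuous_intros)

lemma borel_measurable_tform [measurable (raw)]:
  assumes "f \<in> borel_measurable M" "g \<in> borel_measurable M"
  shows "(\<lambda>x. tform t (f x) (g x)) \<in> borel_measurable M"
proof -
  have "(\<lambda>x. (f x, g x)) \<in> borel_measurable M"
    using assms by measurable
  from borel_measurable_continuous_on[OF continuous_on_tform[of t] this] show ?thesis by simp
qed

lemma borel_measurable_qform [measurable (raw)]:
  assumes "f \<in> borel_measurable M"
  shows "(\<lambda>x. qform t (f x)) \<in> borel_measurable M"
proof -
  have "(\<lambda>x. Re (tform t (f x) (f x))) \<in> borel_measurable M"
    using assms by measurable
  then show ?thesis by (simp add: tform_self)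
qed

lemma borel_measurable_cscale [measurable (raw)]:
  fixes g :: "'a \<Rightarrow> complex ^ 'n"
  assumes "f \<in> borel_measurable M" "g \<in> borel_measurable M"
  shows "(\<lambda>x. f x *s g x) \<in> borel_measurable M"
proof -
  have "(\<lambda>x. (f x, g x)) \<in> borel_measurable M"
    using assms by measurable
  moreover have *: "continuous_on UNIV (\<lambda>p :: complex \<times> (complex ^ 'n). fst p *s snd p)"
    unfolding vector_scalar_mult_def by (intro continuous_intros)
  ultimately show ?thesis
    using borel_measurable_continuous_on[OF *, of "\<lambda>x. (f x, g x)" M] by simp
qed

lemma sets_fock_measure [simp, measurable_cong]: "sets (fock_measure t) = sets borel"
  by (simp add: fock_measure_def)

lemma space_fock_measure [simp]: "space (fock_measure t) = UNIV"
  by (simp add: fock_measure_def)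

definition gauss :: "real ^ 'n \<Rightarrow> complex ^ 'n \<Rightarrow> real" where
  "gauss t z = 1 / (pi ^ CARD('n) * (\<Prod>j\<in>UNIV. t $ j)) * exp (- qform t z)"

lemma fock_measure_gauss: "fock_measure t = density lborel (\<lambda>z. ennreal (gauss t z))"
  by (simp add: fock_measure_def gauss_def qform_def)

lemma borel_measurable_gauss [measurable (raw)]:
  assumes "f \<in> borel_measurable M"
  shows "(\<lambda>x. gauss t (f x)) \<in> borel_measurable M"
  unfolding gauss_def using assms by measurable

lemma gauss_minus: "gauss t (- x) = gauss t x"
  by (simp add: gauss_def qform_minus)

lemma gauss_unit: "cmod c = 1 \<Longrightarrow> gauss t (c *s x) = gauss t x"
  by (simp add: gauss_def qform_unit)

text \<open>The factor in front is the density of a translated Gaussian. For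
  \<open>y = s *\<^sub>R z\<close> it is the squared modulus of the exponential in
  \<open>weyl\<close>, which is why the Weyl operators are isometric.\<close>

lemma gauss_add: "gauss t (x + y) = exp (- 2 * Re (tform t x y) - qform t y) * gauss t x"
  by (simp add: gauss_def qform_add exp_add[symmetric] exp_diff exp_minus field_simps)

section \<open>Normalization and changes of variable\<close>

lemma nn_integral_lborel_translate:
  fixes a :: "'a :: euclidean_space"
  assumes [measurable]: "f \<in> borel_measurable borel"
  shows "(\<integral>\<^sup>+x. f (x + a) \<partial>lborel) = (\<integral>\<^sup>+x. f x \<partial>lborel)"
  by (subst lborel_distr_plus[of a, symmetric]) (simp add: nn_integral_distr add.commute)

lemma nn_integral_gauss_1d:
  assumes "a > 0"
  shows "(\<integral>\<^sup>+x. ennreal (exp (- x\<^sup>2 / a)) \<partial>lborel) = ennreal (sqrt (pi * a))"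
proof -
  define s where "s = sqrt (a / 2)"
  have s: "s > 0" "2 * s\<^sup>2 = a" using assms by (auto simp: s_def)
  interpret prob_space "density lborel (normal_density 0 s)"
    using s by (rule_tac prob_space_normal_density)
  have "(\<integral>\<^sup>+x. ennreal (normal_density 0 s x) \<partial>lborel) = 1"
    using emeasure_space_1 by (simp add: emeasure_density)
  moreover have "exp (- x\<^sup>2 / a) = sqrt (pi * a) * normal_density 0 s x" for x
    using s(1) by (simp add: normal_density_def mult_ac flip: s(2))
  ultimately show ?thesis
    using assms by (simp add: ennreal_mult' nn_integral_cmult)
qed

locale weights =
  fixes t :: "real ^ 'n"
  assumes pos: "t $ j > 0"
begin

lemma gauss_nonneg [simp]: "0 \<le> gauss t z"
  using pos by (auto simp: gauss_def intro!: divide_nonneg_nonneg mult_nonneg_nonneg prod_nonneg less_imp_le[OF pos])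

lemma qform_nonneg [simp]: "0 \<le> qform t z"
  unfolding qform_def by (intro sum_nonneg divide_nonneg_nonneg) (auto simp: less_imp_le[OF pos])

lemma nn_integral_gauss: "(\<integral>\<^sup>+z. ennreal (gauss t z) \<partial>lborel) = 1"
proof -
  \<comment> \<open>\<open>idx\<close> reads the coordinate \<open>j\<close> off a real basis vector
    \<open>axis j 1\<close> or \<open>axis j \<i>\<close>, so that the factor belonging to this
    vector can use the weight \<open>t $ j\<close>.\<close>
  define idx :: "complex ^ 'n \<Rightarrow> 'n" where "idx b = (SOME j. b $ j \<noteq> 0)" for b
  have idx: "idx (axis j c) = j" if "c \<noteq> 0" for j c
    using that by (auto simp: idx_def axis_def intro!: some_equality split: if_splits)
  have basis: "(\<Prod>b\<in>Basis. h b) = (\<Prod>j\<in>UNIV. h (axis j 1) * h (axis j \<i>))"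
    for h :: "complex ^ 'n \<Rightarrow> 'c :: comm_monoid_mult"
  proof -
    have "(Basis :: (complex ^ 'n) set) = (\<lambda>(j, c). axis j c) ` (UNIV \<times> {1, \<i>})"
      by (auto simp: Basis_vec_def Basis_complex_def)
    then have "(\<Prod>b\<in>Basis. h b) = (\<Prod>b\<in>(\<lambda>(j, c). axis j c) ` (UNIV \<times> {1, \<i>}). h b)"
      by (rule arg_cong)
    moreover have "inj_on (\<lambda>(j, c). axis j c :: complex ^ 'n) (UNIV \<times> {1, \<i>})"
      by (auto simp: inj_on_def axis_eq_axis)
    ultimately have "(\<Prod>b\<in>Basis. h b) = (\<Prod>p\<in>UNIV \<times> {1, \<i>}. h (axis (fst p) (snd p)))"
      by (simp add: prod.reindex case_prod_unfold)
    also have "\<dots> = (\<Prod>j\<in>UNIV. \<Prod>c\<in>{1, \<i>}. h (axis j c))"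
      by (subst prod.cartesian_product) (simp add: case_prod_unfold)
    finally show ?thesis by simp
  qed
  have qf: "exp (- qform t z) = (\<Prod>b\<in>Basis. exp (- (z \<bullet> b)\<^sup>2 / t $ idx b))" for z
    unfolding basis
    by (simp add: idx inner_axis qform_def exp_sum[symmetric] mult_exp_exp sum_negf[symmetric]
        cmod_power2 add_divide_distrib)
  have "(\<integral>\<^sup>+z. ennreal (exp (- qform t z)) \<partial>lborel)
      = (\<integral>\<^sup>+z. (\<Prod>b\<in>Basis. ennreal (exp (- (z \<bullet> b)\<^sup>2 / t $ idx b))) \<partial>lborel)"
    unfolding qf by (simp add: prod_ennreal)
  also have "\<dots> = (\<Prod>b\<in>Basis. \<integral>\<^sup>+x. ennreal (exp (- x\<^sup>2 / t $ idx b)) \<partial>lborel)"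
    by (rule nn_integral_lborel_prod[where f = "\<lambda>b x. ennreal (exp (- x\<^sup>2 / t $ idx b))"]) auto
  also have "\<dots> = (\<Prod>b\<in>Basis. ennreal (sqrt (pi * t $ idx b)))"
    by (intro prod.cong refl nn_integral_gauss_1d pos)
  also have "\<dots> = (\<Prod>j\<in>UNIV. ennreal (pi * t $ j))"
    unfolding basis by (simp add: idx less_imp_le[OF pos] flip: ennreal_mult)
  also have "\<dots> = ennreal (pi ^ CARD('n) * (\<Prod>j\<in>UNIV. t $ j))"
    by (subst prod_ennreal) (auto simp: less_imp_le[OF pos] prod.distrib)
  finally have *: "(\<integral>\<^sup>+z. ennreal (exp (- qform t z)) \<partial>lborel)
      = ennreal (pi ^ CARD('n) * (\<Prod>j\<in>UNIV. t $ j))" .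
  define C where "C = pi ^ CARD('n) * (\<Prod>j\<in>UNIV. t $ j)"
  have p: "0 < C"
    unfolding C_def by (intro mult_pos_pos prod_pos) (auto simp: pos)
  have "(\<integral>\<^sup>+z. ennreal (gauss t z) \<partial>lborel) = (\<integral>\<^sup>+z. ennreal (1 / C) * ennreal (exp (- qform t z)) \<partial>lborel)"
    unfolding gauss_def C_def[symmetric] using p by (subst ennreal_mult[symmetric]) auto
  also have "\<dots> = ennreal (1 / C) * ennreal C"
    by (subst nn_integral_cmult) (auto simp: * C_def)
  also have "\<dots> = 1"
    using p by (subst ennreal_mult[symmetric]) auto
  finally show ?thesis .
qed

lemma prob_space_fock_measure: "prob_space (fock_measure t)"
  by (rule prob_spaceI) (simp add: fock_measure_gauss emeasure_density nn_integral_gauss)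

sublocale \<mu>: prob_space "fock_measure t"
  by (rule prob_space_fock_measure)

lemma nn_integral_fock_measure:
  assumes "f \<in> borel_measurable borel"
  shows "(\<integral>\<^sup>+z. f z \<partial>fock_measure t) = (\<integral>\<^sup>+z. ennreal (gauss t z) * f z \<partial>lborel)"
  using assms by (simp add: fock_measure_gauss nn_integral_density)

lemma nn_integral_fock_translate:
  assumes [measurable]: "f \<in> borel_measurable borel"
  shows "(\<integral>\<^sup>+z. ennreal (exp (- 2 * Re (tform t z a) - qform t a)) * f (z + a) \<partial>fock_measure t)
       = (\<integral>\<^sup>+z. f z \<partial>fock_measure t)"
proof -
  have "(\<integral>\<^sup>+z. ennreal (exp (- 2 * Re (tform t z a) - qform t a)) * f (z + a) \<partial>fock_measure t)
     = (\<integral>\<^sup>+z. ennreal (gauss t (z + a)) * f (z + a) \<partial>lborel)"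
    by (subst nn_integral_fock_measure)
       (auto simp: gauss_add ennreal_mult ac_simps intro!: nn_integral_cong)
  also have "\<dots> = (\<integral>\<^sup>+z. f z \<partial>fock_measure t)"
    by (subst nn_integral_lborel_translate) (auto simp: nn_integral_fock_measure)
  finally show ?thesis .
qed

lemma integral_fock_translate:
  fixes f :: "complex ^ 'n \<Rightarrow> complex"
  assumes [measurable]: "f \<in> borel_measurable borel"
  shows "(LINT z|fock_measure t. of_real (exp (- 2 * Re (tform t z a) - qform t a)) * f (z + a))
       = (LINT z|fock_measure t. f z)"
proof -
  have "(LINT z|fock_measure t. of_real (exp (- 2 * Re (tform t z a) - qform t a)) * f (z + a))
     = (LINT z|lborel. gauss t (z + a) *\<^sub>R f (z + a))"
    unfolding fock_measure_gauss
    by (subst integral_density) (auto simp: gauss_add scaleR_conv_of_real ac_simps intro!: Bochner_Integration.integral_cong)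
  also have "\<dots> = (LINT z|distr lborel borel ((+) a). gauss t z *\<^sub>R f z)"
    by (subst integral_distr) (auto simp: add.commute)
  also have "\<dots> = (LINT z|fock_measure t. f z)"
    unfolding fock_measure_gauss lborel_distr_plus
    by (subst integral_density) auto
  finally show ?thesis .
qed

text \<open>Comparing a rotated copy of Lebesgue measure with Lebesgue measure through the convolution with
  the rotation invariant Gaussian replaces the uniqueness theorem for Haar measure.\<close>

lemma nn_integral_lborel_rotate:
  fixes f :: "complex ^ 'n \<Rightarrow> ennreal"
  assumes [measurable]: "f \<in> borel_measurable borel" and c: "cmod c = 1"
  shows "(\<integral>\<^sup>+z. f (c *s z) \<partial>lborel) = (\<integral>\<^sup>+z. f z \<partial>lborel)"
proof -
  have c': "c * cnj c = 1" "cnj c * c = 1" using c by (auto simp: complex_norm_square[symmetric] mult.commute)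
  have "(\<integral>\<^sup>+x. f (c *s x) \<partial>lborel) = (\<integral>\<^sup>+x. \<integral>\<^sup>+y. f (c *s x) * ennreal (gauss t y) \<partial>lborel \<partial>lborel)"
    by (simp add: nn_integral_cmult nn_integral_gauss)
  also have "\<dots> = (\<integral>\<^sup>+y. \<integral>\<^sup>+x. f (c *s x) * ennreal (gauss t y) \<partial>lborel \<partial>lborel)"
    by (rule lborel_pair.Fubini') measurable
  also have "\<dots> = (\<integral>\<^sup>+y. \<integral>\<^sup>+x. f (c *s (x + cnj c *s y)) * ennreal (gauss t y) \<partial>lborel \<partial>lborel)"
    by (intro nn_integral_cong nn_integral_lborel_translate[symmetric]) measurable
  also have "\<dots> = (\<integral>\<^sup>+y. \<integral>\<^sup>+x. f (c *s x + y) * ennreal (gauss t y) \<partial>lborel \<partial>lborel)"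
    by (simp add: vector_add_ldistrib vector_smult_assoc c' vector_smult_lid)
  also have "\<dots> = (\<integral>\<^sup>+x. \<integral>\<^sup>+y. f (c *s x + y) * ennreal (gauss t y) \<partial>lborel \<partial>lborel)"
    by (rule lborel_pair.Fubini') measurable
  \<comment> \<open>Shifting \<open>y\<close> by \<open>- (c *s x)\<close> frees \<open>f\<close>
    from \<open>x\<close>; the Gaussian factor that remains has total mass 1 in \<open>x\<close>
    because the Gaussian is rotation invariant.\<close>
  also have "\<dots> = (\<integral>\<^sup>+x. \<integral>\<^sup>+y. f (c *s x + (y + - (c *s x))) * ennreal (gauss t (y + - (c *s x))) \<partial>lborel \<partial>lborel)"
    by (intro nn_integral_cong nn_integral_lborel_translate[symmetric]) measurable
  also have "\<dots> = (\<integral>\<^sup>+x. \<integral>\<^sup>+y. f y * ennreal (gauss t (y + - (c *s x))) \<partial>lborel \<partial>lborel)"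
    by simp
  also have "\<dots> = (\<integral>\<^sup>+y. \<integral>\<^sup>+x. f y * ennreal (gauss t (y + - (c *s x))) \<partial>lborel \<partial>lborel)"
    by (rule lborel_pair.Fubini') measurable
  also have "\<dots> = (\<integral>\<^sup>+y. f y * (\<integral>\<^sup>+x. ennreal (gauss t (x + - (cnj c *s y))) \<partial>lborel) \<partial>lborel)"
  proof (intro nn_integral_cong)
    fix y :: "complex ^ 'n"
    have "gauss t (y + - (c *s x)) = gauss t (x + - (cnj c *s y))" for x
    proof -
      have "gauss t (y + - (c *s x)) = gauss t (- (c *s (x + - (cnj c *s y))))"
        by (simp add: vector_ssub_ldistrib vector_smult_assoc c' vector_smult_lid)
      then show ?thesis using c by (simp only: gauss_minus gauss_unit)
    qed
    then show "(\<integral>\<^sup>+x. f y * ennreal (gauss t (y + - (c *s x))) \<partial>lborel) =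
       f y * (\<integral>\<^sup>+x. ennreal (gauss t (x + - (cnj c *s y))) \<partial>lborel)"
      by (simp add: nn_integral_cmult)
  qed
  also have "\<dots> = (\<integral>\<^sup>+y. f y \<partial>lborel)"
    by (subst nn_integral_lborel_translate) (auto simp: nn_integral_gauss)
  finally show ?thesis .
qed

lemma distr_fock_rotate:
  assumes c: "cmod c = 1"
  shows "distr (fock_measure t) borel (\<lambda>z. c *s z) = fock_measure t"
proof (rule measure_eqI)
  fix A assume "A \<in> sets (distr (fock_measure t) borel (\<lambda>z. c *s z))"
  then have [measurable]: "A \<in> sets borel" by simp
  have "emeasure (distr (fock_measure t) borel (\<lambda>z. c *s z)) A
     = (\<integral>\<^sup>+z. indicator A z \<partial>distr (fock_measure t) borel (\<lambda>z. c *s z))"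
    by simp
  also have "\<dots> = (\<integral>\<^sup>+z. ennreal (gauss t (c *s z)) * indicator A (c *s z) \<partial>lborel)"
    by (subst nn_integral_distr) (auto simp: nn_integral_fock_measure gauss_unit c)
  also have "\<dots> = (\<integral>\<^sup>+z. ennreal (gauss t z) * indicator A z \<partial>lborel)"
    by (rule nn_integral_lborel_rotate[where f = "\<lambda>z. ennreal (gauss t z) * indicator A z"])
       (use c in auto)
  also have "\<dots> = emeasure (fock_measure t) A"
    by (simp add: fock_measure_gauss emeasure_density)
  finally show "emeasure (distr (fock_measure t) borel (\<lambda>z. c *s z)) A = emeasure (fock_measure t) A" .
qed simp

end

section \<open>Entire functions and the reproducing property\<close>

lemma entireI:
  "(\<And>z. (f has_derivative f' z) (at z)) \<Longrightarrow> (\<And>z c v. f' z (c *s v) = c * f' z v) \<Longrightarrow> f \<in> entire"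
  unfolding entire_def by blast

lemma entireE:
  assumes "f \<in> entire"
  obtains f' where "\<And>z. (f has_derivative f' z) (at z)" "\<And>z c v. f' z (c *s v) = c * f' z v"
proof -
  have "\<forall>z. \<exists>f'. (f has_derivative f') (at z) \<and> (\<forall>c v. f' (c *s v) = c * f' v)"
    using assms by (simp add: entire_def)
  from choice[OF this] show ?thesis using that by blast
qed

lemma entire_add:
  assumes "f \<in> entire" "g \<in> entire" shows "(\<lambda>z. f z + g z) \<in> entire"
proof -
  obtain f' where f: "\<And>z. (f has_derivative f' z) (at z)" "\<And>z c v. f' z (c *s v) = c * f' z v"
    using assms(1) by (rule entireE) blast
  obtain g' where g: "\<And>z. (g has_derivative g' z) (at z)" "\<And>z c v. g' z (c *s v) = c * g' z v"
    using assms(2) by (rule entireE) blast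
  show ?thesis
    by (rule entireI[where f' = "\<lambda>z v. f' z v + g' z v"])
       (auto intro!: derivative_eq_intros f g simp: f(2) g(2) algebra_simps)
qed

lemma entire_mult:
  assumes "f \<in> entire" "g \<in> entire" shows "(\<lambda>z. f z * g z) \<in> entire"
proof -
  obtain f' where f: "\<And>z. (f has_derivative f' z) (at z)" "\<And>z c v. f' z (c *s v) = c * f' z v"
    using assms(1) by (rule entireE) blast
  obtain g' where g: "\<And>z. (g has_derivative g' z) (at z)" "\<And>z c v. g' z (c *s v) = c * g' z v"
    using assms(2) by (rule entireE) blast
  show ?thesis
    by (rule entireI[where f' = "\<lambda>z v. f z * g' z v + f' z v * g z"])
       (auto intro!: derivative_eq_intros f g simp: f(2) g(2) algebra_simps)
qed

lemma entire_const: "(\<lambda>z. c) \<in> entire"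
  by (rule entireI[where f' = "\<lambda>z v. 0"]) auto

lemma entire_shift:
  assumes "f \<in> entire" shows "(\<lambda>z. f (z + a)) \<in> entire"
proof -
  obtain f' where f: "\<And>z. (f has_derivative f' z) (at z)" "\<And>z c v. f' z (c *s v) = c * f' z v"
    using assms(1) by (rule entireE) blast
  show ?thesis
  proof (rule entireI[where f' = "\<lambda>z v. f' (z + a) v"])
    fix z
    have "((\<lambda>z. z + a) has_derivative (\<lambda>v. v)) (at z)"
      by (auto intro!: derivative_eq_intros)
    from has_derivative_compose[OF this f(1)]
    show "((\<lambda>z. f (z + a)) has_derivative f' (z + a)) (at z)" .
  qed (simp add: f(2))
qed

lemma linear_tform_left: "linear (\<lambda>v. tform t v a)"
  by (rule linearI) (simp_all add: tform_simps scaleR_conv_of_real[where 'a = complex])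

lemma has_derivative_tform_left [derivative_intros]:
  assumes "(f has_derivative f') F"
  shows "((\<lambda>z. tform t (f z) a) has_derivative (\<lambda>v. tform t (f' v) a)) F"
  by (rule bounded_linear.has_derivative[OF linear_tform_left[unfolded linear_conv_bounded_linear] assms])

lemma entire_exp_tform: "(\<lambda>z. exp (c * tform t z a)) \<in> entire"
proof (rule entireI[where f' = "\<lambda>z v. exp (c * tform t z a) * (c * tform t v a)"])
  fix z
  have "((\<lambda>z. c * tform t z a) has_derivative (\<lambda>v. c * tform t v a)) (at z)"
    by (auto intro!: derivative_eq_intros)
  from has_derivative_compose[OF this DERIV_exp[unfolded has_field_derivative_def]]
  show "((\<lambda>z. exp (c * tform t z a)) has_derivative (\<lambda>v. exp (c * tform t z a) * (c * tform t v a))) (at z)" .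
qed (simp add: tform_simps(9))

lemma entire_continuous: "f \<in> entire \<Longrightarrow> continuous_on UNIV f"
  by (auto simp: entire_def continuous_on_eq_continuous_at intro: has_derivative_continuous)

lemma entire_measurable: "f \<in> entire \<Longrightarrow> f \<in> borel_measurable borel"
  by (intro borel_measurable_continuous_onI entire_continuous)

text \<open>Restriction to the complex line through \<open>w\<close> reduces the claim to Cauchy's
  formula on the unit circle.\<close>

lemma entire_mean_value:
  fixes F :: "complex ^ 'n \<Rightarrow> complex"
  assumes F: "F \<in> entire"
  shows "(LINT x|lborel. indicator {0..1} x *\<^sub>R F (exp (2 * pi * \<i> * of_real x) *s w)) = F 0"
proof -
  obtain F' where f: "\<And>z. (F has_derivative F' z) (at z)" "\<And>z c v. F' z (c *s v) = c * F' z v"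
    using F by (rule entireE) blast
  define G where "G \<zeta> = F (\<zeta> *s w)" for \<zeta>
  have lin: "linear (\<lambda>\<zeta>. \<zeta> *s w)"
    by (rule linearI) (simp_all add: vec_eq_iff algebra_simps)
  have "(G has_field_derivative F' (\<zeta> *s w) w) (at \<zeta>)" for \<zeta>
  proof -
    have "((\<lambda>\<zeta>. \<zeta> *s w) has_derivative (\<lambda>\<zeta>. \<zeta> *s w)) (at \<zeta>)"
      using lin by (intro bounded_linear_imp_has_derivative) (simp add: linear_conv_bounded_linear)
    from has_derivative_compose[OF this f(1)] show ?thesis
      unfolding G_def has_field_derivative_def
      by (rule has_derivative_eq_rhs) (auto simp: f(2) mult.commute)
  qed
  then have hol: "G holomorphic_on S" for S
    by (meson holomorphic_on_def field_differentiable_def has_field_derivative_at_within)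
  have "((\<lambda>u. G u / (u - 0)) has_contour_integral 2 * of_real pi * \<i> * G 0) (circlepath 0 1)"
    by (rule Cauchy_integral_circlepath_simple) (auto intro: hol)
  then have "((\<lambda>x. G (circlepath 0 1 x) / circlepath 0 1 x * vector_derivative (circlepath 0 1) (at x within {0..1}))
      has_integral 2 * of_real pi * \<i> * G 0) {0..1}"
    by (simp add: has_contour_integral_def)
  \<comment> \<open>The derivative of the circle path is \<open>2 * pi * \<i>\<close> times the path
    itself and cancels the denominator.\<close>
  then have "((\<lambda>x. (2 * of_real pi * \<i>) * G (exp (2 * pi * \<i> * of_real x))) has_integral 2 * of_real pi * \<i> * G 0) {0..1}"
    by (rule has_integral_eq[rotated])
       (simp add: vector_derivative_circlepath01, simp add: circlepath mult_ac)
  from has_integral_mult_right[OF this, of "1 / (2 * of_real pi * \<i>)"]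
  have I: "((\<lambda>x. G (exp (2 * pi * \<i> * of_real x))) has_integral G 0) {0..1}"
    by simp
  have "continuous_on {0..1} (\<lambda>x. G (exp (2 * pi * \<i> * of_real x)))"
    by (rule continuous_on_compose2[OF holomorphic_on_imp_continuous_on[OF hol[of UNIV]]])
       (auto intro!: continuous_intros)
  then have S: "set_integrable lborel {0..1} (\<lambda>x. G (exp (2 * pi * \<i> * of_real x)))"
    by (rule borel_integrable_atLeastAtMost')
  have "(LINT x:{0..1}|lborel. G (exp (2 * pi * \<i> * of_real x))) = G 0"
    using set_borel_integral_eq_integral(2)[OF S] I by (simp add: integral_unique)
  then show ?thesis
    by (simp add: set_lebesgue_integral_def G_def)
qed

context weights
begin

text \<open>The measure is invariant under the rotations \<open>e x\<close>, so the integral may be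
  averaged over them; after Fubini the inner average at each \<open>w\<close> is \<open>F 0\<close>
  by the mean value property.\<close>

lemma integral_entire:
  assumes F: "F \<in> entire" and int: "integrable (fock_measure t) F"
  shows "(LINT w|fock_measure t. F w) = F 0"
proof -
  interpret pair_sigma_finite "lborel :: real measure" "fock_measure t" ..
  define e where "e x = exp (2 * pi * \<i> * of_real x)" for x :: real
  have e: "cmod (e x) = 1" for x by (simp add: e_def)
  have [measurable]: "F \<in> borel_measurable borel" by (rule entire_measurable[OF F])
  have [measurable]: "e \<in> borel_measurable borel"
    unfolding e_def by measurable
  define f where "f x w = indicator {0..1} x *\<^sub>R F (e x *s w)" for x w
  have [measurable]: "(\<lambda>(x, w). f x w) \<in> borel_measurable (lborel \<Otimes>\<^sub>M fock_measure t)"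
    unfolding f_def by measurable
  have rot: "integrable (fock_measure t) (\<lambda>w. h (e x *s w))"
            "(LINT w|fock_measure t. h (e x *s w)) = (LINT w|fock_measure t. h w)"
    if h: "integrable (fock_measure t) h" for h :: "complex ^ 'n \<Rightarrow> 'b :: {banach, second_countable_topology}" and x
  proof -
    have [measurable]: "h \<in> borel_measurable borel" using borel_measurable_integrable[OF h] by simp
    show "integrable (fock_measure t) (\<lambda>w. h (e x *s w))"
      using h by (subst (asm) distr_fock_rotate[OF e, of x, symmetric]) (simp add: integrable_distr_eq)
    show "(LINT w|fock_measure t. h (e x *s w)) = (LINT w|fock_measure t. h w)"
      by (subst (2) distr_fock_rotate[OF e, of x, symmetric]) (simp add: integral_distr)
  qed
  have "integrable (lborel \<Otimes>\<^sub>M fock_measure t) (\<lambda>(x, w). f x w)"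
  proof (rule Fubini_integrable)
    have "(LINT w|fock_measure t. norm (f x w)) = indicator {0..1} x *\<^sub>R (LINT w|fock_measure t. norm (F w))" for x
      using rot(2)[OF integrable_norm[OF int], of x] by (simp add: f_def)
    then show "integrable lborel (\<lambda>x. LINT w|fock_measure t. norm (case (x, w) of (x, w) \<Rightarrow> f x w))"
      by simp
    show "AE x in lborel. integrable (fock_measure t) (\<lambda>w. case (x, w) of (x, w) \<Rightarrow> f x w)"
      using rot(1)[OF int] by (auto simp: f_def)
  qed measurable
  from Fubini_integral[OF this, symmetric]
  have "(LINT x|lborel. LINT w|fock_measure t. f x w) = (LINT w|fock_measure t. LINT x|lborel. f x w)" .
  moreover have "(LINT x|lborel. f x w) = F 0" for w
    using entire_mean_value[OF F, of w] by (simp add: f_def e_def)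
  moreover have "(LINT w|fock_measure t. f x w) = indicator {0..1} x *\<^sub>R (LINT w|fock_measure t. F w)" for x
    using rot(2)[OF int, of x] by (simp add: f_def)
  ultimately show ?thesis
    by (simp add: \<mu>.prob_space[simplified])
qed

text \<open>Translating by \<open>a\<close> turns the integral into the Gaussian mean of an entire
  function \<open>G\<close> with \<open>G 0 = F a\<close>. The hypothesis is integrability against
  the kernel because in \<open>bproj_osc\<close> the function \<open>F\<close> is an exponential
  times a Fock function, a product that may fail to be square integrable.\<close>

lemma reproducing:
  assumes F: "F \<in> entire" and int: "integrable (fock_measure t) (\<lambda>w. F w * exp (tform t a w))"
  shows "(LINT w|fock_measure t. F w * exp (tform t a w)) = F a"
proof -
  define G where "G w = F (w + a) * exp (- 1 * tform t w a)" for w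
  have [measurable]: "F \<in> borel_measurable borel" by (rule entire_measurable[OF F])
  \<comment> \<open>The density of the translated Gaussian has exponent
    \<open>- 2 Re <w,a> - |a|^2\<close>; adding \<open><a,w> + |a|^2\<close> from the kernel leaves
    the holomorphic \<open>- <w,a>\<close>.\<close>
  have G: "of_real (exp (- 2 * Re (tform t w a) - qform t a)) * (F (w + a) * exp (tform t a (w + a))) = G w" for w
  proof -
    have "tform t w a + tform t a w = of_real (2 * Re (tform t w a))"
      using complex_add_cnj[of "tform t w a"] by (simp add: cnj_tform)
    then have "of_real (- 2 * Re (tform t w a) - qform t a) + tform t a (w + a) = - 1 * tform t w a"
      by (simp add: tform_simps tform_self) (simp add: algebra_simps)
    then show ?thesis
      unfolding G_def exp_of_real[symmetric]
      by (metis (no_types, lifting) exp_add mult.assoc mult.commute)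
  qed
  have "G \<in> entire"
    unfolding G_def by (intro entire_mult entire_shift entire_exp_tform F)
  moreover have "integrable (fock_measure t) G"
  proof (rule integrableI_bounded)
    show [measurable]: "G \<in> borel_measurable (fock_measure t)"
      using entire_measurable[OF \<open>G \<in> entire\<close>] by simp
    have "(\<integral>\<^sup>+w. ennreal (norm (G w)) \<partial>fock_measure t) =
       (\<integral>\<^sup>+w. ennreal (exp (- 2 * Re (tform t w a) - qform t a)) * ennreal (norm (F (w + a) * exp (tform t a (w + a)))) \<partial>fock_measure t)"
      by (intro nn_integral_cong) (auto simp: norm_mult ennreal_mult' simp flip: G)
    also have "\<dots> = (\<integral>\<^sup>+w. ennreal (norm (F w * exp (tform t a w))) \<partial>fock_measure t)"
      by (rule nn_integral_fock_translate) measurable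
    also have "\<dots> < \<infinity>"
      using int by (simp add: integrable_iff_bounded)
    finally show "(\<integral>\<^sup>+w. ennreal (norm (G w)) \<partial>fock_measure t) < \<infinity>" .
  qed
  ultimately have "(LINT w|fock_measure t. G w) = G 0"
    by (rule integral_entire)
  moreover have "(LINT w|fock_measure t. G w) = (LINT w|fock_measure t. F w * exp (tform t a w))"
    unfolding G[symmetric] by (rule integral_fock_translate) measurable
  ultimately show ?thesis by (simp add: G_def tform_simps)
qed

end

section \<open>Square integrable functions and the projection\<close>

lemma measurable_fock_measure [simp]: "measurable (fock_measure t) M = measurable borel M"
  by (rule measurable_cong_sets) auto

lemma borel_measurable_cnj [measurable (raw)]:
  "f \<in> borel_measurable M \<Longrightarrow> (\<lambda>x. cnj (f x)) \<in> borel_measurable M"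
  by (rule borel_measurable_continuous_on[of cnj f]) (auto intro!: continuous_intros)

lemma L2_measurable [measurable_dest]: "f \<in> L2_fun t \<Longrightarrow> f \<in> borel_measurable borel"
  by (simp add: L2_fun_def)

lemma L2_integrable_sq: "f \<in> L2_fun t \<Longrightarrow> integrable (fock_measure t) (\<lambda>w. (cmod (f w))\<^sup>2)"
  by (simp add: L2_fun_def)

lemma L2_funI:
  assumes "f \<in> borel_measurable borel" "(\<integral>\<^sup>+w. ennreal ((cmod (f w))\<^sup>2) \<partial>fock_measure t) < \<infinity>"
  shows "f \<in> L2_fun t"
  using assms by (auto simp: L2_fun_def intro!: integrableI_bounded)

lemma L2_nn_finite: "f \<in> L2_fun t \<Longrightarrow> (\<integral>\<^sup>+w. ennreal ((cmod (f w))\<^sup>2) \<partial>fock_measure t) < \<infinity>"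
  using L2_integrable_sq[of f t] by (simp add: integrable_iff_bounded)

lemma L2_bound:
  assumes [measurable]: "f \<in> borel_measurable borel" and g: "g \<in> L2_fun t" and le: "\<And>w. cmod (f w) \<le> B * cmod (g w)"
  shows "f \<in> L2_fun t"
proof -
  have "integrable (fock_measure t) (\<lambda>w. B\<^sup>2 * (cmod (g w))\<^sup>2)"
    using L2_integrable_sq[OF g] by simp
  then have "integrable (fock_measure t) (\<lambda>w. (cmod (f w))\<^sup>2)"
  proof (rule Bochner_Integration.integrable_bound)
    show "AE w in fock_measure t. norm ((cmod (f w))\<^sup>2) \<le> norm (B\<^sup>2 * (cmod (g w))\<^sup>2)"
      using power_mono[OF le, of _ 2] by (auto simp: power_mult_distrib)
  qed simp
  then show ?thesis by (simp add: L2_fun_def)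
qed

lemma L2_bounded_mult:
  assumes [measurable]: "p \<in> borel_measurable borel" and g: "g \<in> L2_fun t" and le: "\<And>w. cmod (p w) \<le> B"
  shows "(\<lambda>w. p w * g w) \<in> L2_fun t"
proof (rule L2_bound[OF _ g])
  show "(\<lambda>w. p w * g w) \<in> borel_measurable borel"
    using L2_measurable[OF g] by measurable
  show "cmod (p w * g w) \<le> B * cmod (g w)" for w
    using le[of w] by (simp add: norm_mult mult_right_mono)
qed

lemma L2_cmult: "f \<in> L2_fun t \<Longrightarrow> (\<lambda>w. c * f w) \<in> L2_fun t"
  by (rule L2_bounded_mult[of "\<lambda>_. c" _ _ "cmod c"]) auto

lemma L2_add:
  assumes f: "f \<in> L2_fun t" and g: "g \<in> L2_fun t"
  shows "(\<lambda>w. f w + g w) \<in> L2_fun t"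
proof -
  note [measurable] = L2_measurable[OF f] L2_measurable[OF g]
  have "integrable (fock_measure t) (\<lambda>w. 2 * (cmod (f w))\<^sup>2 + 2 * (cmod (g w))\<^sup>2)"
    using L2_integrable_sq[OF f] L2_integrable_sq[OF g] by simp
  then have "integrable (fock_measure t) (\<lambda>w. (cmod (f w + g w))\<^sup>2)"
  proof (rule Bochner_Integration.integrable_bound)
    have "(cmod (f w + g w))\<^sup>2 \<le> 2 * (cmod (f w))\<^sup>2 + 2 * (cmod (g w))\<^sup>2" for w
    proof -
      have "(cmod (f w + g w))\<^sup>2 \<le> (cmod (f w) + cmod (g w))\<^sup>2"
        by (intro power_mono norm_triangle_ineq) auto
      also have "\<dots> \<le> 2 * (cmod (f w))\<^sup>2 + 2 * (cmod (g w))\<^sup>2"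
        using sum_squares_bound[of "cmod (f w)" "cmod (g w)"] by (simp add: power2_sum)
      finally show ?thesis .
    qed
    then show "AE w in fock_measure t. norm ((cmod (f w + g w))\<^sup>2) \<le> norm (2 * (cmod (f w))\<^sup>2 + 2 * (cmod (g w))\<^sup>2)"
      by auto
  qed simp
  then show ?thesis by (simp add: L2_fun_def)
qed

lemma L2_diff: "f \<in> L2_fun t \<Longrightarrow> g \<in> L2_fun t \<Longrightarrow> (\<lambda>w. f w - g w) \<in> L2_fun t"
  using L2_add[of f t "\<lambda>w. - 1 * g w"] L2_cmult[of g t "- 1"] by simp

lemma L2_cnj: "f \<in> L2_fun t \<Longrightarrow> (\<lambda>w. cnj (f w)) \<in> L2_fun t"
  by (rule L2_bound[of _ f _ 1]) auto

lemma L2_mult_integrable: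
  assumes f: "f \<in> L2_fun t" and g: "g \<in> L2_fun t"
  shows "integrable (fock_measure t) (\<lambda>w. f w * g w)"
proof -
  note [measurable] = L2_measurable[OF f] L2_measurable[OF g]
  have "integrable (fock_measure t) (\<lambda>w. (cmod (f w))\<^sup>2 + (cmod (g w))\<^sup>2)"
    using L2_integrable_sq[OF f] L2_integrable_sq[OF g] by simp
  then show ?thesis
  proof (rule Bochner_Integration.integrable_bound)
    have "cmod (f w) * cmod (g w) \<le> (cmod (f w))\<^sup>2 + (cmod (g w))\<^sup>2" for w
      using sum_squares_bound[of "cmod (f w)" "cmod (g w)"]
        mult_nonneg_nonneg[OF norm_ge_zero[of "f w"] norm_ge_zero[of "g w"]] by linarith
    then show "AE w in fock_measure t. norm (f w * g w) \<le> norm ((cmod (f w))\<^sup>2 + (cmod (g w))\<^sup>2)"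
      by (auto simp: norm_mult)
  qed simp
qed

lemma L2_nrm_nonneg [simp]: "0 \<le> L2_nrm t f"
  by (simp add: L2_nrm_def)

lemma L2_nrm_sq: "(L2_nrm t f)\<^sup>2 = (LINT w|fock_measure t. (cmod (f w))\<^sup>2)"
  by (simp add: L2_nrm_def)

lemma L2_nrm_inner: "L2_inner t f f = of_real ((L2_nrm t f)\<^sup>2)"
  unfolding L2_nrm_sq L2_inner_def complex_norm_square[symmetric] by (rule integral_complex_of_real)

lemma nn_integral_L2: "f \<in> L2_fun t \<Longrightarrow> (\<integral>\<^sup>+w. ennreal ((cmod (f w))\<^sup>2) \<partial>fock_measure t) = ennreal ((L2_nrm t f)\<^sup>2)"
  unfolding L2_nrm_sq by (intro nn_integral_eq_integral L2_integrable_sq) auto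

lemma L2_nrm_le:
  assumes "f \<in> L2_fun t" "(\<integral>\<^sup>+w. ennreal ((cmod (f w))\<^sup>2) \<partial>fock_measure t) \<le> ennreal (b\<^sup>2)" "b \<ge> 0"
  shows "L2_nrm t f \<le> b"
proof -
  have "(L2_nrm t f)\<^sup>2 \<le> b\<^sup>2"
    using assms by (simp add: nn_integral_L2)
  then show ?thesis using assms(3) by (rule power2_le_imp_le)
qed

lemma L2_nrm_cmult: "L2_nrm t (\<lambda>w. c * f w) = cmod c * L2_nrm t f"
  by (simp add: L2_nrm_def norm_mult power_mult_distrib real_sqrt_mult)

lemma L2_inner_diff_left:
  "f \<in> L2_fun t \<Longrightarrow> g \<in> L2_fun t \<Longrightarrow> k \<in> L2_fun t \<Longrightarrow>
    L2_inner t (\<lambda>w. f w - g w) k = L2_inner t f k - L2_inner t g k"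
  by (simp add: L2_inner_def left_diff_distrib Bochner_Integration.integral_diff L2_mult_integrable L2_cnj)

lemma L2_inner_diff_right:
  "f \<in> L2_fun t \<Longrightarrow> g \<in> L2_fun t \<Longrightarrow> k \<in> L2_fun t \<Longrightarrow>
    L2_inner t k (\<lambda>w. f w - g w) = L2_inner t k f - L2_inner t k g"
  by (simp add: L2_inner_def right_diff_distrib Bochner_Integration.integral_diff L2_mult_integrable L2_cnj)

lemma L2_inner_cmult_left: "L2_inner t (\<lambda>w. c * f w) k = c * L2_inner t f k"
  by (simp add: L2_inner_def mult.assoc)

lemma L2_inner_cnj: "L2_inner t g f = cnj (L2_inner t f g)"
proof -
  have "(\<lambda>w. g w * cnj (f w)) = (\<lambda>w. cnj (f w * cnj (g w)))"
    by (simp add: mult.commute)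
  then show ?thesis by (simp only: L2_inner_def Bochner_Integration.integral_cnj)
qed

lemma L2_nrm_diff_sq:
  assumes "f \<in> L2_fun t" "g \<in> L2_fun t"
  shows "(L2_nrm t (\<lambda>w. f w - g w))\<^sup>2 = (L2_nrm t f)\<^sup>2 + (L2_nrm t g)\<^sup>2 - 2 * Re (L2_inner t f g)"
proof -
  have "complex_of_real ((L2_nrm t (\<lambda>w. f w - g w))\<^sup>2) =
    of_real ((L2_nrm t f)\<^sup>2) + of_real ((L2_nrm t g)\<^sup>2) - (L2_inner t f g + cnj (L2_inner t f g))"
    unfolding L2_nrm_inner[symmetric] L2_inner_cnj[of t g f, symmetric]
    by (simp add: L2_inner_diff_left L2_inner_diff_right L2_diff assms)
  from arg_cong[OF this, of Re] show ?thesis by simp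
qed

lemma fock_L2: "f \<in> fock t \<Longrightarrow> f \<in> L2_fun t"
  and fock_entire: "f \<in> fock t \<Longrightarrow> f \<in> entire"
  by (auto simp: fock_def)

lemma fock_measurable [measurable_dest]: "f \<in> fock t \<Longrightarrow> f \<in> borel_measurable borel"
  by (simp add: fock_def L2_fun_def)

lemma fock_add: "f \<in> fock t \<Longrightarrow> g \<in> fock t \<Longrightarrow> (\<lambda>w. f w + g w) \<in> fock t"
  by (simp add: fock_def L2_add entire_add)

lemma fock_cmult: "f \<in> fock t \<Longrightarrow> (\<lambda>w. c * f w) \<in> fock t"
  by (simp add: fock_def L2_cmult entire_mult entire_const)

lemma fock_zero: "(\<lambda>w. 0) \<in> fock t"
  by (simp add: fock_def L2_fun_def entire_const)

lemma fock_diff: "f \<in> fock t \<Longrightarrow> g \<in> fock t \<Longrightarrow> (\<lambda>w. f w - g w) \<in> fock t"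
  using fock_add[of f t "\<lambda>w. - 1 * g w"] fock_cmult[of g t "- 1"] by simp

text \<open>The orthogonal projection onto the Fock space as an integral operator.\<close>

definition bproj :: "real ^ 'n \<Rightarrow> (complex ^ 'n \<Rightarrow> complex) \<Rightarrow> complex ^ 'n \<Rightarrow> complex" where
  "bproj t h u = (LINT w|fock_measure t. h w * exp (tform t u w))"


section \<open>Kernel estimates and holomorphy of the projection\<close>

context weights
begin

lemma norm_tform_le: "cmod (tform t v w) \<le> (\<Sum>j\<in>UNIV. 1 / t $ j) * norm v * norm w"
proof -
  have "cmod (tform t v w) \<le> (\<Sum>j\<in>UNIV. cmod (v $ j) * cmod (w $ j) / t $ j)"
    unfolding tform_def by (rule sum_norm_le) (simp add: norm_mult norm_divide less_imp_le[OF pos])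
  also have "\<dots> \<le> (\<Sum>j\<in>UNIV. (norm v * norm w) / t $ j)"
    by (intro sum_mono divide_right_mono mult_mono)
       (auto simp: norm_nth_le less_imp_le[OF pos] Finite_Cartesian_Product.norm_nth_le)
  also have "\<dots> = (\<Sum>j\<in>UNIV. 1 / t $ j) * norm v * norm w"
    by (simp add: sum_distrib_right)
  finally show ?thesis .
qed

lemma norm_sq_le_qform: "(norm w)\<^sup>2 \<le> (\<Sum>j\<in>UNIV. t $ j) * qform t w"
proof -
  have "(norm w)\<^sup>2 = (\<Sum>j\<in>UNIV. (cmod (w $ j))\<^sup>2)"
    by (simp add: norm_vec_def L2_set_def sum_nonneg)
  also have "\<dots> = (\<Sum>j\<in>UNIV. t $ j * ((cmod (w $ j))\<^sup>2 / t $ j))"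
    using pos by (intro sum.cong refl) (auto simp: less_imp_neq[OF pos, symmetric])
  also have "\<dots> \<le> (\<Sum>j\<in>UNIV. (\<Sum>i\<in>UNIV. t $ i) * ((cmod (w $ j))\<^sup>2 / t $ j))"
    by (intro sum_mono mult_right_mono member_le_sum) (auto simp: less_imp_le[OF pos])
  finally show ?thesis by (simp add: qform_def sum_distrib_left)
qed

lemma nn_integral_exp_half: "(\<integral>\<^sup>+w. ennreal (exp (- qform t w / 2)) \<partial>lborel) < \<infinity>"
proof -
  \<comment> \<open>Doubling the weights halves the form, so \<open>exp (- qform t w / 2)\<close> is
    a multiple of a normalized Gaussian.\<close>
  interpret w2: weights "2 *\<^sub>R t" by standard (simp add: pos)
  define C where "C = pi ^ CARD('n) * (\<Prod>j\<in>UNIV. (2 *\<^sub>R t) $ j)"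
  have C: "C > 0" unfolding C_def by (intro mult_pos_pos prod_pos) (auto simp: pos)
  have "exp (- qform t w / 2) = C * gauss (2 *\<^sub>R t) w" for w
    unfolding gauss_def C_def[symmetric] using C by (simp add: qform_def sum_divide_distrib mult.commute)
  then show ?thesis
    using C by (simp add: ennreal_mult nn_integral_cmult w2.nn_integral_gauss)
qed

lemma exp_norm_L2: "(\<lambda>w. complex_of_real (exp (a * norm w))) \<in> L2_fun t"
proof (rule L2_funI)
  define T where "T = (\<Sum>j\<in>UNIV. t $ j)"
  have T: "T > 0" unfolding T_def by (intro sum_pos) (auto simp: pos)
  \<comment> \<open>Completing the square, with the square of \<open>norm w\<close> at most
    \<open>T * qform t w\<close>, spends half of the Gaussian decay on absorbing
    \<open>exp (2 * (a * norm w))\<close>.\<close>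
  have *: "2 * (a * norm w) - qform t w \<le> 2 * a\<^sup>2 * T - qform t w / 2" for w
  proof -
    have "0 \<le> (norm w / sqrt (2 * T) - a * sqrt (2 * T))\<^sup>2" by simp
    also have "\<dots> = (norm w)\<^sup>2 / (2 * T) + 2 * a\<^sup>2 * T - 2 * (a * norm w)"
      using T by (simp add: power2_diff power_divide power_mult_distrib)
    also have "(norm w)\<^sup>2 / (2 * T) \<le> qform t w / 2"
      using norm_sq_le_qform[of w] T by (simp add: T_def[symmetric] field_simps)
    finally show ?thesis by simp
  qed
  define C where "C = 1 / (pi ^ CARD('n) * (\<Prod>j\<in>UNIV. t $ j))"
  have C: "C > 0" unfolding C_def by (intro divide_pos_pos mult_pos_pos prod_pos) (auto simp: pos)
  have "(\<integral>\<^sup>+w. ennreal ((cmod (complex_of_real (exp (a * norm w))))\<^sup>2) \<partial>fock_measure t)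
     = (\<integral>\<^sup>+w. ennreal (C * exp (2 * (a * norm w) - qform t w)) \<partial>lborel)"
    using C by (subst nn_integral_fock_measure)
      (auto simp: gauss_def C_def[symmetric] ennreal_mult'[symmetric] mult.assoc exp_double[symmetric] exp_add[symmetric] intro!: nn_integral_cong)
  also have "\<dots> \<le> (\<integral>\<^sup>+w. ennreal (C * exp (2 * a\<^sup>2 * T)) * ennreal (exp (- qform t w / 2)) \<partial>lborel)"
  proof (rule nn_integral_mono)
    fix w
    have "exp (2 * (a * norm w) - qform t w) \<le> exp (2 * a\<^sup>2 * T) * exp (- qform t w / 2)"
      using *[of w] by (simp add: exp_add[symmetric])
    then show "ennreal (C * exp (2 * (a * norm w) - qform t w)) \<le> ennreal (C * exp (2 * a\<^sup>2 * T)) * ennreal (exp (- qform t w / 2))"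
      using C by (simp add: ennreal_mult'[symmetric] mult.assoc mult_left_mono)
  qed
  also have "\<dots> < \<infinity>"
    using nn_integral_exp_half by (simp add: nn_integral_cmult ennreal_mult_less_top)
  finally show "(\<integral>\<^sup>+w. ennreal ((cmod (complex_of_real (exp (a * norm w))))\<^sup>2) \<partial>fock_measure t) < \<infinity>" .
qed simp

lemma exp_tform_L2: "(\<lambda>w. exp (c * tform t u w)) \<in> L2_fun t"
proof -
  define S where "S = (\<Sum>j\<in>UNIV. 1 / t $ j)"
  have *: "cmod (exp z) \<le> exp (cmod c * (S * norm u * norm w))" 
    if "z = c * tform t u w" for z w
  proof -
    have "cmod (exp z) \<le> exp (cmod z)" by (rule norm_exp)
    also have "cmod z \<le> cmod c * (S * norm u * norm w)"
      using mult_left_mono[OF norm_tform_le[of u w], of "cmod c"] that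
      by (auto simp: norm_mult S_def[symmetric] mult_ac)
    finally show ?thesis by simp
  qed
  show "(\<lambda>w. exp (c * tform t u w)) \<in> L2_fun t"
    by (rule L2_bound[OF _ exp_norm_L2[of "cmod c * S * norm u"], of _ 1])
       (use * in \<open>auto simp: mult.assoc simp del: norm_exp_eq_Re\<close>)
qed

lemma bproj_integrable: "h \<in> L2_fun t \<Longrightarrow> integrable (fock_measure t) (\<lambda>w. h w * exp (tform t u w))"
  using L2_mult_integrable[of h t] exp_tform_L2[of 1 u] by simp

lemma bproj_fock:
  assumes "f \<in> fock t"
  shows "bproj t f = f"
  using assms by (auto simp: bproj_def fock_entire fock_L2 reproducing bproj_integrable)

lemma bproj_add: "f \<in> L2_fun t \<Longrightarrow> g \<in> L2_fun t \<Longrightarrow> bproj t (\<lambda>w. f w + g w) = (\<lambda>w. bproj t f w + bproj t g w)"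
  by (auto simp: bproj_def distrib_right Bochner_Integration.integral_add bproj_integrable)

lemma bproj_cmult: "bproj t (\<lambda>w. c * f w) = (\<lambda>w. c * bproj t f w)"
  by (auto simp: bproj_def mult.assoc)

text \<open>Differentiation under the integral sign: \<open>L u\<close> is the formal derivative.
  The second order Taylor remainder of the kernel is quadratic in the increment and dominated by an
  exponential of \<open>norm w\<close>, which is integrable against \<open>h\<close>.\<close>

lemma bproj_entire:
  assumes h: "h \<in> L2_fun t"
  shows "bproj t h \<in> entire"
proof -
  note [measurable] = L2_measurable[OF h]
  define S where "S = (\<Sum>j\<in>UNIV. 1 / t $ j)"
  have S: "S \<ge> 0" unfolding S_def by (intro sum_nonneg) (auto simp: less_imp_le[OF pos])
  have tf: "cmod (tform t v w) \<le> S * norm v * norm w" for v w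
    unfolding S_def by (rule norm_tform_le)
  have le_exp: "x \<le> exp x" for x :: real
    using exp_ge_add_one_self[of x] by linarith
  define L where "L u v = (LINT w|fock_measure t. h w * (exp (tform t u w) * tform t v w))" for u v
  have dom: "integrable (fock_measure t) (\<lambda>w. cmod (h w) * exp (a * norm w))" for a
    using integrable_norm[OF L2_mult_integrable[OF h exp_norm_L2[of a]]] by (simp add: norm_mult)
  have L_int: "integrable (fock_measure t) (\<lambda>w. h w * (exp (tform t u w) * tform t v w))" for u v
  proof (rule Bochner_Integration.integrable_bound[OF dom[of "2 * S * norm u + 2 * S * norm v"]])
    have "cmod (exp (tform t u w) * tform t v w) \<le> exp ((2 * S * norm u + 2 * S * norm v) * norm w)" for w
    proof -
      have "cmod (exp (tform t u w) * tform t v w) \<le> exp (S * norm u * norm w) * exp (S * norm v * norm w)"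
        unfolding norm_mult
        by (intro mult_mono order_trans[OF norm_exp] order_trans[OF tf] le_exp) (auto simp: tf)
      also have "\<dots> \<le> exp ((2 * S * norm u + 2 * S * norm v) * norm w)"
        using S by (simp add: exp_add[symmetric] algebra_simps mult_nonneg_nonneg add_increasing)
      finally show ?thesis .
    qed
    then show "AE w in fock_measure t. norm (h w * (exp (tform t u w) * tform t v w)) \<le>
      norm (cmod (h w) * exp ((2 * S * norm u + 2 * S * norm v) * norm w))"
      by (intro AE_I2) (simp add: norm_mult abs_mult mult_left_mono)
  qed measurable
  show ?thesis
  proof (rule entireI[where f' = L])
    fix u
    have linL: "linear (L u)"
      by (rule linearI)
         (simp_all add: L_def tform_simps distrib_left L_int Bochner_Integration.integral_add scaleR_conv_of_real[where 'a = complex] mult.left_commute[of _ "of_real _"])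
    \<comment> \<open>\<open>S * norm u\<close> comes from the kernel at \<open>u\<close>, the
      second \<open>S\<close> from \<open>exp (tform t v w)\<close> with
      \<open>norm v \<le> 1\<close>, and \<open>2\<close> from bounding the square of
      \<open>norm w\<close> by \<open>exp (2 * norm w)\<close>.\<close>
    define a where "a = S * norm u + S + 2"
    define B where "B = S\<^sup>2 * (LINT w|fock_measure t. cmod (h w) * exp (a * norm w))"
    show "(bproj t h has_derivative L u) (at u)"
    proof (rule has_derivativeI_sandwich[of 1 _ _ _ _ "\<lambda>y. B * norm (y - u)"])
      show "bounded_linear (L u)" using linL by (simp add: linear_conv_bounded_linear)
      show "((\<lambda>y. B * norm (y - u)) \<longlongrightarrow> 0) (at u)"
        by (auto intro!: tendsto_eq_intros)
      fix y assume y: "y \<noteq> u" "dist y u < 1"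
      define v where "v = y - u"
      have v: "v \<noteq> 0" "norm v \<le> 1" "y = u + v" using y by (auto simp: v_def dist_norm)
      have bound: "cmod (exp (tform t y w) - exp (tform t u w) - exp (tform t u w) * tform t v w)
          \<le> S\<^sup>2 * (norm v)\<^sup>2 * exp (a * norm w)" for w
      proof -
        have Sv: "S * norm v * norm w \<le> S * norm w"
          using v(2) S by (simp add: mult_right_mono mult_left_le)
        have "exp (tform t y w) - exp (tform t u w) - exp (tform t u w) * tform t v w
           = exp (tform t u w) * (exp (tform t v w) - (\<Sum>i\<le>1. tform t v w ^ i / fact i))"
          by (simp add: v(3) tform_simps exp_add algebra_simps)
        also have "cmod \<dots> \<le> exp (S * norm u * norm w) * (exp (S * norm w) * (S * norm v * norm w)\<^sup>2)"
          unfolding norm_mult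
        proof (intro mult_mono)
          show "cmod (exp (tform t u w)) \<le> exp (S * norm u * norm w)"
            using norm_exp[of "tform t u w"] tf[of u w] by (smt (verit) exp_le_cancel_iff)
          have "cmod (exp (tform t v w) - (\<Sum>i\<le>1. tform t v w ^ i / fact i))
             \<le> exp \<bar>Re (tform t v w)\<bar> * (cmod (tform t v w)) ^ Suc 1 / fact 1"
            by (rule Taylor_exp)
          also have "\<dots> = exp \<bar>Re (tform t v w)\<bar> * (cmod (tform t v w))\<^sup>2"
            by (simp add: numeral_2_eq_2)
          also have "\<dots> \<le> exp (S * norm w) * (S * norm v * norm w)\<^sup>2"
            using tf[of v w] abs_Re_le_cmod[of "tform t v w"] Sv
            by (intro mult_mono power_mono) auto
          finally show "cmod (exp (tform t v w) - (\<Sum>i\<le>1. tform t v w ^ i / fact i)) \<le> exp (S * norm w) * (S * norm v * norm w)\<^sup>2" .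
        qed auto
        also have "\<dots> \<le> exp (S * norm u * norm w) * (exp (S * norm w) * (S\<^sup>2 * (norm v)\<^sup>2 * exp (2 * norm w)))"
          using power_mono[OF le_exp[of "norm w"], of 2]
          by (simp add: power_mult_distrib mult_left_mono exp_double)
        also have "\<dots> = S\<^sup>2 * (norm v)\<^sup>2 * exp (a * norm w)"
          by (simp add: a_def exp_add distrib_right)
        finally show ?thesis .
      qed
      have eq: "bproj t h y - bproj t h u - L u (y - u) =
         (LINT w|fock_measure t. h w * (exp (tform t y w) - exp (tform t u w) - exp (tform t u w) * tform t v w))"
        unfolding bproj_def L_def v_def[symmetric] right_diff_distrib
        by (simp add: L_int bproj_integrable[OF h])
      have "norm (bproj t h y - bproj t h u - L u (y - u)) \<le>
         (LINT w|fock_measure t. norm (h w * (exp (tform t y w) - exp (tform t u w) - exp (tform t u w) * tform t v w)))"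
        unfolding eq by (rule integral_norm_bound)
      also have "\<dots> \<le> (LINT w|fock_measure t. S\<^sup>2 * (norm v)\<^sup>2 * (cmod (h w) * exp (a * norm w)))"
      proof (rule integral_mono_AE')
        show "integrable (fock_measure t) (\<lambda>w. S\<^sup>2 * (norm v)\<^sup>2 * (cmod (h w) * exp (a * norm w)))"
          using dom by simp
        show "AE w in fock_measure t. norm (h w * (exp (tform t y w) - exp (tform t u w) - exp (tform t u w) * tform t v w))
          \<le> S\<^sup>2 * (norm v)\<^sup>2 * (cmod (h w) * exp (a * norm w))"
          using mult_left_mono[OF bound norm_ge_zero]
          by (intro AE_I2) (simp add: norm_mult[of "h _"] mult_ac)
      qed auto
      also have "\<dots> = B * norm v * norm v"
        by (simp add: B_def power2_eq_square)
      finally show "norm (bproj t h y - bproj t h u - L u (y - u)) / norm (y - u) \<le> B * norm (y - u)"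
        using v by (simp add: v_def[symmetric] field_simps)
    qed simp
    show "L u (c *s v) = c * L u v" for c v
      by (simp add: L_def tform_simps mult.left_commute[of _ c])
  qed
qed

end

text \<open>Cauchy-Schwarz after splitting \<open>k\<close> into two square roots. It serves both
  the Schur estimate and the bound on integrated Weyl operators.\<close>

lemma nn_integral_weighted_square:
  fixes k :: "'a \<Rightarrow> real"
  assumes [measurable]: "k \<in> borel_measurable M" "x \<in> borel_measurable M" and k: "\<And>s. 0 \<le> k s"
  shows "(\<integral>\<^sup>+s. ennreal (k s) * x s \<partial>M)\<^sup>2 \<le> (\<integral>\<^sup>+s. ennreal (k s) \<partial>M) * (\<integral>\<^sup>+s. ennreal (k s) * (x s)\<^sup>2 \<partial>M)"
proof -
  have sq: "ennreal (sqrt (k s)) * ennreal (sqrt (k s)) = ennreal (k s)" for s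
    using k[of s] by (simp flip: ennreal_mult)
  have "(\<integral>\<^sup>+s. ennreal (sqrt (k s)) * (ennreal (sqrt (k s)) * x s) \<partial>M)\<^sup>2
      \<le> (\<integral>\<^sup>+s. (ennreal (sqrt (k s)))\<^sup>2 \<partial>M) * (\<integral>\<^sup>+s. (ennreal (sqrt (k s)) * x s)\<^sup>2 \<partial>M)"
    by (rule Cauchy_Schwarz_nn_integral) measurable
  then show ?thesis
    by (simp add: mult.assoc[symmetric] power_mult_distrib power2_eq_square[of "ennreal _"] sq)
qed

section \<open>Schur test and the projection formula\<close>

context weights
begin

text \<open>Moving half of each Gaussian weight to either side turns the modulus of the kernel into
  \<open>\<kappa>\<close>, a convolution kernel with integrable profile, and Schur's test applies.
  The modulus stands inside the inner integral so that the same estimate also justifies Fubini in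
  \<open>bproj_inner\<close>.\<close>

lemma schur_bound:
  assumes h: "h \<in> L2_fun t"
  shows "(\<integral>\<^sup>+u. (\<integral>\<^sup>+w. ennreal (cmod (h w * exp (tform t u w))) \<partial>fock_measure t)\<^sup>2 \<partial>fock_measure t) < \<infinity>"
proof -
  note [measurable] = L2_measurable[OF h]
  define C where "C = 1 / (pi ^ CARD('n) * (\<Prod>j\<in>UNIV. t $ j))"
  have C: "C > 0" unfolding C_def by (intro divide_pos_pos mult_pos_pos prod_pos) (auto simp: pos)
  have gauss: "gauss t w = C * exp (- qform t w)" for w by (simp add: gauss_def C_def)
  have gu: "gauss t w * exp (qform t w) = C" for w by (simp add: gauss exp_minus)
  define \<kappa> where "\<kappa> u w = C * exp (- qform t (u - w) / 2)" for u w
  have [measurable]: "(\<lambda>w. \<kappa> (f w) (g w)) \<in> borel_measurable M"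
    if "f \<in> borel_measurable M" "g \<in> borel_measurable M" for f g and M :: "'z measure"
    using that unfolding \<kappa>_def by measurable
  have \<kappa>0: "0 \<le> \<kappa> u w" for u w using C by (simp add: \<kappa>_def)
  define K where "K = (\<integral>\<^sup>+w. ennreal (C * exp (- qform t w / 2)) \<partial>lborel)"
  have K: "K < \<infinity>"
    using C nn_integral_exp_half by (simp add: K_def ennreal_mult' nn_integral_cmult ennreal_mult_less_top)
  have \<kappa>1: "(\<integral>\<^sup>+u. ennreal (\<kappa> u w) \<partial>lborel) = K" for w
    using nn_integral_lborel_translate[of "\<lambda>u. ennreal (C * exp (- qform t u / 2))" "- w"]
    by (simp add: \<kappa>_def K_def)
  have \<kappa>2: "(\<integral>\<^sup>+w. ennreal (\<kappa> u w) \<partial>lborel) = K" for u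
  proof -
    have "\<kappa> u w = \<kappa> w u" for w
      using qform_minus[of t "u - w"] by (simp add: \<kappa>_def)
    then show ?thesis by (simp add: \<kappa>1)
  qed
  \<comment> \<open>Completing the square: \<open>- qform t w + Re (tform t u w)\<close> equals
    \<open>qform t u / 2 - qform t (u - w) / 2 - qform t w / 2\<close>.\<close>
  have conj: "gauss t w * cmod (h w * exp (tform t u w)) = exp (qform t u / 2) * (\<kappa> u w * (exp (- qform t w / 2) * cmod (h w)))" for u w
  proof -
    have "exp (- qform t w) * exp (Re (tform t u w)) = exp (qform t u / 2) * (exp (- qform t (u - w) / 2) * exp (- qform t w / 2))"
      by (simp add: exp_add[symmetric] qform_diff field_simps)
    then show ?thesis by (simp add: gauss \<kappa>_def norm_mult mult_ac)
  qed
  have "(\<integral>\<^sup>+w. ennreal (cmod (h w * exp (tform t u w))) \<partial>fock_measure t)\<^sup>2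
     \<le> ennreal (exp (qform t u)) * (K * (\<integral>\<^sup>+w. ennreal (\<kappa> u w) * ennreal (exp (- qform t w) * (cmod (h w))\<^sup>2) \<partial>lborel))" for u
  proof -
    have "(\<integral>\<^sup>+w. ennreal (cmod (h w * exp (tform t u w))) \<partial>fock_measure t)
      = (\<integral>\<^sup>+w. ennreal (exp (qform t u / 2)) * (ennreal (\<kappa> u w) * ennreal (exp (- qform t w / 2) * cmod (h w))) \<partial>lborel)"
      by (subst nn_integral_fock_measure) (auto simp: ennreal_mult'[symmetric] conj \<kappa>0 simp del: norm_exp_eq_Re intro!: nn_integral_cong)
    also have "\<dots> = ennreal (exp (qform t u / 2)) * (\<integral>\<^sup>+w. ennreal (\<kappa> u w) * ennreal (exp (- qform t w / 2) * cmod (h w)) \<partial>lborel)"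
      by (rule nn_integral_cmult) measurable
    finally have "(\<integral>\<^sup>+w. ennreal (cmod (h w * exp (tform t u w))) \<partial>fock_measure t)\<^sup>2
      = (ennreal (exp (qform t u / 2)))\<^sup>2 * (\<integral>\<^sup>+w. ennreal (\<kappa> u w) * ennreal (exp (- qform t w / 2) * cmod (h w)) \<partial>lborel)\<^sup>2"
      by (simp add: power_mult_distrib)
    also have "(ennreal (exp (qform t u / 2)))\<^sup>2 = ennreal (exp (qform t u))"
      by (simp add: ennreal_power exp_double[symmetric])
    also have "(\<integral>\<^sup>+w. ennreal (\<kappa> u w) * ennreal (exp (- qform t w / 2) * cmod (h w)) \<partial>lborel)\<^sup>2
       \<le> K * (\<integral>\<^sup>+w. ennreal (\<kappa> u w) * (ennreal (exp (- qform t w / 2) * cmod (h w)))\<^sup>2 \<partial>lborel)"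
      using nn_integral_weighted_square[of "\<kappa> u" lborel "\<lambda>w. ennreal (exp (- qform t w / 2) * cmod (h w))"]
      by (simp add: \<kappa>0 \<kappa>2)
    also have "(\<integral>\<^sup>+w. ennreal (\<kappa> u w) * (ennreal (exp (- qform t w / 2) * cmod (h w)))\<^sup>2 \<partial>lborel)
       = (\<integral>\<^sup>+w. ennreal (\<kappa> u w) * ennreal (exp (- qform t w) * (cmod (h w))\<^sup>2) \<partial>lborel)"
      by (simp add: ennreal_power power_mult_distrib exp_double[symmetric])
    finally show ?thesis by (simp add: mult_left_mono)
  qed
  then have "(\<integral>\<^sup>+u. (\<integral>\<^sup>+w. ennreal (cmod (h w * exp (tform t u w))) \<partial>fock_measure t)\<^sup>2 \<partial>fock_measure t)
    \<le> (\<integral>\<^sup>+u. ennreal (exp (qform t u)) * (K * (\<integral>\<^sup>+w. ennreal (\<kappa> u w) * ennreal (exp (- qform t w) * (cmod (h w))\<^sup>2) \<partial>lborel)) \<partial>fock_measure t)"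
    by (intro nn_integral_mono)
  also have "\<dots> = (\<integral>\<^sup>+u. ennreal C * K * (\<integral>\<^sup>+w. ennreal (\<kappa> u w) * ennreal (exp (- qform t w) * (cmod (h w))\<^sup>2) \<partial>lborel) \<partial>lborel)"
    using C by (subst nn_integral_fock_measure)
      (auto simp: gu mult.assoc[symmetric] ennreal_mult'[symmetric] intro!: nn_integral_cong)
  also have "\<dots> = ennreal C * K * (\<integral>\<^sup>+u. \<integral>\<^sup>+w. ennreal (\<kappa> u w) * ennreal (exp (- qform t w) * (cmod (h w))\<^sup>2) \<partial>lborel \<partial>lborel)"
    by (rule nn_integral_cmult) measurable
  also have "(\<integral>\<^sup>+u. \<integral>\<^sup>+w. ennreal (\<kappa> u w) * ennreal (exp (- qform t w) * (cmod (h w))\<^sup>2) \<partial>lborel \<partial>lborel)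
     = (\<integral>\<^sup>+w. \<integral>\<^sup>+u. ennreal (\<kappa> u w) * ennreal (exp (- qform t w) * (cmod (h w))\<^sup>2) \<partial>lborel \<partial>lborel)"
    by (rule lborel_pair.Fubini') measurable
  also have "\<dots> = (\<integral>\<^sup>+w. K * ennreal (exp (- qform t w) * (cmod (h w))\<^sup>2) \<partial>lborel)"
    by (simp add: nn_integral_multc \<kappa>1)
  also have "\<dots> = K * (\<integral>\<^sup>+w. ennreal (exp (- qform t w) * (cmod (h w))\<^sup>2) \<partial>lborel)"
    by (rule nn_integral_cmult) measurable
  also have "ennreal C * K * (K * (\<integral>\<^sup>+w. ennreal (exp (- qform t w) * (cmod (h w))\<^sup>2) \<partial>lborel)) =
     K * K * (ennreal C * (\<integral>\<^sup>+w. ennreal (exp (- qform t w) * (cmod (h w))\<^sup>2) \<partial>lborel))"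
    by (simp add: mult_ac)
  also have "ennreal C * (\<integral>\<^sup>+w. ennreal (exp (- qform t w) * (cmod (h w))\<^sup>2) \<partial>lborel)
     = (\<integral>\<^sup>+w. ennreal (gauss t w) * ennreal ((cmod (h w))\<^sup>2) \<partial>lborel)"
    using C by (subst nn_integral_cmult[symmetric]) (auto simp: gauss ennreal_mult'[symmetric] mult.assoc)
  also have "\<dots> = (\<integral>\<^sup>+w. ennreal ((cmod (h w))\<^sup>2) \<partial>fock_measure t)"
    by (rule nn_integral_fock_measure[symmetric]) measurable
  also have "K * K * \<dots> < \<infinity>"
    using K L2_nn_finite[OF h] by (simp add: ennreal_mult_less_top)
  finally show ?thesis .
qed

lemma bproj_in_fock:
  assumes h: "h \<in> L2_fun t"
  shows "bproj t h \<in> fock t"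
proof -
  have "bproj t h \<in> L2_fun t"
  proof (rule L2_funI)
    show "bproj t h \<in> borel_measurable borel"
      by (rule entire_measurable[OF bproj_entire[OF h]])
    have "ennreal ((cmod (bproj t h u))\<^sup>2) \<le> (\<integral>\<^sup>+w. ennreal (cmod (h w * exp (tform t u w))) \<partial>fock_measure t)\<^sup>2" for u
    proof -
      have "ennreal (cmod (bproj t h u)) \<le> (\<integral>\<^sup>+w. ennreal (cmod (h w * exp (tform t u w))) \<partial>fock_measure t)"
        unfolding bproj_def by (rule integral_norm_bound_ennreal[OF bproj_integrable[OF h]])
      from power_mono[OF this, of 2] show ?thesis by (simp add: ennreal_power)
    qed
    then have "(\<integral>\<^sup>+u. ennreal ((cmod (bproj t h u))\<^sup>2) \<partial>fock_measure t)
      \<le> (\<integral>\<^sup>+u. (\<integral>\<^sup>+w. ennreal (cmod (h w * exp (tform t u w))) \<partial>fock_measure t)\<^sup>2 \<partial>fock_measure t)"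
      by (intro nn_integral_mono)
    also have "\<dots> < \<infinity>" by (rule schur_bound[OF h])
    finally show "(\<integral>\<^sup>+u. ennreal ((cmod (bproj t h u))\<^sup>2) \<partial>fock_measure t) < \<infinity>" .
  qed
  then show ?thesis using bproj_entire[OF h] by (simp add: fock_def)
qed

text \<open>After Fubini the kernel acts on \<open>k\<close> instead of \<open>h\<close>, because
  conjugation exchanges its arguments, and it reproduces \<open>k\<close>.\<close>

lemma bproj_inner:
  assumes h: "h \<in> L2_fun t" and k: "k \<in> fock t"
  shows "L2_inner t (bproj t h) k = L2_inner t h k"
proof -
  interpret pair_sigma_finite "fock_measure t" "fock_measure t" ..
  note [measurable] = L2_measurable[OF h] fock_measurable[OF k]
  define F where "F u w = h w * exp (tform t u w) * cnj (k u)" for u w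
  have [measurable]: "(\<lambda>(u, w). F u w) \<in> borel_measurable (fock_measure t \<Otimes>\<^sub>M fock_measure t)"
    unfolding F_def by measurable
  have "integrable (fock_measure t \<Otimes>\<^sub>M fock_measure t) (\<lambda>(u, w). F u w)"
  proof (rule integrableI_bounded)
    have "(\<integral>\<^sup>+p. ennreal (norm (case p of (u, w) \<Rightarrow> F u w)) \<partial>(fock_measure t \<Otimes>\<^sub>M fock_measure t))
      = (\<integral>\<^sup>+u. \<integral>\<^sup>+w. ennreal (norm (F u w)) \<partial>fock_measure t \<partial>fock_measure t)"
      by (subst \<mu>.nn_integral_fst[symmetric]) auto
    also have "\<dots> = (\<integral>\<^sup>+u. (\<integral>\<^sup>+w. ennreal (cmod (h w * exp (tform t u w))) \<partial>fock_measure t) * ennreal (cmod (k u)) \<partial>fock_measure t)"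
      by (intro nn_integral_cong, subst nn_integral_multc[symmetric]) (auto simp: F_def norm_mult ennreal_mult)
    also have "\<dots> < \<infinity>"
    proof -
      have "(\<integral>\<^sup>+u. (\<integral>\<^sup>+w. ennreal (cmod (h w * exp (tform t u w))) \<partial>fock_measure t) * ennreal (cmod (k u)) \<partial>fock_measure t)\<^sup>2
        \<le> (\<integral>\<^sup>+u. (\<integral>\<^sup>+w. ennreal (cmod (h w * exp (tform t u w))) \<partial>fock_measure t)\<^sup>2 \<partial>fock_measure t) * (\<integral>\<^sup>+u. (ennreal (cmod (k u)))\<^sup>2 \<partial>fock_measure t)"
        by (rule Cauchy_Schwarz_nn_integral) measurable
      also have "\<dots> < \<infinity>"
        using schur_bound[OF h] L2_nn_finite[OF fock_L2[OF k]] by (simp add: ennreal_mult_less_top ennreal_power)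
      finally show ?thesis by (simp add: power_less_top_ennreal)
    qed
    finally show "(\<integral>\<^sup>+p. ennreal (norm (case p of (u, w) \<Rightarrow> F u w)) \<partial>(fock_measure t \<Otimes>\<^sub>M fock_measure t)) < \<infinity>" .
  qed measurable
  from Fubini_integral[OF this]
  have "(LINT w|fock_measure t. LINT u|fock_measure t. F u w) = (LINT u|fock_measure t. LINT w|fock_measure t. F u w)" .
  moreover have "(LINT w|fock_measure t. F u w) = bproj t h u * cnj (k u)" for u
    by (simp add: F_def bproj_def)
  moreover have "(LINT u|fock_measure t. F u w) = h w * cnj (k w)" for w
  proof -
    have "F u w = h w * cnj (k u * exp (tform t w u))" for u
      by (simp add: F_def exp_cnj cnj_tform)
    then have "(LINT u|fock_measure t. F u w) = h w * cnj (bproj t k w)"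
      by (simp add: bproj_def Bochner_Integration.integral_cnj del: complex_cnj_mult)
    then show ?thesis by (simp add: bproj_fock[OF k])
  qed
  ultimately show ?thesis by (simp add: L2_inner_def)
qed

text \<open>Vanishing almost everywhere becomes vanishing everywhere through the reproducing
  formula, whose integral ignores null sets.\<close>

lemma fock_nrm_zero:
  assumes f: "f \<in> fock t" and 0: "L2_nrm t f = 0"
  shows "f = (\<lambda>w. 0)"
proof
  fix u
  have "(LINT w|fock_measure t. (cmod (f w))\<^sup>2) = 0"
    using 0 by (simp flip: L2_nrm_sq)
  then have "AE w in fock_measure t. (cmod (f w))\<^sup>2 = 0"
    using L2_integrable_sq[OF fock_L2[OF f]] by (subst (asm) integral_nonneg_eq_0_iff_AE) auto
  then have "AE w in fock_measure t. f w * exp (tform t u w) = 0" by simp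
  then have "bproj t f u = 0"
    unfolding bproj_def by (rule integral_eq_zero_AE)
  then show "f u = 0" by (simp add: bproj_fock[OF f])
qed

text \<open>This exchanges the definite description for an integral, so that Toeplitz operators can
  be computed pointwise.\<close>

lemma fock_proj_eq:
  assumes h: "h \<in> L2_fun t"
  shows "fock_proj t h = bproj t h"
  unfolding fock_proj_def
proof (rule the_equality)
  note B = bproj_in_fock[OF h]
  show *: "bproj t h \<in> fock t \<and> (\<forall>k\<in>fock t. L2_inner t (\<lambda>w. h w - bproj t h w) k = 0)"
    using B by (simp add: L2_inner_diff_left h fock_L2 bproj_inner)
  fix g assume g: "g \<in> fock t \<and> (\<forall>k\<in>fock t. L2_inner t (\<lambda>w. h w - g w) k = 0)"
  \<comment> \<open>The difference of two candidates lies in the Fock space and is orthogonal to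
    itself.\<close>
  define d where "d = (\<lambda>w. g w - bproj t h w)"
  have d: "d \<in> fock t" unfolding d_def by (intro fock_diff B) (use g in auto)
  have "L2_inner t d d = L2_inner t h d - L2_inner t (bproj t h) d - (L2_inner t h d - L2_inner t g d)"
    using g h B d by (subst d_def) (simp add: L2_inner_diff_left fock_L2)
  also have "\<dots> = 0"
    using g h B d by (simp add: L2_inner_diff_left[symmetric] fock_L2 bproj_inner)
  finally have "L2_nrm t d = 0" by (simp add: L2_nrm_inner)
  from fock_nrm_zero[OF d this] show "g = bproj t h" by (auto simp: d_def fun_eq_iff)
qed

lemma toeplitz_apply: "g \<in> toeplitz_dom t \<phi> \<Longrightarrow> toeplitz t \<phi> g = bproj t (\<lambda>w. \<phi> w * g w)"
  by (simp add: toeplitz_def toeplitz_dom_def fock_proj_eq)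

lemma toeplitz_dom_bounded:
  assumes "p \<in> borel_measurable borel" "\<And>w. cmod (p w) \<le> B"
  shows "toeplitz_dom t p = fock t"
  using L2_bounded_mult[OF assms(1) fock_L2 assms(2)] by (auto simp: toeplitz_dom_def)

end

section \<open>The Weyl group and its integrated form\<close>

text \<open>\<open>weyl t z\<close> is the one-parameter unitary group \<open>exp (- i s A)\<close> generated by the Toeplitz operator \<open>A\<close>
  with symbol \<open>2 \<sigma>\<^sub>t(\<cdot>, z)\<close>.\<close>

definition weyl :: "real ^ 'n \<Rightarrow> complex ^ 'n \<Rightarrow> real \<Rightarrow> (complex ^ 'n \<Rightarrow> complex) \<Rightarrow> complex ^ 'n \<Rightarrow> complex" where
  "weyl t z s f u = exp (- (of_real s * tform t u z) - of_real (s\<^sup>2 * qform t z / 2)) * f (u + s *\<^sub>R z)"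

text \<open>Integrated separately at each \<open>u\<close>; on Fock functions
  \<open>weyl_pointwise\<close> makes the integral converge absolutely for every integrable
  \<open>H\<close>.\<close>

definition weyl_int :: "real ^ 'n \<Rightarrow> complex ^ 'n \<Rightarrow> (real \<Rightarrow> complex) \<Rightarrow> (complex ^ 'n \<Rightarrow> complex) \<Rightarrow> complex ^ 'n \<Rightarrow> complex" where
  "weyl_int t z H f u = (LINT s|lborel. H s * weyl t z s f u)"

definition weyl_op :: "real ^ 'n \<Rightarrow> complex ^ 'n \<Rightarrow> (real \<Rightarrow> complex) \<Rightarrow> 'n fock_op" where
  "weyl_op t z H = (\<lambda>f\<in>fock t. weyl_int t z H f)"

lemma weyl_zero [simp]: "weyl t z 0 f = f"
  by (simp add: weyl_def fun_eq_iff)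

text \<open>Both shifts lie along the same \<open>z\<close>, so no phase appears: evaluating the
  form at \<open>u + s *\<^sub>R z\<close> contributes \<open>- r s |z|^2\<close>, the cross term of
  \<open>- (s + r)^2 |z|^2 / 2\<close>.\<close>

lemma weyl_add: "weyl t z s (weyl t z r f) = weyl t z (s + r) f"
proof
  fix u
  have "- (of_real s * tform t u z) - of_real (s\<^sup>2 * qform t z / 2) + 
      (- (of_real r * tform t (u + s *\<^sub>R z) z) - of_real (r\<^sup>2 * qform t z / 2))
    = - (of_real (s + r) * tform t u z) - of_real ((s + r)\<^sup>2 * qform t z / 2)"
    by (simp add: tform_simps tform_self power2_sum) (simp add: field_simps)
  then show "weyl t z s (weyl t z r f) u = weyl t z (s + r) f u"
    unfolding weyl_def by (simp add: mult.assoc[symmetric] exp_add[symmetric] scaleR_add_left add.assoc)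
qed

lemma weyl_plus: "weyl t z s (\<lambda>w. f w + g w) u = weyl t z s f u + weyl t z s g u"
  by (simp add: weyl_def algebra_simps)

lemma weyl_cmult: "weyl t z s (\<lambda>w. c * f w) u = c * weyl t z s f u"
  by (simp add: weyl_def)

lemma ennreal_le_if_square_le: "x\<^sup>2 \<le> (ennreal b)\<^sup>2 \<Longrightarrow> x \<le> ennreal b"
  by (cases x; cases "b \<ge> 0") (auto simp: ennreal_power ennreal_neg top_unique dest: power2_le_imp_le)

lemma borel_measurable_weyl [measurable]:
  assumes "f \<in> fock t" "a \<in> borel_measurable M" "b \<in> borel_measurable M"
  shows "(\<lambda>x. weyl t z (a x) f (b x)) \<in> borel_measurable M"
  using fock_measurable[OF assms(1)] assms(2,3) unfolding weyl_def by measurable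

context weights
begin

lemma nn_integral_weyl:
  assumes [measurable]: "f \<in> borel_measurable borel"
  shows "(\<integral>\<^sup>+u. ennreal ((cmod (weyl t z s f u))\<^sup>2) \<partial>fock_measure t) = (\<integral>\<^sup>+u. ennreal ((cmod (f u))\<^sup>2) \<partial>fock_measure t)"
proof -
  have "(cmod (weyl t z s f u))\<^sup>2 = exp (- 2 * Re (tform t u (s *\<^sub>R z)) - qform t (s *\<^sub>R z)) * (cmod (f (u + s *\<^sub>R z)))\<^sup>2" for u
    by (simp add: weyl_def norm_mult power_mult_distrib exp_double[symmetric] tform_simps qform_scaleR algebra_simps)
  then show ?thesis
    using nn_integral_fock_translate[of "\<lambda>u. ennreal ((cmod (f u))\<^sup>2)" "s *\<^sub>R z"]
    by (simp add: ennreal_mult')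
qed

lemma weyl_fock:
  assumes f: "f \<in> fock t"
  shows "weyl t z s f \<in> fock t"
proof -
  have "weyl t z s f \<in> L2_fun t"
    using L2_nn_finite[OF fock_L2[OF f]] borel_measurable_weyl[OF f, of "\<lambda>_. s" borel "\<lambda>u. u" z]
    by (intro L2_funI) (auto simp: nn_integral_weyl fock_measurable[OF f])
  moreover have "weyl t z s f \<in> entire"
  proof -
    have "weyl t z s f = (\<lambda>u. exp (of_real (- s) * tform t u z) * (exp (- of_real (s\<^sup>2 * qform t z / 2)) * f (u + s *\<^sub>R z)))"
      by (simp add: weyl_def fun_eq_iff mult.assoc[symmetric] exp_add[symmetric])
    then show ?thesis
      by (simp only:) (intro entire_mult entire_exp_tform entire_const entire_shift fock_entire[OF f])
  qed
  ultimately show ?thesis by (simp add: fock_def)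
qed

lemma weyl_nrm:
  assumes f: "f \<in> fock t"
  shows "L2_nrm t (weyl t z s f) = L2_nrm t f"
  using nn_integral_weyl[OF fock_measurable[OF f], of z s] nn_integral_L2[OF fock_L2[OF f]]
    nn_integral_L2[OF fock_L2[OF weyl_fock[OF f, of z s]]]
  by simp

section \<open>Pointwise bounds and integration along the group\<close>

lemma nn_integral_L2_mult:
  assumes f: "f \<in> L2_fun t" and g: "g \<in> L2_fun t"
  shows "(\<integral>\<^sup>+w. ennreal (cmod (f w * g w)) \<partial>fock_measure t) \<le> ennreal (L2_nrm t f * L2_nrm t g)"
proof -
  note [measurable] = L2_measurable[OF f] L2_measurable[OF g]
  have "(\<integral>\<^sup>+w. ennreal (cmod (f w)) * ennreal (cmod (g w)) \<partial>fock_measure t)\<^sup>2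
     \<le> (\<integral>\<^sup>+w. (ennreal (cmod (f w)))\<^sup>2 \<partial>fock_measure t) * (\<integral>\<^sup>+w. (ennreal (cmod (g w)))\<^sup>2 \<partial>fock_measure t)"
    by (rule Cauchy_Schwarz_nn_integral) measurable
  also have "\<dots> = (ennreal (L2_nrm t f * L2_nrm t g))\<^sup>2"
    by (simp add: ennreal_power nn_integral_L2 f g ennreal_mult[symmetric] power_mult_distrib)
  finally have "(\<integral>\<^sup>+w. ennreal (cmod (f w)) * ennreal (cmod (g w)) \<partial>fock_measure t) \<le> ennreal (L2_nrm t f * L2_nrm t g)"
    by (rule ennreal_le_if_square_le)
  then show ?thesis by (simp add: norm_mult ennreal_mult)
qed

lemma fock_pointwise:
  assumes f: "f \<in> fock t"
  shows "cmod (f u) \<le> L2_nrm t f * L2_nrm t (\<lambda>w. exp (tform t u w))"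
proof -
  have E: "(\<lambda>w. exp (tform t u w)) \<in> L2_fun t" using exp_tform_L2[of 1 u] by simp
  have "ennreal (cmod (bproj t f u)) \<le> (\<integral>\<^sup>+w. ennreal (cmod (f w * exp (tform t u w))) \<partial>fock_measure t)"
    unfolding bproj_def by (rule integral_norm_bound_ennreal[OF bproj_integrable[OF fock_L2[OF f]]])
  also have "\<dots> \<le> ennreal (L2_nrm t f * L2_nrm t (\<lambda>w. exp (tform t u w)))"
    by (rule nn_integral_L2_mult[OF fock_L2[OF f] E])
  finally show ?thesis by (simp add: bproj_fock[OF f])
qed

text \<open>The bound is uniform in \<open>s\<close>, because point evaluations are bounded and Weyl
  operators preserve the norm.\<close>

lemma weyl_pointwise: "f \<in> fock t \<Longrightarrow> cmod (weyl t z s f u) \<le> L2_nrm t f * L2_nrm t (\<lambda>w. exp (tform t u w))"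
  using fock_pointwise[OF weyl_fock, of f z s u] by (simp add: weyl_nrm)

lemma weyl_int_integrable:
  assumes f: "f \<in> fock t" and H: "integrable lborel H"
  shows "integrable lborel (\<lambda>s. H s * weyl t z s f u)"
proof -
  note [measurable] = f borel_measurable_integrable[OF H]
  define B where "B = L2_nrm t f * L2_nrm t (\<lambda>w. exp (tform t u w))"
  have B: "B \<ge> 0" by (simp add: B_def)
  have "integrable lborel (\<lambda>s. B * cmod (H s))" using H by simp
  then show ?thesis
  proof (rule Bochner_Integration.integrable_bound)
    show "AE s in lborel. norm (H s * weyl t z s f u) \<le> norm (B * cmod (H s))"
      using mult_left_mono[OF weyl_pointwise[OF f] norm_ge_zero] B
      by (intro AE_I2) (simp add: norm_mult B_def abs_mult mult.commute)
  qed measurable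
qed

lemma weyl_int_measurable:
  assumes f: "f \<in> fock t" and H: "integrable lborel H"
  shows "weyl_int t z H f \<in> borel_measurable borel"
proof -
  note [measurable] = f borel_measurable_integrable[OF H]
  show ?thesis unfolding weyl_int_def by measurable
qed

text \<open>The uniform bound on the inner integrals gives absolute integrability on the product. In
  both applications it comes from Cauchy-Schwarz against the kernel
  \<open>exp (tform t u w)\<close>.\<close>

lemma Fubini_weighted:
  fixes H :: "real \<Rightarrow> complex" and F :: "real \<Rightarrow> complex ^ 'n \<Rightarrow> complex"
  assumes H: "integrable lborel H" and F: "(\<lambda>(s, w). F s w) \<in> borel_measurable (lborel \<Otimes>\<^sub>M fock_measure t)"
    and le: "\<And>s. (\<integral>\<^sup>+w. ennreal (cmod (F s w)) \<partial>fock_measure t) \<le> ennreal B"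
  shows "(LINT w|fock_measure t. LINT s|lborel. H s * F s w) = (LINT s|lborel. H s * (LINT w|fock_measure t. F s w))"
proof -
  interpret pair_sigma_finite "lborel :: real measure" "fock_measure t" ..
  note [measurable] = borel_measurable_integrable[OF H] F
  have "integrable (lborel \<Otimes>\<^sub>M fock_measure t) (\<lambda>(s, w). H s * F s w)"
  proof (rule integrableI_bounded)
    have "(\<integral>\<^sup>+p. ennreal (norm (case p of (s, w) \<Rightarrow> H s * F s w)) \<partial>(lborel \<Otimes>\<^sub>M fock_measure t))
      = (\<integral>\<^sup>+s. \<integral>\<^sup>+w. ennreal (cmod (H s * F s w)) \<partial>fock_measure t \<partial>lborel)"
      by (subst \<mu>.nn_integral_fst[symmetric]) auto
    also have "\<dots> = (\<integral>\<^sup>+s. ennreal (cmod (H s)) * (\<integral>\<^sup>+w. ennreal (cmod (F s w)) \<partial>fock_measure t) \<partial>lborel)"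
      by (intro nn_integral_cong, subst nn_integral_cmult[symmetric]) (auto simp: norm_mult ennreal_mult)
    also have "\<dots> \<le> (\<integral>\<^sup>+s. ennreal (cmod (H s)) * ennreal B \<partial>lborel)"
      by (intro nn_integral_mono mult_left_mono le) auto
    also have "\<dots> < \<infinity>"
      using H by (simp add: nn_integral_multc integrable_iff_bounded ennreal_mult_less_top)
    finally show "(\<integral>\<^sup>+p. ennreal (norm (case p of (s, w) \<Rightarrow> H s * F s w)) \<partial>(lborel \<Otimes>\<^sub>M fock_measure t)) < \<infinity>" .
  qed measurable
  from Fubini_integral[OF this] show ?thesis by simp
qed

text \<open>A form of Minkowski's integral inequality: Cauchy-Schwarz with weight
  \<open>cmod (H s)\<close>, then Tonelli, after which every Weyl operator contributes the same
  norm.\<close>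

lemma weyl_int_bound:
  assumes f: "f \<in> fock t" and H: "integrable lborel H"
  shows "(\<integral>\<^sup>+u. ennreal ((cmod (weyl_int t z H f u))\<^sup>2) \<partial>fock_measure t)
    \<le> ennreal (((LINT s|lborel. cmod (H s)) * L2_nrm t f)\<^sup>2)"
proof -
  interpret P: pair_sigma_finite "fock_measure t" "lborel :: real measure" ..
  note [measurable] = f borel_measurable_integrable[OF H]
  define N where "N = (LINT s|lborel. cmod (H s))"
  have N: "(\<integral>\<^sup>+s. ennreal (cmod (H s)) \<partial>lborel) = ennreal N"
    unfolding N_def using H by (intro nn_integral_eq_integral) auto
  have N0: "N \<ge> 0" by (simp add: N_def)
  have "ennreal ((cmod (weyl_int t z H f u))\<^sup>2) \<le> ennreal N * (\<integral>\<^sup>+s. ennreal (cmod (H s)) * ennreal ((cmod (weyl t z s f u))\<^sup>2) \<partial>lborel)" for u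
  proof -
    have "ennreal (cmod (weyl_int t z H f u)) \<le> (\<integral>\<^sup>+s. ennreal (cmod (H s * weyl t z s f u)) \<partial>lborel)"
      unfolding weyl_int_def by (rule integral_norm_bound_ennreal[OF weyl_int_integrable[OF f H]])
    also have "\<dots> = (\<integral>\<^sup>+s. ennreal (cmod (H s)) * ennreal (cmod (weyl t z s f u)) \<partial>lborel)"
      by (simp add: norm_mult ennreal_mult)
    finally have "(ennreal (cmod (weyl_int t z H f u)))\<^sup>2 \<le> (\<integral>\<^sup>+s. ennreal (cmod (H s)) * ennreal (cmod (weyl t z s f u)) \<partial>lborel)\<^sup>2"
      by (rule power_mono) simp
    also have "\<dots> \<le> (\<integral>\<^sup>+s. ennreal (cmod (H s)) \<partial>lborel) * (\<integral>\<^sup>+s. ennreal (cmod (H s)) * (ennreal (cmod (weyl t z s f u)))\<^sup>2 \<partial>lborel)"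
      by (rule nn_integral_weighted_square) auto
    finally show ?thesis by (simp add: N ennreal_power)
  qed
  then have "(\<integral>\<^sup>+u. ennreal ((cmod (weyl_int t z H f u))\<^sup>2) \<partial>fock_measure t)
     \<le> (\<integral>\<^sup>+u. ennreal N * (\<integral>\<^sup>+s. ennreal (cmod (H s)) * ennreal ((cmod (weyl t z s f u))\<^sup>2) \<partial>lborel) \<partial>fock_measure t)"
    by (intro nn_integral_mono)
  also have "\<dots> = ennreal N * (\<integral>\<^sup>+u. (\<integral>\<^sup>+s. ennreal (cmod (H s)) * ennreal ((cmod (weyl t z s f u))\<^sup>2) \<partial>lborel) \<partial>fock_measure t)"
    by (rule nn_integral_cmult) measurable
  also have "(\<integral>\<^sup>+u. (\<integral>\<^sup>+s. ennreal (cmod (H s)) * ennreal ((cmod (weyl t z s f u))\<^sup>2) \<partial>lborel) \<partial>fock_measure t)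
    = (\<integral>\<^sup>+s. (\<integral>\<^sup>+u. ennreal (cmod (H s)) * ennreal ((cmod (weyl t z s f u))\<^sup>2) \<partial>fock_measure t) \<partial>lborel)"
    by (rule P.Fubini'[symmetric]) measurable
  also have "\<dots> = (\<integral>\<^sup>+s. ennreal (cmod (H s)) * ennreal ((L2_nrm t f)\<^sup>2) \<partial>lborel)"
    by (simp add: nn_integral_cmult nn_integral_weyl nn_integral_L2 fock_L2 fock_measurable f)
  also have "\<dots> = ennreal N * ennreal ((L2_nrm t f)\<^sup>2)"
    by (simp add: nn_integral_multc N)
  also have "ennreal N * (ennreal N * ennreal ((L2_nrm t f)\<^sup>2)) = ennreal ((N * L2_nrm t f)\<^sup>2)"
    using N0 by (simp add: ennreal_mult[symmetric] power2_eq_square mult_ac)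
  finally show ?thesis by (simp add: N_def)
qed

text \<open>Holomorphy is inherited from \<open>bproj\<close>: the projection commutes with the
  integral over \<open>s\<close> and fixes every Weyl image, so the integrated function equals its
  own projection.\<close>

lemma weyl_int_fock:
  assumes f: "f \<in> fock t" and H: "integrable lborel H"
  shows "weyl_int t z H f \<in> fock t"
proof -
  note [measurable] = f borel_measurable_integrable[OF H]
  have L2: "weyl_int t z H f \<in> L2_fun t"
    using weyl_int_bound[OF f H, of z] by (intro L2_funI weyl_int_measurable f H) (auto simp: le_less_trans)
  have "bproj t (weyl_int t z H f) = weyl_int t z H f"
  proof
    fix u
    have E: "(\<lambda>w. exp (tform t u w)) \<in> L2_fun t" using exp_tform_L2[of 1 u] by simp
    have "bproj t (weyl_int t z H f) u = (LINT w|fock_measure t. LINT s|lborel. H s * (weyl t z s f w * exp (tform t u w)))"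
      unfolding bproj_def weyl_int_def by (simp flip: integral_mult_left_zero mult.assoc)
    also have "\<dots> = (LINT s|lborel. H s * (LINT w|fock_measure t. weyl t z s f w * exp (tform t u w)))"
    proof (rule Fubini_weighted[OF H])
      show "(\<lambda>(s, w). weyl t z s f w * exp (tform t u w)) \<in> borel_measurable (lborel \<Otimes>\<^sub>M fock_measure t)"
        by measurable
      show "(\<integral>\<^sup>+w. ennreal (cmod (weyl t z s f w * exp (tform t u w))) \<partial>fock_measure t)
         \<le> ennreal (L2_nrm t f * L2_nrm t (\<lambda>w. exp (tform t u w)))" for s
        using nn_integral_L2_mult[OF fock_L2[OF weyl_fock[OF f]] E] by (simp add: weyl_nrm f)
    qed
    also have "\<dots> = weyl_int t z H f u"
      unfolding weyl_int_def by (simp add: bproj_fock[OF weyl_fock[OF f]] flip: bproj_def)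
    finally show "bproj t (weyl_int t z H f) u = weyl_int t z H f u" .
  qed
  with bproj_in_fock[OF L2] show ?thesis by simp
qed

lemma weyl_int_nrm:
  assumes f: "f \<in> fock t" and H: "integrable lborel H"
  shows "L2_nrm t (weyl_int t z H f) \<le> (LINT s|lborel. cmod (H s)) * L2_nrm t f"
  by (rule L2_nrm_le[OF fock_L2[OF weyl_int_fock[OF f H]] weyl_int_bound[OF f H]]) simp

section \<open>Integrated Weyl operators as bounded operators\<close>

lemma weyl_op_bounded:
  assumes H: "integrable lborel H"
  shows "weyl_op t z H \<in> bounded_ops t"
  unfolding bounded_ops_def
proof (intro CollectI conjI ballI allI exI)
  show "weyl_op t z H \<in> fock t \<rightarrow>\<^sub>E fock t"
    by (auto simp: weyl_op_def weyl_int_fock H)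
  show "weyl_op t z H (\<lambda>w. f w + g w) = (\<lambda>w. weyl_op t z H f w + weyl_op t z H g w)"
    if "f \<in> fock t" "g \<in> fock t" for f g
    using that by (auto simp: weyl_op_def fock_add weyl_int_def weyl_plus distrib_left weyl_int_integrable H)
  show "weyl_op t z H (\<lambda>w. c * f w) = (\<lambda>w. c * weyl_op t z H f w)" if "f \<in> fock t" for f c
    using that by (auto simp: weyl_op_def fock_cmult weyl_int_def weyl_cmult mult.left_commute[of _ c])
  show "L2_nrm t (weyl_op t z H f) \<le> (LINT s|lborel. cmod (H s)) * L2_nrm t f" if "f \<in> fock t" for f
    using that by (simp add: weyl_op_def weyl_int_nrm H)
qed

lemma weyl_op_add:
  assumes "integrable lborel H" "integrable lborel G"
  shows "op_add t (weyl_op t z H) (weyl_op t z G) = weyl_op t z (\<lambda>s. H s + G s)"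
  using assms by (auto simp: op_add_def weyl_op_def fun_eq_iff restrict_def weyl_int_def distrib_right weyl_int_integrable)

lemma weyl_op_scale: "op_scale t c (weyl_op t z H) = weyl_op t z (\<lambda>s. c * H s)"
  by (auto simp: op_scale_def weyl_op_def fun_eq_iff restrict_def weyl_int_def mult.assoc)

lemma weyl_op_norm:
  assumes H: "integrable lborel H"
  shows "op_norm t (weyl_op t z H) \<le> (LINT s|lborel. cmod (H s))" "0 \<le> op_norm t (weyl_op t z H)"
proof -
  define S where "S = {L2_nrm t (weyl_op t z H f) |f. f \<in> fock t \<and> L2_nrm t f \<le> 1}"
  have ub: "x \<le> (LINT s|lborel. cmod (H s))" if x: "x \<in> S" for x
  proof -
    obtain f where f: "x = L2_nrm t (weyl_op t z H f)" "f \<in> fock t" "L2_nrm t f \<le> 1"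
      using x by (auto simp: S_def)
    have "x \<le> (LINT s|lborel. cmod (H s)) * L2_nrm t f"
      using f H by (simp add: weyl_op_def weyl_int_nrm)
    also have "\<dots> \<le> (LINT s|lborel. cmod (H s)) * 1"
      using f by (intro mult_left_mono) auto
    finally show ?thesis by simp
  qed
  \<comment> \<open>\<open>Sup\<close> is meaningful only for a nonempty bounded set; the zero
    function supplies a member.\<close>
  have ne: "L2_nrm t (weyl_op t z H (\<lambda>w. 0)) \<in> S"
    by (auto simp: S_def fock_zero L2_nrm_def)
  show "op_norm t (weyl_op t z H) \<le> (LINT s|lborel. cmod (H s))"
    unfolding op_norm_def S_def[symmetric] using ne by (intro cSup_least ub) auto
  have "0 \<le> L2_nrm t (weyl_op t z H (\<lambda>w. 0))" by simp
  also have "\<dots> \<le> op_norm t (weyl_op t z H)"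
    unfolding op_norm_def S_def[symmetric] using ne ub by (intro cSup_upper bdd_aboveI)
  finally show "0 \<le> op_norm t (weyl_op t z H)" .
qed

text \<open>The passage from \<open>H\<close> to its operator is linear and contractive from the
  \<open>L^1\<close> norm to the operator norm, so norm closedness of the algebra becomes closedness
  of the kernels under \<open>L^1\<close> limits.\<close>

lemma weyl_op_closed:
  assumes A: "cstar_subalgebra t \<A>" and H: "integrable lborel H" and K: "\<And>k. integrable lborel (K k)"
    and mem: "\<And>k. weyl_op t z (K k) \<in> \<A>"
    and lim: "(\<lambda>k::nat. LINT s|lborel. cmod (K k s - H s)) \<longlonglongrightarrow> 0"
  shows "weyl_op t z H \<in> \<A>"
proof -
  have eq: "op_add t (weyl_op t z (K k)) (op_scale t (- 1) (weyl_op t z H)) = weyl_op t z (\<lambda>s. K k s - H s)" for k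
    using H K by (simp add: weyl_op_scale weyl_op_add)
  have lim': "(\<lambda>k. op_norm t (op_add t (weyl_op t z (K k)) (op_scale t (- 1) (weyl_op t z H)))) \<longlonglongrightarrow> 0"
    unfolding eq
    by (rule tendsto_sandwich[OF _ _ tendsto_const lim]) (auto intro!: always_eventually weyl_op_norm H K)
  have closed: "\<forall>X. \<forall>B\<in>bounded_ops t. (\<forall>k. X k \<in> \<A>) \<longrightarrow>
      (\<lambda>k::nat. op_norm t (op_add t (X k) (op_scale t (- 1) B))) \<longlonglongrightarrow> 0 \<longrightarrow> B \<in> \<A>"
    using A unfolding cstar_subalgebra_def by (elim conjE) assumption
  show ?thesis
    using closed[rule_format, OF weyl_op_bounded[OF H], of "\<lambda>k. weyl_op t z (K k)"] mem lim' by simp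
qed

end

section \<open>Symbols of integrated Weyl operators\<close>

definition osc :: "real ^ 'n \<Rightarrow> complex ^ 'n \<Rightarrow> real \<Rightarrow> complex ^ 'n \<Rightarrow> complex" where
  "osc t z s w = exp (- (\<i> * of_real (s * (2 * sigma_t t w z))))"

text \<open>The exponential factor undoes the Gaussian smoothing of symbols by Toeplitz quantization.\<close>

definition weyl_symbol :: "real ^ 'n \<Rightarrow> complex ^ 'n \<Rightarrow> (real \<Rightarrow> complex) \<Rightarrow> complex ^ 'n \<Rightarrow> complex" where
  "weyl_symbol t z H w = (LINT s|lborel. H s * of_real (exp (s\<^sup>2 * qform t z / 2)) * osc t z s w)"

text \<open>The first factor is holomorphic in \<open>w\<close> and can join the function; the
  second has the shape of the reproducing kernel and moves the evaluation point by
  \<open>s *\<^sub>R z\<close>.\<close>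

lemma osc_conv: "osc t z s w = exp (of_real (- s) * tform t w z) * exp (of_real s * tform t z w)"
proof -
  have "tform t w z - tform t z w = of_real (2 * sigma_t t w z) * \<i>"
    using complex_diff_cnj[of "tform t w z"] by (simp add: cnj_tform sigma_t_def)
  then have "- (\<i> * of_real (s * (2 * sigma_t t w z))) = of_real (- s) * tform t w z + of_real s * tform t z w"
    by (simp add: algebra_simps)
  then show ?thesis unfolding osc_def exp_add[symmetric] by (rule arg_cong)
qed

lemma norm_osc [simp]: "cmod (osc t z s w) = 1"
  by (simp add: osc_def)

lemma borel_measurable_sigma_t [measurable (raw)]:
  assumes [measurable]: "f \<in> borel_measurable M"
  shows "(\<lambda>x. sigma_t t (f x) z) \<in> borel_measurable M"
  unfolding sigma_t_def by measurable

lemma borel_measurable_osc [measurable (raw)]: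
  assumes [measurable]: "a \<in> borel_measurable M" "f \<in> borel_measurable M"
  shows "(\<lambda>x. osc t z (a x) (f x)) \<in> borel_measurable M"
  unfolding osc_def by measurable

lemma osc_shift: "osc t z s (w - v) = osc t z s w * exp (\<i> * of_real (s * (2 * sigma_t t v z)))"
  by (simp add: osc_def exp_add[symmetric] sigma_t_def tform_simps algebra_simps)

text \<open>A chord of the unit circle is at most as long as its arc.\<close>

lemma norm_osc_diff: "cmod (osc t z s w - osc t z s v) \<le> 2 * \<bar>s\<bar> * \<bar>sigma_t t w z - sigma_t t v z\<bar>"
proof -
  define x where "x = s * (2 * (sigma_t t v z - sigma_t t w z))"
  have "osc t z s w = osc t z s v * exp (\<i> * of_real x)"
    by (simp add: osc_def x_def exp_add[symmetric] algebra_simps)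
  then have "osc t z s w - osc t z s v = osc t z s v * (exp (\<i> * of_real x) - 1)"
    by (simp add: algebra_simps)
  then have "cmod (osc t z s w - osc t z s v) = 2 * \<bar>sin (x / 2)\<bar>"
    by (simp add: norm_mult dist_exp_i_1)
  also have "\<dots> \<le> \<bar>x\<bar>"
    using abs_sin_x_le_abs_x[of "x / 2"] by simp
  also have "\<bar>x\<bar> = 2 * \<bar>s\<bar> * \<bar>sigma_t t w z - sigma_t t v z\<bar>"
    unfolding x_def abs_mult by (simp add: abs_minus_commute)
  finally show ?thesis .
qed

context weights
begin

text \<open>The antiholomorphic factor of \<open>osc\<close> merges with the kernel at
  \<open>u\<close> into the kernel at \<open>u + s *\<^sub>R z\<close>, where the holomorphic rest
  is evaluated. Compared with \<open>weyl\<close>, the exponent contains an additional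
  \<open>- s^2 |z|^2 / 2\<close>: this is the damping that \<open>weyl_symbol\<close>
  compensates.\<close>

lemma bproj_osc:
  assumes g: "g \<in> fock t"
  shows "bproj t (\<lambda>w. osc t z s w * g w) u = of_real (exp (- (s\<^sup>2 * qform t z / 2))) * weyl t z s g u"
proof -
  define F where "F w = exp (of_real (- s) * tform t w z) * g w" for w
  define a where "a = u + s *\<^sub>R z"
  have L2: "(\<lambda>w. osc t z s w * g w) \<in> L2_fun t"
    by (rule L2_bounded_mult[OF _ fock_L2[OF g], of _ 1]) auto
  have eq: "osc t z s w * g w * exp (tform t u w) = F w * exp (tform t a w)" for w
    by (simp add: osc_conv F_def a_def tform_simps exp_add)
  have "F \<in> entire"
    unfolding F_def by (intro entire_mult entire_exp_tform fock_entire[OF g])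
  then have "bproj t (\<lambda>w. osc t z s w * g w) u = F a"
    using bproj_integrable[OF L2, of u] unfolding bproj_def eq by (rule reproducing)
  also have "F a = of_real (exp (- (s\<^sup>2 * qform t z / 2))) * weyl t z s g u"
  proof -
    have "of_real (- s) * tform t a z = of_real (- (s\<^sup>2 * qform t z / 2)) + (- (of_real s * tform t u z) - of_real (s\<^sup>2 * qform t z / 2))"
      by (simp add: a_def tform_simps tform_self field_simps power2_eq_square)
    then show ?thesis
      unfolding F_def weyl_def a_def[symmetric] exp_of_real[symmetric] mult.assoc[symmetric] exp_add[symmetric] by simp
  qed
  finally show ?thesis .
qed

context
  fixes H :: "real \<Rightarrow> complex" and N :: real and z :: "complex ^ 'n"
  assumes H: "integrable lborel H" and supp: "\<And>s. N < \<bar>s\<bar> \<Longrightarrow> H s = 0"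
begin

text \<open>On the support of \<open>H\<close> the weight is at most
  \<open>exp (N\<^sup>2 * qform t z / 2)\<close>; here compact support pays for the growth of the
  weight.\<close>

lemma symbol_weight_integrable: "integrable lborel (\<lambda>s. H s * of_real (exp (s\<^sup>2 * qform t z / 2)))"
proof -
  note [measurable] = borel_measurable_integrable[OF H]
  have "integrable lborel (\<lambda>s. exp (N\<^sup>2 * qform t z / 2) * cmod (H s))" using H by simp
  then show ?thesis
  proof (rule Bochner_Integration.integrable_bound)
    have "cmod (H s) * exp (s\<^sup>2 * qform t z / 2) \<le> exp (N\<^sup>2 * qform t z / 2) * cmod (H s)" for s
    proof (cases "\<bar>s\<bar> \<le> N")
      case True
      then have "s\<^sup>2 \<le> N\<^sup>2" by (metis abs_le_square_iff abs_of_nonneg abs_ge_zero order_trans)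
      then show ?thesis by (simp add: mult.commute mult_left_mono mult_right_mono)
    qed (simp add: supp)
    then show "AE s in lborel. norm (H s * of_real (exp (s\<^sup>2 * qform t z / 2))) \<le> norm (exp (N\<^sup>2 * qform t z / 2) * cmod (H s))"
      by (intro AE_I2) (simp add: norm_mult)
  qed measurable
qed

lemma symbol_integrable: "integrable lborel (\<lambda>s. H s * of_real (exp (s\<^sup>2 * qform t z / 2)) * osc t z s w)"
proof (rule Bochner_Integration.integrable_bound[OF symbol_weight_integrable])
  show "(\<lambda>s. H s * of_real (exp (s\<^sup>2 * qform t z / 2)) * osc t z s w) \<in> borel_measurable lborel"
    using borel_measurable_integrable[OF H] by measurable
qed (simp add: norm_mult)

lemma weyl_symbol_bounded:
  "cmod (weyl_symbol t z H w) \<le> (LINT s|lborel. cmod (H s * of_real (exp (s\<^sup>2 * qform t z / 2))))"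
  unfolding weyl_symbol_def
  by (rule order_trans[OF integral_norm_bound]) (simp add: norm_mult)

lemma weyl_symbol_measurable: "weyl_symbol t z H \<in> borel_measurable borel"
  using borel_measurable_integrable[OF H] unfolding weyl_symbol_def by measurable

text \<open>Only frequencies with \<open>\<bar>s\<bar> \<le> N\<close> occur, and each oscillation
  is Lipschitz in \<open>w\<close> with a constant proportional to \<open>\<bar>s\<bar>\<close>, so
  the symbol is even Lipschitz.\<close>

lemma weyl_symbol_BUC: "weyl_symbol t z H \<in> BUC"
proof -
  define B where "B = (LINT s|lborel. cmod (H s * of_real (exp (s\<^sup>2 * qform t z / 2))))"
  have B: "B \<ge> 0" by (simp add: B_def)
  define S where "S = (\<Sum>j\<in>UNIV. 1 / t $ j) * norm z"
  have S: "S \<ge> 0" unfolding S_def by (intro mult_nonneg_nonneg sum_nonneg) (auto simp: less_imp_le[OF pos])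
  have sig: "\<bar>sigma_t t w z - sigma_t t v z\<bar> \<le> S * norm (w - v)" for v w
  proof -
    have "\<bar>sigma_t t w z - sigma_t t v z\<bar> \<le> cmod (tform t (w - v) z)"
      using abs_Im_le_cmod[of "tform t (w - v) z"] by (simp add: sigma_t_def tform_simps)
    also have "\<dots> \<le> S * norm (w - v)" using norm_tform_le[of "w - v" z] by (simp add: S_def mult_ac)
    finally show ?thesis .
  qed
  have "dist (weyl_symbol t z H w) (weyl_symbol t z H v) \<le> (2 * \<bar>N\<bar> * S * B) * dist w v" for w v
  proof -
    define d where "d = 2 * \<bar>N\<bar> * (S * norm (w - v))"
    have "dist (weyl_symbol t z H w) (weyl_symbol t z H v) =
       cmod (LINT s|lborel. H s * of_real (exp (s\<^sup>2 * qform t z / 2)) * (osc t z s w - osc t z s v))"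
      by (simp add: weyl_symbol_def dist_norm symbol_integrable right_diff_distrib)
    also have "\<dots> \<le> (LINT s|lborel. d * cmod (H s * of_real (exp (s\<^sup>2 * qform t z / 2))))"
    proof (rule order_trans[OF integral_norm_bound], rule integral_mono_AE')
      show "integrable lborel (\<lambda>s. d * cmod (H s * of_real (exp (s\<^sup>2 * qform t z / 2))))"
        using integrable_norm[OF symbol_weight_integrable] by simp
      have "cmod (H s * of_real (exp (s\<^sup>2 * qform t z / 2)) * (osc t z s w - osc t z s v))
        \<le> d * cmod (H s * of_real (exp (s\<^sup>2 * qform t z / 2)))" for s
      proof (cases "\<bar>s\<bar> \<le> N")
        case True
        have "cmod (osc t z s w - osc t z s v) \<le> d"
          unfolding d_def using True
          by (intro order_trans[OF norm_osc_diff] mult_mono sig) auto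
        then show ?thesis by (simp add: norm_mult[of "H s * _"] mult.commute[of d] mult_left_mono)
      qed (simp add: supp)
      then show "AE s in lborel. norm (H s * of_real (exp (s\<^sup>2 * qform t z / 2)) * (osc t z s w - osc t z s v))
        \<le> d * cmod (H s * of_real (exp (s\<^sup>2 * qform t z / 2)))"
        by simp
    qed (auto simp: d_def intro!: mult_nonneg_nonneg S)
    also have "\<dots> = (2 * \<bar>N\<bar> * S * B) * dist w v"
      by (simp add: B_def d_def dist_norm mult_ac)
    finally show ?thesis .
  qed
  then have "(2 * \<bar>N\<bar> * S * B)-lipschitz_on UNIV (weyl_symbol t z H)"
    using B S by (intro lipschitz_onI) auto
  from lipschitz_on_uniformly_continuous[OF this] show ?thesis
    using weyl_symbol_bounded by (auto simp: BUC_def bounded_iff)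
qed

text \<open>Fubini carries the projection under the integral over \<open>s\<close>, where the
  damping found in \<open>bproj_osc\<close> cancels the exponential weight of the symbol.\<close>

lemma toeplitz_weyl_symbol: "toeplitz t (weyl_symbol t z H) = weyl_op t z H"
proof -
  have dom: "toeplitz_dom t (weyl_symbol t z H) = fock t"
    using weyl_symbol_measurable weyl_symbol_bounded by (rule toeplitz_dom_bounded)
  have "bproj t (\<lambda>w. weyl_symbol t z H w * g w) u = weyl_int t z H g u" if g: "g \<in> fock t" for g u
  proof -
    note [measurable] = fock_measurable[OF g]
    have E: "(\<lambda>w. exp (tform t u w)) \<in> L2_fun t" using exp_tform_L2[of 1 u] by simp
    have "bproj t (\<lambda>w. weyl_symbol t z H w * g w) u =
      (LINT w|fock_measure t. LINT s|lborel. H s * of_real (exp (s\<^sup>2 * qform t z / 2)) * (osc t z s w * (g w * exp (tform t u w))))"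
      unfolding bproj_def weyl_symbol_def by (simp flip: integral_mult_left_zero mult.assoc)
    also have "\<dots> = (LINT s|lborel. H s * of_real (exp (s\<^sup>2 * qform t z / 2)) * (LINT w|fock_measure t. osc t z s w * (g w * exp (tform t u w))))"
    proof (rule Fubini_weighted[OF symbol_weight_integrable])
      show "(\<lambda>(s, w). osc t z s w * (g w * exp (tform t u w))) \<in> borel_measurable (lborel \<Otimes>\<^sub>M fock_measure t)"
        by measurable
      show "(\<integral>\<^sup>+w. ennreal (cmod (osc t z s w * (g w * exp (tform t u w)))) \<partial>fock_measure t)
         \<le> ennreal (L2_nrm t g * L2_nrm t (\<lambda>w. exp (tform t u w)))" for s
        using nn_integral_L2_mult[OF fock_L2[OF g] E] by (simp add: norm_mult)
    qed
    also have "\<dots> = (LINT s|lborel. H s * of_real (exp (s\<^sup>2 * qform t z / 2)) * (bproj t (\<lambda>w. osc t z s w * g w) u))"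
      by (simp add: bproj_def mult.assoc)
    also have "\<dots> = weyl_int t z H g u"
      unfolding weyl_int_def bproj_osc[OF g]
      by (intro Bochner_Integration.integral_cong refl) (simp add: exp_minus flip: exp_of_real)
    finally show ?thesis .
  qed
  then show ?thesis
    using dom by (auto simp: fun_eq_iff weyl_op_def restrict_def toeplitz_apply) (auto simp: toeplitz_def)
qed

end

end

section \<open>Resolvents\<close>

text \<open>Derivatives at 0 are tested along \<open>1 / real (Suc n)\<close>, since Fatou's lemma
  and dominated convergence are applied to sequences. The derivative is one-sided because Laplace
  orbits are described explicitly for nonnegative times.\<close>

lemma tendsto_scaled_sequence:
  fixes F :: "real \<Rightarrow> 'b :: real_normed_vector"
  assumes F: "(F has_vector_derivative D) (at 0 within {0..1})" and 0: "F 0 = 0"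
  shows "(\<lambda>n. real (Suc n) *\<^sub>R F (1 / real (Suc n))) \<longlonglongrightarrow> D"
proof -
  have "((\<lambda>y. (1 / norm (y - 0)) *\<^sub>R (F y - (F 0 + (y - 0) *\<^sub>R D))) \<longlongrightarrow> 0) (at 0 within {0..1})"
    using F unfolding has_vector_derivative_def has_derivative_within by blast
  moreover have "filterlim (\<lambda>n. 1 / real (Suc n)) (at 0 within {0..1}) sequentially"
    unfolding filterlim_at using LIMSEQ_inverse_real_of_nat by (auto simp: inverse_eq_divide)
  ultimately have "(\<lambda>n. (1 / norm (1 / real (Suc n) - 0)) *\<^sub>R (F (1 / real (Suc n)) - (F 0 + (1 / real (Suc n) - 0) *\<^sub>R D))) \<longlonglongrightarrow> 0"
    by (rule filterlim_compose)
  then have "(\<lambda>n. real (Suc n) *\<^sub>R F (1 / real (Suc n)) - D) \<longlonglongrightarrow> 0"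
    by (simp add: 0 scaleR_diff_right del: of_nat_Suc)
  then show ?thesis by (simp add: Lim_null[symmetric])
qed

lemma exp_quotient: "(\<lambda>n. of_nat (Suc n) * (exp (a / of_nat (Suc n)) - 1)) \<longlonglongrightarrow> (a :: complex)"
proof -
  have "((\<lambda>x. exp (a * x) - 1) has_field_derivative a) (at (of_real 0))"
    by (auto intro!: derivative_eq_intros)
  then have "((\<lambda>x. exp (a * of_real x) - 1) has_vector_derivative a) (at 0 within {0..1})"
    by (rule has_vector_derivative_real_field)
  from tendsto_scaled_sequence[OF this] show ?thesis
    by (simp add: scaleR_conv_of_real del: of_nat_Suc)
qed

context weights
begin

text \<open>Multiplication by \<open>osc\<close> preserves the norm, and its compression to the Fock
  space is \<open>c\<close> times the Weyl operator. Expanding both squares turns the left side into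
  \<open>2 (1 - c) |g|^2 + c D\<close>, where \<open>1 - c\<close> is of order
  \<open>s^2\<close>.\<close>

lemma osc_quotient_nrm:
  assumes g: "g \<in> fock t"
  shows "(L2_nrm t (\<lambda>w. osc t z s w * g w - g w))\<^sup>2 \<le> s\<^sup>2 * qform t z * (L2_nrm t g)\<^sup>2 + (L2_nrm t (\<lambda>w. weyl t z s g w - g w))\<^sup>2"
proof -
  define c where "c = exp (- (s\<^sup>2 * qform t z / 2))"
  have c: "0 \<le> c" "c \<le> 1" "1 - c \<le> s\<^sup>2 * qform t z / 2"
    using exp_ge_add_one_self[of "- (s\<^sup>2 * qform t z / 2)"] by (auto simp: c_def)
  have L2: "(\<lambda>w. osc t z s w * g w) \<in> L2_fun t"
    by (rule L2_bounded_mult[OF _ fock_L2[OF g], of _ 1]) auto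
  have "bproj t (\<lambda>w. osc t z s w * g w) = (\<lambda>u. of_real c * weyl t z s g u)"
    by (simp add: bproj_osc[OF g] c_def fun_eq_iff)
  then have in1: "L2_inner t (\<lambda>w. osc t z s w * g w) g = of_real c * L2_inner t (weyl t z s g) g"
    using bproj_inner[OF L2 g] by (simp add: L2_inner_cmult_left)
  have n1: "L2_nrm t (\<lambda>w. osc t z s w * g w) = L2_nrm t g"
    by (simp add: L2_nrm_def norm_mult)
  define D where "D = (L2_nrm t (\<lambda>w. weyl t z s g w - g w))\<^sup>2"
  have D: "D = 2 * (L2_nrm t g)\<^sup>2 - 2 * Re (L2_inner t (weyl t z s g) g)"
    unfolding D_def by (simp add: L2_nrm_diff_sq fock_L2 weyl_fock g weyl_nrm)
  have "(L2_nrm t (\<lambda>w. osc t z s w * g w - g w))\<^sup>2 = 2 * (L2_nrm t g)\<^sup>2 - 2 * c * Re (L2_inner t (weyl t z s g) g)"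
    by (simp add: L2_nrm_diff_sq L2 fock_L2 g n1 in1)
  also have "\<dots> = 2 * (1 - c) * (L2_nrm t g)\<^sup>2 + c * D"
    by (simp add: D algebra_simps)
  also have "\<dots> \<le> s\<^sup>2 * qform t z * (L2_nrm t g)\<^sup>2 + 1 * D"
    using c by (intro add_mono mult_right_mono) (auto simp: D_def)
  finally show ?thesis by (simp add: D_def)
qed

text \<open>Vectors on which the Weyl group is Lipschitz continuous belong to the domain of its generator:
  the difference quotients of the oscillating symbol stay bounded, so Fatou's lemma applies.\<close>

lemma toeplitz_dom_lipschitz:
  assumes g: "g \<in> fock t" and le: "\<And>s. 0 < s \<Longrightarrow> L2_nrm t (\<lambda>w. weyl t z s g w - g w) \<le> B * s"
  shows "g \<in> toeplitz_dom t (\<lambda>w. of_real (2 * sigma_t t w z))"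
proof -
  note [measurable] = fock_measurable[OF g]
  \<comment> \<open>\<open>D\<close> is the bound of \<open>osc_quotient_nrm\<close> divided by
    \<open>s\<^sup>2\<close>, hence independent of the step.\<close>
  define D where "D = qform t z * (L2_nrm t g)\<^sup>2 + B\<^sup>2"
  define q where "q n w = of_nat (Suc n) * (osc t z (1 / real (Suc n)) w * g w - g w)" for n w
  have [measurable]: "q n \<in> borel_measurable borel" for n unfolding q_def by measurable
  have q2: "q n \<in> L2_fun t" for n
    unfolding q_def
    by (intro L2_cmult L2_diff L2_bounded_mult[of _ _ _ 1] fock_L2[OF g]) auto
  have qn: "(\<integral>\<^sup>+w. ennreal ((cmod (q n w))\<^sup>2) \<partial>fock_measure t) \<le> ennreal D" for n
  proof -
    define s where "s = 1 / real (Suc n)"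
    have s: "s > 0" by (simp add: s_def)
    have "(L2_nrm t (\<lambda>w. weyl t z s g w - g w))\<^sup>2 \<le> (B * s)\<^sup>2"
      by (intro power_mono le s) auto
    then have "(L2_nrm t (\<lambda>w. osc t z s w * g w - g w))\<^sup>2 \<le> D * s\<^sup>2"
      using osc_quotient_nrm[OF g, of z s] by (simp add: D_def algebra_simps power_mult_distrib)
    then have "(real (Suc n))\<^sup>2 * (L2_nrm t (\<lambda>w. osc t z s w * g w - g w))\<^sup>2 \<le> (real (Suc n))\<^sup>2 * (D * s\<^sup>2)"
      by (intro mult_left_mono) auto
    also have "(real (Suc n))\<^sup>2 * (D * s\<^sup>2) = D"
      by (simp add: s_def power_divide del: of_nat_Suc)
    also have "(real (Suc n))\<^sup>2 * (L2_nrm t (\<lambda>w. osc t z s w * g w - g w))\<^sup>2 = (L2_nrm t (q n))\<^sup>2"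
      unfolding q_def s_def[symmetric] L2_nrm_cmult by (simp add: power_mult_distrib del: of_nat_Suc)
    finally show ?thesis by (simp add: nn_integral_L2[OF q2] ennreal_leI)
  qed
  have lim: "(\<lambda>n. ennreal ((cmod (q n w))\<^sup>2)) \<longlonglongrightarrow> ennreal ((cmod (of_real (2 * sigma_t t w z) * g w))\<^sup>2)" for w
  proof -
    have "q n w = of_nat (Suc n) * (exp (- (\<i> * of_real (2 * sigma_t t w z)) / of_nat (Suc n)) - 1) * g w" for n
      by (simp add: q_def osc_def algebra_simps del: of_nat_Suc)
    then have "(\<lambda>n. q n w) \<longlonglongrightarrow> - (\<i> * of_real (2 * sigma_t t w z)) * g w"
      by (simp only:) (intro tendsto_intros exp_quotient)
    from tendsto_ennrealI[OF tendsto_power[OF tendsto_norm[OF this], of 2]] show ?thesis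
      by (simp add: norm_mult)
  qed
  have "(\<integral>\<^sup>+w. ennreal ((cmod (of_real (2 * sigma_t t w z) * g w))\<^sup>2) \<partial>fock_measure t)
    = (\<integral>\<^sup>+w. liminf (\<lambda>n. ennreal ((cmod (q n w))\<^sup>2)) \<partial>fock_measure t)"
    by (intro nn_integral_cong lim_imp_Liminf[symmetric] lim) simp
  also have "\<dots> \<le> liminf (\<lambda>n. \<integral>\<^sup>+w. ennreal ((cmod (q n w))\<^sup>2) \<partial>fock_measure t)"
    by (rule nn_integral_liminf) measurable
  also have "\<dots> \<le> liminf (\<lambda>n::nat. ennreal D)"
    by (intro Liminf_mono always_eventually allI qn)
  also have "\<dots> < \<infinity>" by (simp add: Liminf_const)
  finally have "(\<lambda>w. of_real (2 * sigma_t t w z) * g w) \<in> L2_fun t"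
    by (intro L2_funI) auto
  then show ?thesis using g by (simp add: toeplitz_dom_def)
qed

text \<open>By \<open>bproj_osc\<close> the sequence consists of difference quotients of the
  projection of \<open>osc\<close> times \<open>g\<close>. Dominated convergence passes to the
  derivative of \<open>osc\<close> at \<open>s = 0\<close>; the dominating function is integrable
  because \<open>g\<close> lies in the domain.\<close>

lemma bproj_sigma_limit:
  assumes g: "g \<in> toeplitz_dom t (\<lambda>w. of_real (2 * sigma_t t w z))"
  shows "(\<lambda>n. of_nat (Suc n) * (of_real (exp (- ((1 / real (Suc n))\<^sup>2 * qform t z / 2))) * weyl t z (1 / real (Suc n)) g u - g u))
    \<longlonglongrightarrow> - \<i> * bproj t (\<lambda>w. of_real (2 * sigma_t t w z) * g w) u"
proof -
  have gf: "g \<in> fock t" and L2: "(\<lambda>w. of_real (2 * sigma_t t w z) * g w) \<in> L2_fun t"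
    using g by (auto simp: toeplitz_dom_def)
  note [measurable] = fock_measurable[OF gf]
  define q where "q n w = of_nat (Suc n) * (osc t z (1 / real (Suc n)) w - 1) * g w * exp (tform t u w)" for n w
  have [measurable]: "q n \<in> borel_measurable borel" for n unfolding q_def by measurable
  have q: "q n w = of_nat (Suc n) * (exp (- (\<i> * of_real (2 * sigma_t t w z)) / of_nat (Suc n)) - 1) * g w * exp (tform t u w)" for n w
    by (simp add: q_def osc_def algebra_simps del: of_nat_Suc)
  have bp: "bproj t (\<lambda>w. c * (osc t z s w * g w - g w)) u = c * (of_real (exp (- (s\<^sup>2 * qform t z / 2))) * weyl t z s g u - g u)" for s c
  proof -
    have O: "(\<lambda>w. osc t z s w * g w) \<in> L2_fun t"
      by (rule L2_bounded_mult[OF _ fock_L2[OF gf], of _ 1]) auto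
    have "(\<lambda>w. osc t z s w * g w - g w) = (\<lambda>w. osc t z s w * g w + (- 1) * g w)" by simp
    then show ?thesis
      using bproj_add[OF O L2_cmult[OF fock_L2[OF gf], of "- 1"]]
      by (simp only: bproj_cmult bproj_osc[OF gf] bproj_fock[OF gf]) simp
  qed
  have "(\<lambda>n. LINT w|fock_measure t. q n w) \<longlonglongrightarrow>
     (LINT w|fock_measure t. - \<i> * (of_real (2 * sigma_t t w z) * g w * exp (tform t u w)))"
  proof (rule integral_dominated_convergence)
    show "integrable (fock_measure t) (\<lambda>w. cmod (of_real (2 * sigma_t t w z) * g w * exp (tform t u w)))"
      by (rule integrable_norm[OF bproj_integrable[OF L2]])
    show "AE w in fock_measure t. (\<lambda>n. q n w) \<longlonglongrightarrow> - \<i> * (of_real (2 * sigma_t t w z) * g w * exp (tform t u w))"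
    proof (rule AE_I2)
      fix w
      have "(\<lambda>n. q n w) \<longlonglongrightarrow> - (\<i> * of_real (2 * sigma_t t w z)) * g w * exp (tform t u w)"
        unfolding q by (intro tendsto_intros exp_quotient)
      then show "(\<lambda>n. q n w) \<longlonglongrightarrow> - \<i> * (of_real (2 * sigma_t t w z) * g w * exp (tform t u w))"
        by (simp add: mult.assoc)
    qed
    fix n
    have *: "cmod (of_nat (Suc n) * (osc t z (1 / real (Suc n)) w - 1)) \<le> cmod (of_real (2 * sigma_t t w z))" for w
    proof -
      have "cmod (osc t z (1 / real (Suc n)) w - 1) \<le> 2 * (1 / real (Suc n)) * \<bar>sigma_t t w z\<bar>"
        using norm_osc_diff[of t z "1 / real (Suc n)" w 0] by (simp add: osc_def sigma_t_def tform_simps)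
      from mult_left_mono[OF this, of "real (Suc n)"] show ?thesis
        by (simp add: norm_mult abs_mult del: of_nat_Suc)
    qed
    show "AE w in fock_measure t. norm (q n w) \<le> cmod (of_real (2 * sigma_t t w z) * g w * exp (tform t u w))"
      unfolding q_def norm_mult[of _ "exp _"] norm_mult[of _ "g _"]
      by (intro AE_I2 mult_right_mono *) auto
  qed measurable
  moreover have "(LINT w|fock_measure t. q n w) = of_nat (Suc n) * (of_real (exp (- ((1 / real (Suc n))\<^sup>2 * qform t z / 2))) * weyl t z (1 / real (Suc n)) g u - g u)" for n
    unfolding bp[symmetric] by (simp only: bproj_def q_def) (simp add: algebra_simps del: of_nat_Suc)
  ultimately show ?thesis by (simp only: bproj_def integral_mult_right_zero)
qed

end

section \<open>Laplace integrals of the Weyl orbits\<close>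

definition laplace :: "real \<Rightarrow> real \<Rightarrow> real" where
  "laplace l s = (if 0 \<le> s then exp (- (l * s)) else 0)"

lemma laplace_nonneg [simp]: "0 \<le> laplace l s"
  by (simp add: laplace_def)

lemma borel_measurable_laplace [measurable]: "laplace l \<in> borel_measurable borel"
  unfolding laplace_def by measurable

lemma laplace_integrable:
  assumes l: "l > 0"
  shows "integrable lborel (laplace l)"
proof -
  interpret prob_space "density lborel (exponential_density l)"
    using l by (rule prob_space_exponential_density)
  have "(\<integral>\<^sup>+s. ennreal (exponential_density l s) \<partial>lborel) = 1"
    using emeasure_space_1 by (simp add: emeasure_density)
  then have "integrable lborel (exponential_density l)"
    using l by (intro integrableI_nonneg) (auto simp: exponential_density_def)
  then have "integrable lborel (\<lambda>s. (1 / l) * exponential_density l s)"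
    by (rule integrable_mult_right)
  moreover have "laplace l s = (1 / l) * exponential_density l s" for s
    using l by (auto simp: laplace_def exponential_density_def mult.commute)
  ultimately show ?thesis by (simp only: cong: Bochner_Integration.integrable_cong)
qed

text \<open>The half-open interval makes the identity exact at \<open>s = r\<close> as well, where
  the shifted kernel already has its value 1.\<close>

lemma laplace_shift: "0 \<le> r \<Longrightarrow> laplace l (s - r) = exp (l * r) * (laplace l s - indicator {0..<r} s * exp (- (l * s)))"
  by (auto simp: laplace_def indicator_def exp_add[symmetric] algebra_simps)

context weights
begin

lemma weyl_weyl_int:
  "weyl t z r (weyl_int t z H f) = weyl_int t z (\<lambda>s. H (s - r)) f"
proof
  fix u
  have "weyl t z r (weyl_int t z H f) u = (LINT s|lborel. H s * weyl t z r (weyl t z s f) u)"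
    unfolding weyl_int_def weyl_def[of t z r] by (simp add: mult.left_commute flip: integral_mult_right_zero)
  also have "\<dots> = (LINT s|lborel. H s * weyl t z (s + r) f u)"
    by (simp add: weyl_add add.commute)
  also have "\<dots> = (LINT s|lborel. H (s - r) * weyl t z s f u)"
    by (subst lborel_integral_real_affine[of 1 _ "- r"]) simp_all
  finally show "weyl t z r (weyl_int t z H f) u = weyl_int t z (\<lambda>s. H (s - r)) f u"
    by (simp add: weyl_int_def)
qed

text \<open>Moving along the orbit translates the kernel, and a kernel that jumps from 0 to 1 and
  then decreases changes by at most \<open>2 * s\<close> in the \<open>L^1\<close> norm. This
  supplies the hypothesis of \<open>toeplitz_dom_lipschitz\<close>.\<close>

lemma laplace_orbit_lipschitz:
  fixes z :: "complex ^ 'n"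
  assumes l: "l > 0" and f: "f \<in> fock t" and s: "s > 0"
  defines "g \<equiv> weyl_int t z (\<lambda>s. of_real (laplace l s)) f"
  shows "L2_nrm t (\<lambda>w. weyl t z s g w - g w) \<le> 2 * L2_nrm t f * s"
proof -
  have I: "integrable lborel (laplace l)" by (rule laplace_integrable[OF l])
  have Is: "integrable lborel (\<lambda>r. laplace l (r - s))"
    using lborel_integrable_real_affine[OF I, of 1 "- s"] by simp
  have int_s: "(LINT r|lborel. laplace l (r - s)) = (LINT r|lborel. laplace l r)"
    by (subst (2) lborel_integral_real_affine[of 1 _ "- s"]) simp_all
  have Ii: "integrable lborel (indicator {0..s} :: real \<Rightarrow> real)"
    using s by (intro integrable_real_indicator) auto
  define H where "H r = complex_of_real (laplace l (r - s) - laplace l r)" for r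
  have H: "integrable lborel H" unfolding H_def using I Is by (intro integrable_of_real) auto
  have "weyl t z s g w - g w = weyl_int t z H f w" for w
    unfolding g_def weyl_weyl_int
    using f I Is by (simp add: weyl_int_def H_def left_diff_distrib weyl_int_integrable)
  then have "L2_nrm t (\<lambda>w. weyl t z s g w - g w) \<le> (LINT r|lborel. cmod (H r)) * L2_nrm t f"
    using weyl_int_nrm[OF f H, of z] by simp
  \<comment> \<open>An absolute value is the number itself plus twice its negative part. The
    negative part is at most the indicator of \<open>{0..s}\<close>, and the difference itself
    integrates to 0 by translation invariance.\<close>
  also have "(LINT r|lborel. cmod (H r)) \<le> (LINT r|lborel. laplace l (r - s) - laplace l r + 2 * indicator {0..s} r)"
  proof (rule integral_mono)
    show "integrable lborel (\<lambda>r. laplace l (r - s) - laplace l r + 2 * indicator {0..s} r)"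
      using I Is Ii by simp
    show "integrable lborel (\<lambda>r. cmod (H r))" using H by simp
    fix r
    have "\<bar>laplace l (r - s) - laplace l r\<bar> \<le> laplace l (r - s) - laplace l r + 2 * indicator {0..s} r"
    proof (cases "r < s")
      case True
      moreover have "exp (- (l * r)) \<le> 1" if "0 \<le> r" using l that by simp
      ultimately show ?thesis by (auto simp: laplace_def indicator_def)
    next
      case False
      then have "laplace l r \<le> laplace l (r - s)" using l s by (simp add: laplace_def)
      then show ?thesis by (simp add: indicator_def)
    qed
    then show "cmod (H r) \<le> laplace l (r - s) - laplace l r + 2 * indicator {0..s} r"
      by (simp only: H_def norm_of_real)
  qed
  also have "\<dots> = 2 * s"
    using s I Is Ii by (simp add: int_s)
  finally show ?thesis by (simp add: mult_right_mono mult_ac)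
qed

text \<open>Up to the factor \<open>exp (l * r)\<close>, moving along the orbit only removes the
  piece of the integral over \<open>{0..r}\<close>; in this form the fundamental theorem of calculus
  gives the derivative at \<open>r = 0\<close>.\<close>

lemma laplace_orbit_explicit:
  fixes z u :: "complex ^ 'n"
  assumes l: "l > 0" and f: "f \<in> fock t" and r: "r \<ge> 0"
  defines "g \<equiv> weyl_int t z (\<lambda>s. of_real (laplace l s)) f"
  defines "k \<equiv> \<lambda>s. of_real (exp (- (l * s))) * weyl t z s f u"
  shows "continuous_on S k"
    and "weyl t z r g u = of_real (exp (l * r)) * (g u - integral {0..r} k)"
proof -
  have cf: "continuous_on UNIV f" by (rule entire_continuous[OF fock_entire[OF f]])
  show k: "continuous_on S k" for S
    unfolding k_def weyl_def
    by (intro continuous_intros continuous_on_compose2[OF cf]) auto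
  have I: "integrable lborel (\<lambda>s. complex_of_real (laplace l s))"
    using laplace_integrable[OF l] by simp
  have set: "set_integrable lborel {0..r} k"
    by (rule borel_integrable_atLeastAtMost'[OF k])
  \<comment> \<open>The shift removes a half-open interval, while \<open>integral\<close> is taken
    over the closed one; they differ by a null set.\<close>
  have ae: "AE s in lborel. indicator {0..<r} s *\<^sub>R k s = indicator {0..r} s *\<^sub>R k s"
    using AE_lborel_singleton[of r] by eventually_elim (auto simp: indicator_def)
  have [measurable]: "k \<in> borel_measurable borel"
    by (rule borel_measurable_continuous_onI[OF k])
  have I': "integrable lborel (\<lambda>s. indicator {0..<r} s *\<^sub>R k s)"
    using set unfolding set_integrable_def
    by (subst integrable_cong_AE[OF _ _ ae]) measurable
  have "(LINT s|lborel. indicator {0..<r} s *\<^sub>R k s) = (LINT s:{0..r}|lborel. k s)"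
    unfolding set_lebesgue_integral_def by (rule integral_cong_AE[OF _ _ ae]) measurable
  then have int: "(LINT s|lborel. indicator {0..<r} s *\<^sub>R k s) = integral {0..r} k"
    using set_borel_integral_eq_integral(2)[OF set] by simp
  have "weyl t z r g u = (LINT s|lborel. of_real (laplace l (s - r)) * weyl t z s f u)"
    unfolding g_def weyl_weyl_int by (simp add: weyl_int_def)
  also have "\<dots> = (LINT s|lborel. of_real (exp (l * r)) * (of_real (laplace l s) * weyl t z s f u - indicator {0..<r} s *\<^sub>R k s))"
    by (intro Bochner_Integration.integral_cong refl)
       (simp add: laplace_shift[OF r] k_def algebra_simps scaleR_conv_of_real)
  also have "\<dots> = of_real (exp (l * r)) * (g u - integral {0..r} k)"
    unfolding g_def weyl_int_def using weyl_int_integrable[OF f I] I'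
    by (simp only: integral_mult_right_zero Bochner_Integration.integral_diff int)
  finally show "weyl t z r g u = of_real (exp (l * r)) * (g u - integral {0..r} k)" .
qed

text \<open>One sequence of difference quotients has two limits: \<open>bproj_sigma_limit\<close>
  yields the Toeplitz operator, the explicit orbit yields \<open>of_real l * g u - f u\<close>.
  Equating them gives the resolvent equation up to a factor \<open>\<i>\<close>.\<close>

lemma laplace_resolvent_equation:
  fixes z :: "complex ^ 'n"
  assumes l: "l > 0" and f: "f \<in> fock t"
  defines "g \<equiv> weyl_int t z (\<lambda>s. of_real (laplace l s)) f"
  shows "g \<in> toeplitz_dom t (\<lambda>w. of_real (2 * sigma_t t w z))"
    and "bproj t (\<lambda>w. of_real (2 * sigma_t t w z) * g w) = (\<lambda>u. \<i> * (of_real l * g u - f u))"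
proof -
  have I: "integrable lborel (\<lambda>s. complex_of_real (laplace l s))"
    using laplace_integrable[OF l] by simp
  have gf: "g \<in> fock t" unfolding g_def by (rule weyl_int_fock[OF f I])
  show dom: "g \<in> toeplitz_dom t (\<lambda>w. of_real (2 * sigma_t t w z))"
    using toeplitz_dom_lipschitz[OF gf] laplace_orbit_lipschitz[OF l f, of _ z]
    unfolding g_def by blast
  show "bproj t (\<lambda>w. of_real (2 * sigma_t t w z) * g w) = (\<lambda>u. \<i> * (of_real l * g u - f u))"
  proof
    fix u
    define k where "k s = of_real (exp (- (l * s))) * weyl t z s f u" for s
    \<comment> \<open>\<open>e\<close> joins the growth of the orbit with the damping of
      \<open>bproj_osc\<close>; the damping is quadratic in the exponent and leaves the derivative
      at 0 equal to \<open>l\<close>.\<close>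
    define e where "e r = exp (l * r - r\<^sup>2 * qform t z / 2)" for r
    define F where "F r = of_real (e r) * (g u - integral {0..r} k) - g u" for r
    have k: "continuous_on {0..1} k"
      using laplace_orbit_explicit(1)[OF l f order_refl, where z = z and u = u] by (simp add: k_def[abs_def])
    have dk: "((\<lambda>r. integral {0..r} k) has_vector_derivative f u) (at 0 within {0..1})"
      using integral_has_vector_derivative[OF k, of 0] by (simp add: k_def)
    have "(e has_real_derivative l) (at 0)"
      unfolding e_def by (auto intro!: derivative_eq_intros)
    then have "(e has_real_derivative l) (at 0 within {0..1})"
      by (rule has_field_derivative_at_within)
    then have de: "((\<lambda>r. complex_of_real (e r)) has_vector_derivative of_real l) (at 0 within {0..1})"
      by (intro has_vector_derivative_of_real)
    have "(F has_vector_derivative of_real l * g u - f u) (at 0 within {0..1})"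
      unfolding F_def
      by (rule has_vector_derivative_eq_rhs, (rule derivative_intros de dk)+) (simp add: e_def)
    moreover have "F 0 = 0" by (simp add: F_def e_def)
    ultimately have lim: "(\<lambda>n. real (Suc n) *\<^sub>R F (1 / real (Suc n))) \<longlonglongrightarrow> of_real l * g u - f u"
      by (rule tendsto_scaled_sequence)
    have quot: "real (Suc n) *\<^sub>R F (1 / real (Suc n)) =
       of_nat (Suc n) * (of_real (exp (- ((1 / real (Suc n))\<^sup>2 * qform t z / 2))) * weyl t z (1 / real (Suc n)) g u - g u)" for n
    proof -
      define r where "r = 1 / real (Suc n)"
      have r: "r \<ge> 0" by (simp add: r_def)
      have "weyl t z r g u = of_real (exp (l * r)) * (g u - integral {0..r} k)"
        unfolding g_def k_def[abs_def] by (rule laplace_orbit_explicit(2)[OF l f r])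
      moreover have "e r = exp (- (r\<^sup>2 * qform t z / 2)) * exp (l * r)"
        by (simp add: e_def exp_add[symmetric])
      ultimately have "F r = of_real (exp (- (r\<^sup>2 * qform t z / 2))) * weyl t z r g u - g u"
        by (simp add: F_def mult.assoc)
      then show ?thesis
        unfolding r_def[symmetric] by (simp add: scaleR_conv_of_real del: of_nat_Suc)
    qed
    have "- \<i> * bproj t (\<lambda>w. of_real (2 * sigma_t t w z) * g w) u = of_real l * g u - f u"
      by (rule LIMSEQ_unique[OF bproj_sigma_limit[OF dom] lim[unfolded quot]])
    then have "\<i> * (- \<i> * bproj t (\<lambda>w. of_real (2 * sigma_t t w z) * g w) u) = \<i> * (of_real l * g u - f u)"
      by simp
    then show "bproj t (\<lambda>w. of_real (2 * sigma_t t w z) * g w) u = \<i> * (of_real l * g u - f u)"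
      by (simp add: mult.assoc[symmetric])
  qed
qed

section \<open>Symmetry and identification of the inverse\<close>

lemma toeplitz_dom_lincomb:
  assumes "g \<in> toeplitz_dom t \<phi>" "h \<in> toeplitz_dom t \<phi>"
  shows "(\<lambda>w. g w + c * h w) \<in> toeplitz_dom t \<phi>"
    and "bproj t (\<lambda>w. \<phi> w * (g w + c * h w)) = (\<lambda>u. bproj t (\<lambda>w. \<phi> w * g w) u + c * bproj t (\<lambda>w. \<phi> w * h w) u)"
proof -
  have g: "g \<in> fock t" "(\<lambda>w. \<phi> w * g w) \<in> L2_fun t" and h: "h \<in> fock t" "(\<lambda>w. \<phi> w * h w) \<in> L2_fun t"
    using assms by (auto simp: toeplitz_dom_def)
  have eq: "(\<lambda>w. \<phi> w * (g w + c * h w)) = (\<lambda>w. \<phi> w * g w + c * (\<phi> w * h w))"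
    by (simp add: algebra_simps)
  show "(\<lambda>w. g w + c * h w) \<in> toeplitz_dom t \<phi>"
    unfolding toeplitz_dom_def mem_Collect_eq eq by (intro conjI fock_add fock_cmult L2_add L2_cmult g h)
  show "bproj t (\<lambda>w. \<phi> w * (g w + c * h w)) = (\<lambda>u. bproj t (\<lambda>w. \<phi> w * g w) u + c * bproj t (\<lambda>w. \<phi> w * h w) u)"
    unfolding eq by (simp add: bproj_add bproj_cmult L2_cmult g h)
qed

text \<open>Pairing the equation with \<open>g\<close> makes one side purely imaginary and the other
  the integral of \<open>\<phi> w\<close> times the squared modulus of \<open>g w\<close>, which is
  real.\<close>

lemma symmetric_no_imaginary_eigenvalue:
  fixes \<phi> :: "complex ^ 'n \<Rightarrow> real"
  assumes g: "g \<in> toeplitz_dom t (\<lambda>w. of_real (\<phi> w))" and l: "l \<noteq> 0"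
    and eq: "(\<lambda>w. \<i> * of_real l * g w) = bproj t (\<lambda>w. of_real (\<phi> w) * g w)"
  shows "g = (\<lambda>w. 0)"
proof -
  have gf: "g \<in> fock t" and L2: "(\<lambda>w. of_real (\<phi> w) * g w) \<in> L2_fun t"
    using g by (auto simp: toeplitz_dom_def)
  have "\<i> * of_real l * of_real ((L2_nrm t g)\<^sup>2) = L2_inner t (\<lambda>w. \<i> * of_real l * g w) g"
    unfolding L2_inner_cmult_left L2_nrm_inner ..
  also have "\<dots> = L2_inner t (\<lambda>w. of_real (\<phi> w) * g w) g"
    unfolding eq by (rule bproj_inner[OF L2 gf])
  also have "\<dots> = of_real (LINT w|fock_measure t. \<phi> w * (cmod (g w))\<^sup>2)"
  proof -
    have "of_real (\<phi> w) * g w * cnj (g w) = complex_of_real (\<phi> w * (cmod (g w))\<^sup>2)" for w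
      by (simp add: mult.assoc flip: complex_norm_square)
    then show ?thesis by (simp only: L2_inner_def integral_complex_of_real)
  qed
  finally have "Im (\<i> * of_real l * of_real ((L2_nrm t g)\<^sup>2)) = 0" by (simp only: Im_complex_of_real)
  then have "L2_nrm t g = 0" using l by simp
  then show ?thesis by (rule fock_nrm_zero[OF gf])
qed

text \<open>\<open>the_inv_into\<close> calls for injectivity, which comes from symmetry applied to
  a difference, and for a preimage of each \<open>f\<close>, which \<open>R\<close>
  provides.\<close>

lemma toeplitz_resolvent_eqI:
  fixes \<phi> :: "complex ^ 'n \<Rightarrow> real"
  assumes l: "l \<noteq> 0" and dom: "\<And>f. f \<in> fock t \<Longrightarrow> R f \<in> toeplitz_dom t (\<lambda>w. of_real (\<phi> w))"
    and eq: "\<And>f. f \<in> fock t \<Longrightarrow> bproj t (\<lambda>w. of_real (\<phi> w) * R f w) = (\<lambda>u. \<i> * of_real l * R f u - f u)"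
  shows "toeplitz_resolvent t (\<lambda>w. of_real (\<phi> w)) (\<i> * of_real l) = restrict R (fock t)"
proof -
  let ?D = "toeplitz_dom t (\<lambda>w. of_real (\<phi> w))"
  let ?T = "\<lambda>g w. \<i> * of_real l * g w - toeplitz t (\<lambda>w. of_real (\<phi> w)) g w"
  have inj: "inj_on ?T ?D"
  proof (rule inj_onI)
    fix g h assume g: "g \<in> ?D" and h: "h \<in> ?D" and gh: "?T g = ?T h"
    define d where "d w = g w + (- 1) * h w" for w
    have d: "d \<in> ?D" unfolding d_def by (rule toeplitz_dom_lincomb[OF g h])
    have "(\<lambda>w. \<i> * of_real l * d w) = bproj t (\<lambda>w. of_real (\<phi> w) * d w)"
      unfolding d_def toeplitz_dom_lincomb(2)[OF g h]
      using gh by (auto simp: fun_eq_iff toeplitz_apply g h algebra_simps)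
    from symmetric_no_imaginary_eigenvalue[OF d l this] show "g = h"
      by (auto simp: d_def fun_eq_iff)
  qed
  have "the_inv_into ?D ?T f = R f" if f: "f \<in> fock t" for f
    using inj _ dom[OF f] by (rule the_inv_into_f_eq) (simp add: toeplitz_apply dom eq f)
  then show ?thesis by (auto simp: toeplitz_resolvent_def restrict_def fun_eq_iff)
qed

text \<open>By \<open>laplace_resolvent_equation\<close>, \<open>\<i> * of_real l\<close> minus the
  Toeplitz operator maps the Laplace integral of \<open>f\<close> to \<open>\<i>\<close> times
  \<open>f\<close>, whence the scalar \<open>- \<i>\<close>.\<close>

lemma resolvent_pos:
  assumes l: "l > 0"
  shows "toeplitz_resolvent t (\<lambda>w. of_real (2 * sigma_t t w z)) (\<i> * of_real l)
    = op_scale t (- \<i>) (weyl_op t z (\<lambda>s. of_real (laplace l s)))"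
proof -
  define G where "G f = weyl_int t z (\<lambda>s. of_real (laplace l s)) f" for f
  define R where "R f w = - \<i> * G f w" for f w
  have "toeplitz_resolvent t (\<lambda>w. of_real (2 * sigma_t t w z)) (\<i> * of_real l) = restrict R (fock t)"
  proof (rule toeplitz_resolvent_eqI)
    fix f assume f: "f \<in> fock t"
    note G = laplace_resolvent_equation[OF l f, of z, folded G_def]
    have Z: "(\<lambda>w. 0) \<in> toeplitz_dom t (\<lambda>w. of_real (2 * sigma_t t w z))"
      by (simp add: toeplitz_dom_def fock_zero fock_L2)
    show "R f \<in> toeplitz_dom t (\<lambda>w. of_real (2 * sigma_t t w z))"
      using toeplitz_dom_lincomb(1)[OF Z G(1), of "- \<i>"] by (simp add: R_def[abs_def])
    have eq: "(\<lambda>w. of_real (2 * sigma_t t w z) * R f w) = (\<lambda>w. - \<i> * (of_real (2 * sigma_t t w z) * G f w))"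
      by (simp add: R_def fun_eq_iff)
    show "bproj t (\<lambda>w. of_real (2 * sigma_t t w z) * R f w) = (\<lambda>u. \<i> * of_real l * R f u - f u)"
      unfolding eq bproj_cmult G(2) by (simp add: R_def fun_eq_iff algebra_simps)
  qed (use l in auto)
  then show ?thesis
    by (auto simp: op_scale_def weyl_op_def R_def G_def restrict_def fun_eq_iff)
qed

text \<open>Replacing \<open>z\<close> by \<open>- z\<close> reverses the sign of the symbol, so
  negative \<open>l\<close> reduces to the Laplace integral at rate \<open>- l\<close> along the
  opposite orbit.\<close>

lemma resolvent_neg:
  assumes l: "l < 0"
  shows "toeplitz_resolvent t (\<lambda>w. of_real (2 * sigma_t t w z)) (\<i> * of_real l)
    = op_scale t \<i> (weyl_op t (- z) (\<lambda>s. of_real (laplace (- l) s)))"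
proof -
  define G where "G f = weyl_int t (- z) (\<lambda>s. of_real (laplace (- l) s)) f" for f
  define R where "R f w = \<i> * G f w" for f w
  have l': "- l > 0" using l by simp
  have sig: "sigma_t t w (- z) = - sigma_t t w z" for w by (simp add: sigma_t_def tform_simps)
  have "toeplitz_resolvent t (\<lambda>w. of_real (2 * sigma_t t w z)) (\<i> * of_real l) = restrict R (fock t)"
  proof (rule toeplitz_resolvent_eqI)
    fix f assume f: "f \<in> fock t"
    note G = laplace_resolvent_equation[OF l' f, of "- z", folded G_def]
    have eq: "(\<lambda>w. of_real (2 * sigma_t t w z) * R f w) = (\<lambda>w. - \<i> * (of_real (2 * sigma_t t w (- z)) * G f w))"
      by (simp add: R_def sig fun_eq_iff)
    show "R f \<in> toeplitz_dom t (\<lambda>w. of_real (2 * sigma_t t w z))"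
      using G(1) unfolding toeplitz_dom_def mem_Collect_eq eq
      by (intro conjI L2_cmult) (auto simp: R_def[abs_def] fock_cmult)
    show "bproj t (\<lambda>w. of_real (2 * sigma_t t w z) * R f w) = (\<lambda>u. \<i> * of_real l * R f u - f u)"
      unfolding eq bproj_cmult G(2) by (simp add: R_def fun_eq_iff algebra_simps)
  qed (use l in auto)
  then show ?thesis
    by (auto simp: op_scale_def weyl_op_def R_def G_def restrict_def fun_eq_iff)
qed

end

section \<open>Resolvents and band-limited symbols generate the same algebra\<close>

definition halfline :: "(real \<Rightarrow> complex) \<Rightarrow> real \<Rightarrow> complex" where
  "halfline k s = (if 0 \<le> s then k s else 0)"

text \<open>The support is bounded on the right, since \<open>halfline\<close> discards negative
  arguments. Complex values make the class stable under multiplication by characters, as translation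
  of symbols demands.\<close>

definition cutoff_functions :: "(real \<Rightarrow> complex) set" where
  "cutoff_functions = {k. continuous_on UNIV k \<and> (\<exists>N. \<forall>s\<ge>N. k s = 0)}"

lemma halfline_supp:
  assumes "k \<in> cutoff_functions"
  obtains N where "\<And>s. N < \<bar>s\<bar> \<Longrightarrow> halfline k s = 0"
proof -
  obtain N where "\<forall>s\<ge>N. k s = 0" using assms by (auto simp: cutoff_functions_def)
  then show ?thesis by (intro that[of N]) (auto simp: halfline_def)
qed

lemma halfline_integrable:
  assumes "k \<in> cutoff_functions"
  shows "integrable lborel (halfline k)"
proof -
  obtain N where N: "\<forall>s\<ge>N. k s = 0" and k: "continuous_on UNIV k"
    using assms by (auto simp: cutoff_functions_def)
  have "set_integrable lborel {0..N} k"
    by (rule borel_integrable_atLeastAtMost'[OF continuous_on_subset[OF k]]) auto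
  moreover have "indicator {0..N} s *\<^sub>R k s = halfline k s" for s
    using N by (auto simp: halfline_def indicator_def)
  ultimately show ?thesis by (simp add: set_integrable_def)
qed

context weights
begin

lemma weyl_op_complexI:
  assumes A: "cstar_subalgebra t \<A>" and H: "integrable lborel H"
    and Re: "weyl_op t z (\<lambda>s. of_real (Re (H s))) \<in> \<A>" and Im: "weyl_op t z (\<lambda>s. of_real (Im (H s))) \<in> \<A>"
  shows "weyl_op t z H \<in> \<A>"
proof -
  have I: "integrable lborel (\<lambda>s. complex_of_real (Re (H s)))" "integrable lborel (\<lambda>s. complex_of_real (Im (H s)))"
    using H by simp_all
  have "op_add t (weyl_op t z (\<lambda>s. of_real (Re (H s)))) (op_scale t \<i> (weyl_op t z (\<lambda>s. of_real (Im (H s))))) \<in> \<A>"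
    using A Re Im by (simp add: cstar_subalgebra_def)
  then have "weyl_op t z (\<lambda>s. of_real (Re (H s)) + \<i> * of_real (Im (H s))) \<in> \<A>"
    using I by (simp add: weyl_op_scale weyl_op_add)
  moreover have "(\<lambda>s. of_real (Re (H s)) + \<i> * of_real (Im (H s))) = H"
    by (simp add: fun_eq_iff complex_eq_iff)
  ultimately show ?thesis by simp
qed

text \<open>In \<open>x = exp (- s)\<close> the factor \<open>laplace 1\<close> adds one to each
  exponent, so even the constant term has a positive rate of decay and falls under
  \<open>L\<close>.\<close>

lemma weyl_op_laplace_polynomial:
  assumes A: "cstar_subalgebra t \<A>"
    and L: "\<And>l. l > 0 \<Longrightarrow> weyl_op t z (\<lambda>s. of_real (laplace l s)) \<in> \<A>"
    and p: "real_polynomial_function p"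
  shows "integrable lborel (\<lambda>s. laplace 1 s * p (exp (- s)))"
    and "weyl_op t z (\<lambda>s. of_real (laplace 1 s * p (exp (- s)))) \<in> \<A>"
proof -
  obtain a n where p: "p = (\<lambda>x. \<Sum>i\<le>n. a i * x ^ i)"
    using p by (auto simp: real_polynomial_function_iff_sum)
  have lap: "laplace 1 s * exp (- s) ^ i = laplace (real (Suc i)) s" for i s
    by (simp add: laplace_def exp_of_nat_mult[symmetric] exp_add[symmetric] algebra_simps)
  have eq: "laplace 1 s * p (exp (- s)) = (\<Sum>i\<le>n. a i * laplace (real (Suc i)) s)" for s
    unfolding lap[symmetric] by (simp add: p sum_distrib_left mult.left_commute)
  have I: "integrable lborel (laplace (real (Suc i)))" for i
    by (rule laplace_integrable) simp
  show "integrable lborel (\<lambda>s. laplace 1 s * p (exp (- s)))"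
    unfolding eq by (intro Bochner_Integration.integrable_sum integrable_mult_right I)
  \<comment> \<open>Closure is available for binary sums, and \<open>weyl_op_add\<close> asks for
    integrable kernels, so the induction carries integrability along.\<close>
  have "integrable lborel (\<lambda>s. complex_of_real (\<Sum>i\<le>m. a i * laplace (real (Suc i)) s)) \<and>
     weyl_op t z (\<lambda>s. of_real (\<Sum>i\<le>m. a i * laplace (real (Suc i)) s)) \<in> \<A>" for m
  proof (induction m)
    case 0
    have "op_scale t (of_real (a 0)) (weyl_op t z (\<lambda>s. of_real (laplace (real (Suc 0)) s))) \<in> \<A>"
      using A L[of "real (Suc 0)"] by (simp add: cstar_subalgebra_def)
    then show ?case using I[of 0] by (simp add: weyl_op_scale)
  next
    case (Suc m)
    have "op_scale t (of_real (a (Suc m))) (weyl_op t z (\<lambda>s. of_real (laplace (real (Suc (Suc m))) s))) \<in> \<A>"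
      using A L[of "real (Suc (Suc m))"] by (simp add: cstar_subalgebra_def)
    then have "op_add t (weyl_op t z (\<lambda>s. of_real (\<Sum>i\<le>m. a i * laplace (real (Suc i)) s)))
        (weyl_op t z (\<lambda>s. of_real (a (Suc m)) * of_real (laplace (real (Suc (Suc m))) s))) \<in> \<A>"
      using A Suc by (simp add: cstar_subalgebra_def weyl_op_scale)
    moreover have "integrable lborel (\<lambda>s. complex_of_real (a (Suc m)) * of_real (laplace (real (Suc (Suc m))) s))"
      using I[of "Suc m"] by (intro integrable_mult_right integrable_of_real)
    ultimately show ?case
      using Suc by (simp add: weyl_op_add del: of_nat_Suc of_real_sum)
  qed
  then show "weyl_op t z (\<lambda>s. of_real (laplace 1 s * p (exp (- s)))) \<in> \<A>"
    unfolding eq by blast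
qed

text \<open>In the variable \<open>x = exp (- s)\<close> the functions \<open>laplace m\<close>, \<open>m \<ge> 1\<close>, span \<open>x\<close> times the polynomials,
  so the Weierstrass theorem makes them dense in \<open>L\<^sup>1(0,\<infinity>)\<close>.\<close>

lemma weyl_op_halfline_of_laplace:
  assumes A: "cstar_subalgebra t \<A>"
    and L: "\<And>l. l > 0 \<Longrightarrow> weyl_op t z (\<lambda>s. of_real (laplace l s)) \<in> \<A>"
    and k: "k \<in> cutoff_functions"
  shows "weyl_op t z (halfline k) \<in> \<A>"
proof -
  obtain N0 where N0: "\<forall>s\<ge>N0. k s = 0" and kc: "continuous_on UNIV k"
    using k by (auto simp: cutoff_functions_def)
  define N where "N = max N0 0"
  have N: "\<And>s. s \<ge> N \<Longrightarrow> k s = 0" "N \<ge> 0" using N0 by (auto simp: N_def)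
  have real: "weyl_op t z (\<lambda>s. of_real (h (halfline k s))) \<in> \<A>"
    if h: "bounded_linear h" for h :: "complex \<Rightarrow> real"
  proof -
    \<comment> \<open>\<open>K\<close> is \<open>h\<close> of \<open>k\<close> in the variable
      \<open>x = exp (- s)\<close>, divided by \<open>x\<close> to offset the weight
      \<open>laplace 1 s\<close>. The maximum removes the singularity at 0 and alters nothing: below
      \<open>exp (- N)\<close> the numerator is \<open>h (k N) = 0\<close>.\<close>
    define K where "K x = h (k (- ln (max x (exp (- N))))) / max x (exp (- N))" for x
    have pos: "max x (exp (- N)) > 0" for x :: real by (simp add: less_max_iff_disj)
    have "continuous_on {0..1} K"
      unfolding K_def using pos
      by (intro continuous_intros bounded_linear.continuous_on[OF h] continuous_on_compose2[OF kc])
         (auto simp: less_imp_neq[OF pos, symmetric])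
    then have "\<exists>p. real_polynomial_function p \<and> (\<forall>x\<in>{0..1}. \<bar>K x - p x\<bar> < 1 / real (Suc n))" for n
      using Stone_Weierstrass_real_polynomial_function[of "{0..1}" K "1 / real (Suc n)"] by (metis compact_Icc of_nat_0_less_iff zero_less_Suc zero_less_divide_1_iff)
    then obtain p where p: "\<And>n. real_polynomial_function (p n)"
        "\<And>n x. x \<in> {0..1} \<Longrightarrow> \<bar>K x - p n x\<bar> < 1 / real (Suc n)"
      by metis
    have hK: "h (halfline k s) = laplace 1 s * K (exp (- s))" for s
    proof (cases "0 \<le> s \<and> s \<le> N")
      case True
      then show ?thesis by (simp add: halfline_def laplace_def K_def max_absorb1)
    next
      case False
      then show ?thesis
        using N by (auto simp: halfline_def laplace_def K_def max_absorb2 linear_simps[OF h])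
    qed
    have lap: "integrable lborel (laplace 1)" by (rule laplace_integrable) simp
    note P = weyl_op_laplace_polynomial[OF A L p(1)]
    show ?thesis
    proof (rule weyl_op_closed[OF A])
      show "integrable lborel (\<lambda>s. complex_of_real (h (halfline k s)))"
        using integrable_bounded_linear[OF h halfline_integrable[OF k]] by simp
      show "integrable lborel (\<lambda>s. complex_of_real (laplace 1 s * p n (exp (- s))))" for n
        using P(1)[of n] by (rule integrable_of_real)
      show "weyl_op t z (\<lambda>s. complex_of_real (laplace 1 s * p n (exp (- s)))) \<in> \<A>" for n
        by (rule P(2))
      \<comment> \<open>A uniform error on \<open>{0..1}\<close> becomes an \<open>L^1\<close> error
        because the weight \<open>laplace 1\<close> is integrable.\<close>
      have le: "(LINT s|lborel. cmod (complex_of_real (laplace 1 s * p n (exp (- s))) - of_real (h (halfline k s))))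
          \<le> (LINT s|lborel. laplace 1 s) * (1 / real (Suc n))" for n
      proof -
        have "cmod (complex_of_real (laplace 1 s * p n (exp (- s))) - of_real (h (halfline k s))) \<le> laplace 1 s * (1 / real (Suc n))" for s
        proof -
          have "cmod (complex_of_real (laplace 1 s * p n (exp (- s))) - of_real (h (halfline k s)))
             = \<bar>laplace 1 s * (p n (exp (- s)) - K (exp (- s)))\<bar>"
            unfolding hK of_real_diff[symmetric] norm_of_real by (simp add: right_diff_distrib)
          also have "\<dots> = laplace 1 s * \<bar>K (exp (- s)) - p n (exp (- s))\<bar>"
            by (simp add: abs_mult abs_minus_commute)
          also have "\<dots> \<le> laplace 1 s * (1 / real (Suc n))"
          proof (cases "0 \<le> s")
            case True
            then show ?thesis
              by (intro mult_left_mono less_imp_le[OF p(2)]) auto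
          qed (simp add: laplace_def)
          finally show ?thesis .
        qed
        then have "(LINT s|lborel. cmod (complex_of_real (laplace 1 s * p n (exp (- s))) - of_real (h (halfline k s))))
          \<le> (LINT s|lborel. laplace 1 s * (1 / real (Suc n)))"
          using lap by (intro integral_mono_AE' always_eventually) (auto simp del: of_nat_Suc)
        then show ?thesis by (simp del: of_nat_Suc)
      qed
      have lim: "(\<lambda>n. (LINT s|lborel. laplace 1 s) * (1 / real (Suc n))) \<longlonglongrightarrow> 0"
        using tendsto_mult_right_zero[OF LIMSEQ_inverse_real_of_nat] by (simp add: inverse_eq_divide)
      show "(\<lambda>n. LINT s|lborel. cmod (complex_of_real (laplace 1 s * p n (exp (- s))) - of_real (h (halfline k s)))) \<longlonglongrightarrow> 0"
      proof (rule tendsto_sandwich[OF _ _ tendsto_const lim])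
        show "\<forall>\<^sub>F n in sequentially. 0 \<le> (LINT s|lborel. cmod (complex_of_real (laplace 1 s * p n (exp (- s))) - of_real (h (halfline k s))))"
          by simp
      qed (intro always_eventually allI le)
    qed
  qed
  show ?thesis
    by (rule weyl_op_complexI[OF A halfline_integrable[OF k] real[OF bounded_linear_Re] real[OF bounded_linear_Im]])
qed

text \<open>Linear cutoffs bring the exponential into the compactly supported class, and dominated
  convergence gives \<open>L^1\<close> convergence. Together with
  \<open>weyl_op_halfline_of_laplace\<close> this places both families of operators in the same
  subalgebras.\<close>

lemma weyl_op_laplace_of_halfline:
  assumes A: "cstar_subalgebra t \<A>" and l: "l > 0"
    and C: "\<And>k. k \<in> cutoff_functions \<Longrightarrow> weyl_op t z (halfline k) \<in> \<A>"
  shows "weyl_op t z (\<lambda>s. of_real (laplace l s)) \<in> \<A>"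
proof -
  \<comment> \<open>For negative \<open>s\<close> the cutoff exceeds 1, which
    \<open>halfline\<close> discards; on the half line it lies between 0 and 1 and tends to
    1.\<close>
  define k where "k n s = complex_of_real (exp (- (l * s)) * max 0 (1 - s / real (Suc n)))" for n s
  have k: "k n \<in> cutoff_functions" for n
    unfolding cutoff_functions_def k_def
    by (auto intro!: continuous_intros exI[of _ "real (Suc n)"] simp: field_simps)
  have lap: "integrable lborel (laplace l)" by (rule laplace_integrable[OF l])
  have [measurable]: "halfline (k n) \<in> borel_measurable lborel" for n
    using borel_measurable_integrable[OF halfline_integrable[OF k]] .
  have hk: "halfline (k n) s - of_real (laplace l s) = of_real (laplace l s * (max 0 (1 - s / real (Suc n)) - 1))" for n s
    by (simp add: halfline_def k_def laplace_def right_diff_distrib)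
  show ?thesis
  proof (rule weyl_op_closed[OF A _ halfline_integrable[OF k] C[OF k]])
    show "integrable lborel (\<lambda>s. complex_of_real (laplace l s))" using lap by (rule integrable_of_real)
    have "(\<lambda>n. LINT s|lborel. cmod (halfline (k n) s - of_real (laplace l s))) \<longlonglongrightarrow> (LINT s|(lborel :: real measure). 0 :: real)"
    proof (rule integral_dominated_convergence[where w = "laplace l"])
      show "integrable lborel (laplace l)" by (rule lap)
      show "AE s in lborel. (\<lambda>n. cmod (halfline (k n) s - of_real (laplace l s))) \<longlonglongrightarrow> 0"
      proof (rule AE_I2)
        fix s
        have "(\<lambda>n. s * inverse (real (Suc n))) \<longlonglongrightarrow> s * 0"
          by (intro tendsto_intros LIMSEQ_inverse_real_of_nat)
        then have "(\<lambda>n. s / real (Suc n)) \<longlonglongrightarrow> 0" by (simp add: divide_inverse)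
        then have "(\<lambda>n. cmod (of_real (laplace l s * (max 0 (1 - s / real (Suc n)) - 1)))) \<longlonglongrightarrow> cmod (of_real (laplace l s * (max 0 (1 - 0) - 1)))"
          by (intro tendsto_intros)
        then show "(\<lambda>n. cmod (halfline (k n) s - of_real (laplace l s))) \<longlonglongrightarrow> 0"
          unfolding hk by simp
      qed
      show "AE s in lborel. norm (cmod (halfline (k n) s - of_real (laplace l s))) \<le> laplace l s" for n
      proof (rule AE_I2)
        fix s
        have "\<bar>max 0 (1 - s / real (Suc n)) - 1\<bar> \<le> 1" if "0 \<le> s"
          using that divide_nonneg_nonneg[OF that, of "real (Suc n)"] by (auto simp: max_def)
        then have "laplace l s * \<bar>max 0 (1 - s / real (Suc n)) - 1\<bar> \<le> laplace l s"
          by (cases "0 \<le> s") (auto simp: laplace_def intro: mult_left_le)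
        then show "norm (cmod (halfline (k n) s - of_real (laplace l s))) \<le> laplace l s"
          unfolding hk norm_of_real by (simp add: abs_mult del: of_nat_Suc)
      qed
    qed measurable
    then show "(\<lambda>n. LINT s|lborel. cmod (halfline (k n) s - of_real (laplace l s))) \<longlonglongrightarrow> 0" by simp
  qed
qed

text \<open>Resolvents and Laplace integrals differ by the scalars \<open>- \<i>\<close> and
  \<open>\<i>\<close>. All \<open>z\<close> are taken together because a resolvent with negative
  \<open>l\<close> belongs to the direction \<open>- z\<close>.\<close>

lemma resolvents_iff_laplace:
  assumes A: "cstar_subalgebra t \<A>"
  shows "{toeplitz_resolvent t (\<lambda>w. of_real (2 * sigma_t t w z)) (\<i> * of_real l) | l z. l \<noteq> 0} \<subseteq> \<A>
    \<longleftrightarrow> (\<forall>z. \<forall>l>0. weyl_op t z (\<lambda>s. of_real (laplace l s)) \<in> \<A>)"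
proof -
  have scale: "op_scale t c B \<in> \<A>" if "B \<in> \<A>" for c B
    using A that by (simp add: cstar_subalgebra_def)
  show ?thesis
  proof (intro iffI allI impI subsetI)
    fix z l assume R: "{toeplitz_resolvent t (\<lambda>w. of_real (2 * sigma_t t w z)) (\<i> * of_real l) | l z. l \<noteq> 0} \<subseteq> \<A>"
      and l: "(l :: real) > 0"
    have "toeplitz_resolvent t (\<lambda>w. of_real (2 * sigma_t t w z)) (\<i> * of_real l) \<in> \<A>"
      using R l by force
    then have "op_scale t \<i> (op_scale t (- \<i>) (weyl_op t z (\<lambda>s. of_real (laplace l s)))) \<in> \<A>"
      unfolding resolvent_pos[OF l] by (rule scale)
    then show "weyl_op t z (\<lambda>s. of_real (laplace l s)) \<in> \<A>"
      by (simp add: weyl_op_scale)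
  next
    fix B assume W: "\<forall>z. \<forall>l>0. weyl_op t z (\<lambda>s. of_real (laplace l s)) \<in> \<A>"
      and "B \<in> {toeplitz_resolvent t (\<lambda>w. of_real (2 * sigma_t t w z)) (\<i> * of_real l) | l z. l \<noteq> 0}"
    then obtain l z where l: "l \<noteq> 0" and B: "B = toeplitz_resolvent t (\<lambda>w. of_real (2 * sigma_t t w z)) (\<i> * of_real l)"
      by blast
    show "B \<in> \<A>"
    proof (cases "l > 0")
      case True
      then show ?thesis unfolding B resolvent_pos[OF True] using W by (intro scale) auto
    next
      case False
      then have l: "l < 0" using l by simp
      show ?thesis unfolding B resolvent_neg[OF l] using W l by (intro scale) auto
    qed
  qed
qed

end

section \<open>The symbol space\<close>

lemma mem_cstar_generated:
  "B \<in> cstar_generated t S \<longleftrightarrow> (\<forall>\<A>. cstar_subalgebra t \<A> \<longrightarrow> S \<subseteq> \<A> \<longrightarrow> B \<in> \<A>)"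
  by (auto simp: cstar_generated_def hull_def)

section \<open>Bounded uniformly continuous symbols\<close>

lemma BUC_measurable: "f \<in> BUC \<Longrightarrow> f \<in> borel_measurable borel"
  by (auto simp: BUC_def intro!: borel_measurable_continuous_onI uniformly_continuous_imp_continuous)

lemma BUC_bounded:
  assumes "f \<in> BUC"
  obtains B where "\<And>w. cmod (f w) \<le> B"
  using assms by (auto simp: BUC_def bounded_iff)

lemma BUC_const: "(\<lambda>w. c) \<in> BUC"
  by (auto simp: BUC_def bounded_iff intro: uniformly_continuous_on_const)

lemma BUC_add:
  assumes f: "f \<in> BUC" and g: "g \<in> BUC"
  shows "(\<lambda>w. f w + g w) \<in> BUC"
proof -
  obtain B C where B: "\<And>w. cmod (f w) \<le> B" and C: "\<And>w. cmod (g w) \<le> C"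
    using BUC_bounded[OF f] BUC_bounded[OF g] by metis
  have "cmod (f w + g w) \<le> B + C" for w
    using norm_triangle_ineq[of "f w" "g w"] B[of w] C[of w] by linarith
  then show ?thesis
    using f g by (auto simp: BUC_def bounded_iff intro: uniformly_continuous_on_add)
qed

lemma BUC_cmult:
  assumes f: "f \<in> BUC"
  shows "(\<lambda>w. c * f w) \<in> BUC"
proof -
  obtain B where B: "\<And>w. cmod (f w) \<le> B" using BUC_bounded[OF f] by metis
  have "cmod (c * f w) \<le> cmod c * B" for w
    using B by (simp add: norm_mult mult_left_mono)
  moreover have "uniformly_continuous_on UNIV (\<lambda>w. c * f w)"
    using f by (intro bounded_linear.uniformly_continuous_on[OF bounded_linear_mult_right]) (simp add: BUC_def)
  ultimately show ?thesis by (auto simp: BUC_def bounded_iff)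
qed

lemma BUC_shift:
  assumes f: "f \<in> BUC"
  shows "shift v f \<in> BUC"
proof -
  have "uniformly_continuous_on UNIV (shift v f)"
    unfolding uniformly_continuous_on_def shift_def
  proof (intro allI impI)
    fix e :: real assume "e > 0"
    then obtain d where "d > 0" "\<And>x y. dist y x < d \<Longrightarrow> dist (f y) (f x) < e"
      using f uniformly_continuous_onE[of UNIV f e] by (auto simp: BUC_def)
    then show "\<exists>d>0. \<forall>x\<in>UNIV. \<forall>y\<in>UNIV. dist y x < d \<longrightarrow> dist (f (y - v)) (f (x - v)) < e"
      by (intro exI[of _ d]) (auto simp: dist_norm)
  qed
  then show ?thesis using f by (auto simp: BUC_def bounded_iff shift_def)
qed

lemma shift_shift: "shift v (shift w f) = shift (v + w) f"
  by (simp add: shift_def algebra_simps)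

text \<open>A translation of the oscillation is a phase that is a character in \<open>s\<close>, and
  the phase can be moved to the kernel.\<close>

lemma shift_weyl_symbol:
  "shift v (weyl_symbol t z H) = weyl_symbol t z (\<lambda>s. H s * exp (\<i> * of_real (s * (2 * sigma_t t v z))))"
  by (simp add: shift_def weyl_symbol_def osc_shift mult_ac fun_eq_iff)

context weights
begin

lemma toeplitz_dom_BUC: "f \<in> BUC \<Longrightarrow> toeplitz_dom t f = fock t"
  by (metis BUC_bounded BUC_measurable toeplitz_dom_bounded)

lemma toeplitz_BUC: "f \<in> BUC \<Longrightarrow> toeplitz t f = (\<lambda>g\<in>fock t. bproj t (\<lambda>w. f w * g w))"
  by (auto simp: toeplitz_apply toeplitz_dom_BUC fun_eq_iff restrict_def) (simp add: toeplitz_def toeplitz_dom_BUC)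

lemma BUC_mult_L2: "f \<in> BUC \<Longrightarrow> g \<in> fock t \<Longrightarrow> (\<lambda>w. f w * g w) \<in> L2_fun t"
  using toeplitz_dom_BUC[of f] by (auto simp: toeplitz_dom_def)

lemma toeplitz_add:
  assumes "f \<in> BUC" "g \<in> BUC"
  shows "toeplitz t (\<lambda>w. f w + g w) = op_add t (toeplitz t f) (toeplitz t g)"
  using assms by (auto simp: toeplitz_BUC BUC_add op_add_def fun_eq_iff restrict_def distrib_right bproj_add BUC_mult_L2)

lemma toeplitz_scale:
  assumes "f \<in> BUC"
  shows "toeplitz t (\<lambda>w. c * f w) = op_scale t c (toeplitz t f)"
  using assms by (auto simp: toeplitz_BUC BUC_cmult op_scale_def fun_eq_iff restrict_def mult.assoc bproj_cmult)

lemma toeplitz_zero: "toeplitz t (\<lambda>w. 0) = op_zero t"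
  by (auto simp: toeplitz_BUC BUC_const op_zero_def fun_eq_iff restrict_def bproj_def)

definition resolvent_symbols :: "(complex ^ 'n \<Rightarrow> complex) set" where
  "resolvent_symbols = {f \<in> BUC. \<forall>v. toeplitz t (shift v f) \<in> resolvent_algebra t}"

lemma resolvent_symbols_subspace: "complex_subspace resolvent_symbols"
proof -
  have zero: "op_zero t \<in> resolvent_algebra t"
    by (auto simp: resolvent_algebra_def mem_cstar_generated cstar_subalgebra_def)
  have add: "op_add t A B \<in> resolvent_algebra t" if "A \<in> resolvent_algebra t" "B \<in> resolvent_algebra t" for A B
    using that by (auto simp: resolvent_algebra_def mem_cstar_generated cstar_subalgebra_def)
  have scale: "op_scale t c A \<in> resolvent_algebra t" if "A \<in> resolvent_algebra t" for c A
    using that by (auto simp: resolvent_algebra_def mem_cstar_generated cstar_subalgebra_def)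
  have "shift v (\<lambda>w. 0) = (\<lambda>w. 0)" "shift v (\<lambda>w. f w + g w) = (\<lambda>w. shift v f w + shift v g w)"
      "shift v (\<lambda>w. c * f w) = (\<lambda>w. c * shift v f w)" for v c and f g :: "complex ^ 'n \<Rightarrow> complex"
    by (simp_all add: shift_def)
  then show ?thesis
    by (simp add: complex_subspace_def resolvent_symbols_def BUC_const BUC_add BUC_cmult BUC_shift
        toeplitz_zero toeplitz_add toeplitz_scale zero add scale)
qed

lemma resolvent_symbols_shift: "shift_invariant resolvent_symbols"
  by (auto simp: shift_invariant_def resolvent_symbols_def BUC_shift shift_shift)

text \<open>Every translate is again the symbol of a cutoff function, \<open>k\<close> times a
  character, so one density argument covers all translates. This makes the symbol space rich enough
  to recover the resolvents.\<close>

lemma weyl_symbol_in_resolvent_symbols: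
  assumes k: "k \<in> cutoff_functions"
  shows "weyl_symbol t z (halfline k) \<in> resolvent_symbols"
proof -
  have BUC: "weyl_symbol t z (halfline j) \<in> BUC" and T: "toeplitz t (weyl_symbol t z (halfline j)) = weyl_op t z (halfline j)"
    if "j \<in> cutoff_functions" for j
    using halfline_supp[OF that] weyl_symbol_BUC[OF halfline_integrable[OF that]]
      toeplitz_weyl_symbol[OF halfline_integrable[OF that]] by metis+
  have "toeplitz t (shift v (weyl_symbol t z (halfline k))) \<in> resolvent_algebra t" for v
  proof -
    define j where "j s = k s * exp (\<i> * of_real (s * (2 * sigma_t t v z)))" for s
    have j: "j \<in> cutoff_functions"
      using k unfolding cutoff_functions_def j_def by (auto intro!: continuous_intros)
    have "shift v (weyl_symbol t z (halfline k)) = weyl_symbol t z (halfline j)"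
    proof -
      have "(\<lambda>s. halfline k s * exp (\<i> * of_real (s * (2 * sigma_t t v z)))) = halfline j"
        by (auto simp: halfline_def j_def)
      then show ?thesis by (simp only: shift_weyl_symbol)
    qed
    moreover have "weyl_op t z (halfline j) \<in> resolvent_algebra t"
      unfolding resolvent_algebra_def mem_cstar_generated
      using weyl_op_halfline_of_laplace[OF _ _ j] resolvents_iff_laplace by blast
    ultimately show ?thesis by (simp add: T[OF j])
  qed
  then show ?thesis by (simp add: resolvent_symbols_def BUC[OF k])
qed

text \<open>One inclusion is built into the symbol space through the translate by 0. For the other,
  cutoff functions put their integrated Weyl operators into the Toeplitz algebra, and
  \<open>L^1\<close> limits of these give the Laplace integrals.\<close>

lemma resolvent_algebra_eq_toeplitz_algebra:
  "resolvent_algebra t = toeplitz_algebra t resolvent_symbols"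
proof (intro equalityI subsetI)
  fix B assume B: "B \<in> resolvent_algebra t"
  show "B \<in> toeplitz_algebra t resolvent_symbols"
    unfolding toeplitz_algebra_def mem_cstar_generated
  proof (intro allI impI)
    fix \<A> assume A: "cstar_subalgebra t \<A>" and T: "toeplitz t ` resolvent_symbols \<subseteq> \<A>"
    have "weyl_op t z (halfline k) \<in> \<A>" if k: "k \<in> cutoff_functions" for z k
    proof -
      obtain N where "\<And>s. N < \<bar>s\<bar> \<Longrightarrow> halfline k s = 0" using halfline_supp[OF k] by metis
      then have "toeplitz t (weyl_symbol t z (halfline k)) = weyl_op t z (halfline k)"
        by (rule toeplitz_weyl_symbol[OF halfline_integrable[OF k]])
      then show ?thesis using T weyl_symbol_in_resolvent_symbols[OF k, of z] by force
    qed
    then have "weyl_op t z (\<lambda>s. of_real (laplace l s)) \<in> \<A>" if "l > 0" for z l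
      using that by (intro weyl_op_laplace_of_halfline[OF A])
    then show "B \<in> \<A>"
      using B A resolvents_iff_laplace[OF A] by (simp add: resolvent_algebra_def mem_cstar_generated)
  qed
next
  fix B assume B: "B \<in> toeplitz_algebra t resolvent_symbols"
  show "B \<in> resolvent_algebra t"
    unfolding resolvent_algebra_def mem_cstar_generated
  proof (intro allI impI)
    fix \<A> assume A: "cstar_subalgebra t \<A>"
      and R: "{toeplitz_resolvent t (\<lambda>w. of_real (2 * sigma_t t w z)) (\<i> * of_real l) | l z. l \<noteq> 0} \<subseteq> \<A>"
    have "toeplitz t f \<in> \<A>" if "f \<in> resolvent_symbols" for f
    proof -
      have "toeplitz t (shift 0 f) \<in> resolvent_algebra t"
        using that by (simp add: resolvent_symbols_def)
      then show ?thesis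
        using A R by (simp add: shift_def resolvent_algebra_def mem_cstar_generated)
    qed
    then show "B \<in> \<A>"
      using B A by (auto simp: toeplitz_algebra_def mem_cstar_generated)
  qed
qed

end

theorem theorem4p10:
  fixes t :: "real ^ 'n"
  assumes "\<And>j. t $ j > 0"
  shows "\<exists>D0 :: (complex ^ 'n \<Rightarrow> complex) set.
           D0 \<subseteq> BUC \<and> complex_subspace D0 \<and> shift_invariant D0 \<and>
           resolvent_algebra t = toeplitz_algebra t D0"
proof -
  interpret weights t by standard (rule assms)
  have "resolvent_symbols \<subseteq> BUC"
    by (auto simp: resolvent_symbols_def)
  then show ?thesis
    using resolvent_symbols_subspace resolvent_symbols_shift resolvent_algebra_eq_toeplitz_algebra by blast
qed

end
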